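(* Let $f:\mathbb{R}\to\mathbb{R}$ be a linear combination of convex functions, with left derivative $f'_-$. Let $X\in\mathcal{X}^{\alpha}$ for some $\alpha\in(0,1)$ with $\alpha>\frac13$, let $0<\beta<\alpha\wedge(3\alpha-1)$, and let $Y=(Y_t)_{t\in[0,T]}$ be a process with $Y\in W_1^{1-\beta}$ (almost surely). Then for any sequence of partitions $\pi_n=\{0=u_0^n<\dots<u_{k(n)}^n=T\}$ with $|\pi_n|=\max_j|u_j^n-u_{j-1}^n|\to0$, $$\sum_{j=0}^{k(n)-1} f'_-(X_{u_j^n})\,(Y_{u_{j+1}^n}-Y_{u_j^n})\longrightarrow\int_0^T f'_-(X_u)\,dY_u\qquad(n\to\infty)$$ almost surely, where the right-hand side is the generalized Lebesgue--Stieltjes integral.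
   Context: Fix $T>0$. Fractional Besov spaces on $[0,T]$, for $0<\beta<1$: $W_1^\beta$ is the space of measurable $h:[0,T]\to\mathbb{R}$ with $$\|h\|_{1,\beta}=\sup_{0\le s<t\le T}\left(\frac{|h(t)-h(s)|}{(t-s)^\beta}+\int_s^t\frac{|h(u)-h(s)|}{(u-s)^{1+\beta}}\,du\right)<\infty,$$ and $W_2^\beta$ is the space of measurable $h$ with $$\|h\|_{2,\beta}=\int_0^T\frac{|h(s)|}{s^\beta}\,ds+\int_0^T\int_0^s\frac{|h(u)-h(s)|}{(s-u)^{1+\beta}}\,du\,ds<\infty .$$ Generalized Lebesgue--Stieltjes integral: for $h\in W_2^\beta$ and $g\in W_1^{1-\beta}$ and $t\in(0,T]$, it is the Lebesgue integral $$\int_0^t h(s)\,dg(s)=(-1)^\beta\int_0^t (D^\beta_{0+}h)(s)\,(D^{1-\beta}_{t-}g_{t-})(s)\,ds,\qquad g_{t-}(s)=g(s)-g(t-),$$ where $(-1)^\beta=e^{i\pi\beta}$ and $$(D^\beta_{0+}h)(s)=\frac{1}{\Gamma(1-\beta)}\left(\frac{h(s)}{s^\beta}+\beta\int_0^s\frac{h(s)-h(u)}{(s-u)^{\beta+1}}\,du\right),$$ $$(D^\beta_{t-}h)(s)=\frac{(-1)^{\beta}}{\Gamma(1-\beta)}\left(\frac{h(s)}{(t-s)^\beta}+\beta\int_s^t\frac{h(s)-h(u)}{(u-s)^{\beta+1}}\,du\right).$$ For stochastic processes the integral is taken path by path. Class $\mathcal{X}^\alpha$: for a centered Gaussian process $X=(X_t)_{t\in[0,T]}$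 put $R(t,s)=\mathbb{E}[X_tX_s]$, $W(t,s)=\mathbb{E}[(X_t-X_s)^2]$, $V(t)=\mathbb{E}[X_t^2]$ and $w^*(t)=\sup_{0\le s\le T-t}W(t+s,s)$. For $0<\alpha<1$, a centered continuous Gaussian process $X$ on $[0,T]$ belongs to $\mathcal{X}^\alpha$ if (i) $R(s,t)>0$ for all $s,t>0$; (ii) $w^*(t)=Ct^{2\alpha}+o(t^{2\alpha})$ as $t\to0$, for some $C>0$; (iii) there exist $c,\delta>0$ such that $V(s)\ge cs^2$ for $s\le\delta$; (iv) there exists $\delta>0$ such that $\sup_{0<t<2\delta}\sup_{t/2\le s\le t}\frac{R(s,s)}{R(t,s)}<\infty$. *)

theory Defs
  imports "HOL-Probability.Probability" "HOL-Library.Landau_Symbols"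
begin

(* Functions and processes on [0,T] are represented by total functions on the reals;
   every notion below only uses their values on {0..T}. *)

(* Extended nonnegative values, so that finiteness of the norm is a genuine condition;
   the integrand value at the singular endpoint is irrelevant (null set). *)

definition besov1_norm :: "real \<Rightarrow> real \<Rightarrow> (real \<Rightarrow> real) \<Rightarrow> ennreal" where
  "besov1_norm T \<beta> h =
     (SUP (s, t) \<in> {(s, t). 0 \<le> s \<and> s < t \<and> t \<le> T}.
        ennreal (\<bar>h t - h s\<bar> / (t - s) powr \<beta>) +
        (\<integral>\<^sup>+u\<in>{s..t}. ennreal (\<bar>h u - h s\<bar> / (u - s) powr (1 + \<beta>)) \<partial>lebesgue))"

definition besov2_norm :: "real \<Rightarrow> real \<Rightarrow> (real \<Rightarrow> real) \<Rightarrow> ennreal" where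
  "besov2_norm T \<beta> h =
     (\<integral>\<^sup>+s\<in>{0..T}. ennreal (\<bar>h s\<bar> / s powr \<beta>) \<partial>lebesgue) +
     (\<integral>\<^sup>+s\<in>{0..T}. (\<integral>\<^sup>+u\<in>{0..s}. ennreal (\<bar>h u - h s\<bar> / (s - u) powr (1 + \<beta>)) \<partial>lebesgue) \<partial>lebesgue)"

definition besov1 :: "real \<Rightarrow> real \<Rightarrow> (real \<Rightarrow> real) set" where
  "besov1 T \<beta> = {h. h \<in> borel_measurable (lebesgue_on {0..T}) \<and> besov1_norm T \<beta> h < \<infinity>}"

definition besov2 :: "real \<Rightarrow> real \<Rightarrow> (real \<Rightarrow> real) set" where
  "besov2 T \<beta> = {h. h \<in> borel_measurable (lebesgue_on {0..T}) \<and> besov2_norm T \<beta> h < \<infinity>}"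

(* cis (pi * \<beta>) is (-1)^\<beta> = e^{i pi \<beta>}. *)

definition frac_deriv_0plus :: "real \<Rightarrow> (real \<Rightarrow> real) \<Rightarrow> real \<Rightarrow> real" where
  "frac_deriv_0plus \<beta> h s =
     1 / Gamma (1 - \<beta>) *
       (h s / s powr \<beta> + \<beta> * (LINT u:{0..s}|lebesgue. (h s - h u) / (s - u) powr (\<beta> + 1)))"

definition frac_deriv_minus :: "real \<Rightarrow> real \<Rightarrow> (real \<Rightarrow> real) \<Rightarrow> real \<Rightarrow> complex" where
  "frac_deriv_minus \<beta> t h s =
     cis (pi * \<beta>) / complex_of_real (Gamma (1 - \<beta>)) *
       complex_of_real
         (h s / (t - s) powr \<beta> + \<beta> * (LINT u:{s..t}|lebesgue. (h s - h u) / (u - s) powr (\<beta> + 1)))"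

(* Meaningful for h \<in> besov2 T \<beta> and g \<in> besov1 T (1 - \<beta>), with 0 < t \<le> T; then g is continuous
   on {0..T}, so that the left limit g(t-) exists. *)

definition gls_integral :: "real \<Rightarrow> real \<Rightarrow> (real \<Rightarrow> real) \<Rightarrow> (real \<Rightarrow> real) \<Rightarrow> complex" where
  "gls_integral \<beta> t h g =
     cis (pi * \<beta>) *
       (LINT s:{0..t}|lebesgue. complex_of_real (frac_deriv_0plus \<beta> h s) *
          frac_deriv_minus (1 - \<beta>) t (\<lambda>r. g r - Lim (at_left t) g) s)"

(* Point masses count as (degenerate) Gaussian laws; e.g. X 0 may be constant. *)

definition gaussian_rv :: "'a measure \<Rightarrow> ('a \<Rightarrow> real) \<Rightarrow> bool" where
  "gaussian_rv M Z \<longleftrightarrow> Z \<in> borel_measurable M \<and>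
     (\<exists>\<mu>. (AE \<omega> in M. Z \<omega> = \<mu>) \<or>
          (\<exists>\<sigma>>0. distributed M lborel Z (\<lambda>x. ennreal (normal_density \<mu> \<sigma> x))))"

definition gaussian_process :: "'a measure \<Rightarrow> real set \<Rightarrow> (real \<Rightarrow> 'a \<Rightarrow> real) \<Rightarrow> bool" where
  "gaussian_process M I X \<longleftrightarrow>
     (\<forall>J a. finite J \<and> J \<subseteq> I \<longrightarrow> gaussian_rv M (\<lambda>\<omega>. \<Sum>t\<in>J. a t * X t \<omega>))"

definition centered_continuous_gaussian_process ::
    "'a measure \<Rightarrow> real \<Rightarrow> (real \<Rightarrow> 'a \<Rightarrow> real) \<Rightarrow> bool" where
  "centered_continuous_gaussian_process M T X \<longleftrightarrow>
     gaussian_process M {0..T} X \<and>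
     (\<forall>t\<in>{0..T}. (LINT \<omega>|M. X t \<omega>) = 0) \<and>
     (AE \<omega> in M. continuous_on {0..T} (\<lambda>t. X t \<omega>))"

definition cov_fun :: "'a measure \<Rightarrow> (real \<Rightarrow> 'a \<Rightarrow> real) \<Rightarrow> real \<Rightarrow> real \<Rightarrow> real" where
  "cov_fun M X t s = (LINT \<omega>|M. X t \<omega> * X s \<omega>)"

definition incr_var :: "'a measure \<Rightarrow> (real \<Rightarrow> 'a \<Rightarrow> real) \<Rightarrow> real \<Rightarrow> real \<Rightarrow> real" where
  "incr_var M X t s = (LINT \<omega>|M. (X t \<omega> - X s \<omega>)\<^sup>2)"

definition var_fun :: "'a measure \<Rightarrow> (real \<Rightarrow> 'a \<Rightarrow> real) \<Rightarrow> real \<Rightarrow> real" where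
  "var_fun M X t = (LINT \<omega>|M. (X t \<omega>)\<^sup>2)"

(* The supremum is over a bounded set: a Gaussian process with continuous paths is continuous
   in mean square, hence incr_var M X is bounded on {0..T} x {0..T}. *)

definition max_incr_var :: "'a measure \<Rightarrow> real \<Rightarrow> (real \<Rightarrow> 'a \<Rightarrow> real) \<Rightarrow> real \<Rightarrow> real" where
  "max_incr_var M T X t = (SUP s\<in>{0..T - t}. incr_var M X (t + s) s)"

definition class_X :: "'a measure \<Rightarrow> real \<Rightarrow> real \<Rightarrow> (real \<Rightarrow> 'a \<Rightarrow> real) \<Rightarrow> bool" where
  "class_X M T \<alpha> X \<longleftrightarrow>
     centered_continuous_gaussian_process M T X \<and>
     (\<forall>s\<in>{0<..T}. \<forall>t\<in>{0<..T}. cov_fun M X s t > 0) \<and>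
     (\<exists>C>0. (\<lambda>t. max_incr_var M T X t - C * t powr (2 * \<alpha>)) \<in> o[at_right 0](\<lambda>t. t powr (2 * \<alpha>))) \<and>
     (\<exists>c>0. \<exists>\<delta>>0. \<forall>s\<in>{0..T}. s \<le> \<delta> \<longrightarrow> var_fun M X s \<ge> c * s\<^sup>2) \<and>
     (\<exists>\<delta>>0. bdd_above {cov_fun M X s s / cov_fun M X t s | t s.
                         0 < t \<and> t < 2 * \<delta> \<and> t \<le> T \<and> t / 2 \<le> s \<and> s \<le> t})"

definition lin_comb_convex :: "(real \<Rightarrow> real) \<Rightarrow> bool" where
  "lin_comb_convex f \<longleftrightarrow>
     (\<exists>(m::nat) (a :: nat \<Rightarrow> real) (\<phi> :: nat \<Rightarrow> real \<Rightarrow> real).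
        (\<forall>i<m. convex_on UNIV (\<phi> i)) \<and> f = (\<lambda>x. \<Sum>i<m. a i * \<phi> i x))"

definition left_deriv :: "(real \<Rightarrow> real) \<Rightarrow> real \<Rightarrow> real" where
  "left_deriv f x = (THE D. (f has_real_derivative D) (at_left x))"

definition is_partition :: "real \<Rightarrow> nat \<Rightarrow> (nat \<Rightarrow> real) \<Rightarrow> bool" where
  "is_partition T k u \<longleftrightarrow> u 0 = 0 \<and> u k = T \<and> strict_mono_on {..k} u"

definition mesh :: "nat \<Rightarrow> (nat \<Rightarrow> real) \<Rightarrow> real" where
  "mesh k u = Max ((\<lambda>j. \<bar>u j - u (j - 1)\<bar>) ` {1..k})"

end

theory Submission imports Defs begin

text \<open>
The generalized Lebesgue--Stieltjes integral of \<open>h\<close> against \<open>g\<close> pairs the left-sided fractional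
derivative of \<open>h\<close> of order \<open>\<beta>\<close> with the right-sided one of \<open>g\<close> of order \<open>1 - \<beta>\<close>. For \<open>g\<close> in \<open>W\<^sub>1\<^bsup>1-\<beta>\<^esup>\<close> the
latter is bounded, so the integral is Lipschitz continuous in \<open>h\<close> for the norm of \<open>W\<^sub>2\<^sup>\<beta>\<close>
(\<open>pairing_diff_bound\<close>). For the step function \<open>h\<^sub>n\<close> with the values \<open>h (u\<^sub>j)\<close> on the cells of a partition it is the
Riemann--Stieltjes sum (\<open>pairing_step_function\<close>); this is the inversion of a fractional derivative by the
fractional integral of the same order (\<open>fractional_inversion\<close>), proved by truncating the singular
integral and recognising an approximate identity. It remains to show \<open>h\<^sub>n \<rightarrow> h\<close> in \<open>W\<^sub>2\<^sup>\<beta>\<close> for almost every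
path \<open>h = f'\<^sub>- \<circ> X\<close>. Since the mesh may tend to zero arbitrarily slowly, estimates of expectations for
each partition do not suffice; there must be one bound, valid path by path, for all partitions.

Suppose that \<open>h\<close> is bounded and its increments satisfy \<open>\<bar>h s - h x\<bar> \<le> \<Delta> s \<bar>s - x\<bar>\<close>, where \<open>\<Delta>\<close> increases in its second
argument and \<open>\<integral>\<integral> \<Delta> s r r\<^bsup>-1-\<beta>\<^esup> dr ds\<close> is finite. Then \<open>h\<close> belongs to \<open>W\<^sub>2\<^sup>\<beta>\<close>, and the distance of \<open>h\<^sub>n\<close> from \<open>h\<close> is at
most a constant times the part of this double integral with \<open>r\<close> below twice the mesh
(\<open>besov2_norm_step_error\<close>), which vanishes in the limit. Pairs of points in one cell contribute
increments of \<open>h\<close> at scales below the mesh; for pairs in different cells the kernel integrates to the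
distance of a point from an end of its cell to the power \<open>-\<beta>\<close>, and the monotonicity of \<open>\<Delta>\<close> turns this
power back into an integral over scales (\<open>osc_weight_le\<close>).

To find such a \<open>\<Delta>\<close>, note that the increments of \<open>f'\<^sub>-\<close> are dominated by those of an increasing function
\<open>m\<close>. Almost every path of \<open>X\<close> is Hoelder continuous with some constant \<open>K\<close> and any exponent \<open>a < \<alpha>\<close>, by
Kolmogorov's argument and the Gaussian moments (\<open>AE_holder_paths\<close>). Therefore
\<open>\<Delta> s r = m (X\<^sub>s + K r\<^sup>a) - m (X\<^sub>s - K r\<^sup>a)\<close> is admissible, with \<open>m\<close> frozen outside a bounded interval that
contains the path. For fixed \<open>K\<close> its expectation only involves the law of \<open>X\<^sub>s\<close>, whose density is at most
a multiple of \<open>1 / s\<close> because the variance is at least of the order of \<open>s\<^sup>2\<close>. The integral over the line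
of the difference of two translates of a bounded increasing function is at most proportional to the
shift, so \<open>E (\<Delta> s r)\<close> is of the order \<open>min 1 (r\<^sup>a / s) \<le> r\<^bsup>ap\<^esup> s\<^bsup>-p\<^esup>\<close> for every \<open>p\<close> in \<open>(0, 1]\<close>. Choosing
\<open>\<beta> < a < \<alpha>\<close> and \<open>\<beta> / a < p < 1\<close> makes the expected double integral finite (\<open>AE_osc_mass_finite\<close>).
\<close>


section \<open>Left derivatives of linear combinations of convex functions\<close>

text \<open>
The slopes of the chords ending at \<open>x\<close> increase as their left end point approaches \<open>x\<close>, so the left
derivative is their supremum; it is finite because the slope of any chord to the right of \<open>x\<close> is a
bound, and the same comparison of chords shows that it increases with \<open>x\<close>.
\<close>

lemma convex_left_deriv_exists:
  fixes \<phi> :: "real \<Rightarrow> real"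
  assumes cv: "convex_on UNIV \<phi>"
  shows "\<exists>D. mono D \<and> (\<forall>x. (\<phi> has_real_derivative D x) (at_left x))"
proof -
  define q where "q = (\<lambda>x y. (\<phi> x - \<phi> y) / (x - y))"
  have slopes: "q y z \<le> q x z" "q x z \<le> q x y" if "z < y" "y < x" for x y z :: real
    using convex_on_slope_le[OF cv, of z x y] that
    unfolding q_def by (auto simp: field_simps)
  define D where "D = (\<lambda>x. Sup (q x ` {..<x}))"
  have bdd: "bdd_above (q x ` {..<x})" for x
  proof (rule bdd_aboveI2)
    fix y assume "y \<in> {..<x}"
    then have "q x y \<le> q (x+1) y" "q (x+1) y \<le> q (x+1) x"
      using slopes[of y x "x+1"] by auto
    then show "q x y \<le> q (x+1) x" by linarith
  qed
  have upper: "q x y \<le> D x" if "y < x" for x y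
    unfolding D_def using bdd that by (intro cSUP_upper) auto
  have "mono D"
  proof (rule monoI)
    fix x x' :: real assume "x \<le> x'"
    show "D x \<le> D x'"
    proof (cases "x = x'")
      case False
      then have lt: "x < x'" using \<open>x \<le> x'\<close> by simp
      have "q x y \<le> D x'" if "y < x" for y
        using slopes(1)[of y x x'] upper[of y x'] that lt by linarith
      then show ?thesis
        by (subst D_def) (intro cSUP_least, auto)
    qed simp
  qed
  moreover have "(\<phi> has_real_derivative D x) (at_left x)" for x
  proof -
    have "((\<lambda>y. q x y) \<longlongrightarrow> D x) (at_left x)"
    proof (rule increasing_tendsto)
      show "\<forall>\<^sub>F y in at_left x. q x y \<le> D x"
        using upper by (auto simp: eventually_at_filter intro!: always_eventually)
    next
      fix l assume "l < D x"
      then obtain y where y: "y < x" "l < q x y"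
        unfolding D_def using less_cSUP_iff[OF _ bdd[of x]] by auto
      have "l < q x z" if "y < z" "z < x" for z
        using slopes(2)[of y z x] y that by linarith
      then show "\<forall>\<^sub>F z in at_left x. l < q x z"
        using eventually_at_left[of y x] y(1) by blast
    qed
    moreover have "q x = (\<lambda>y. (\<phi> y - \<phi> x) / (y - x))"
      unfolding q_def by (rule ext) (metis minus_diff_eq minus_divide_divide)
    ultimately show ?thesis
      unfolding has_field_derivative_iff by simp
  qed
  ultimately show ?thesis by blast
qed

lemma left_deriv_eq:
  assumes "(f has_real_derivative D) (at_left x)"
  shows "left_deriv f x = D"
  unfolding left_deriv_def
  using assms
  by (intro the_equality) (auto simp: has_field_derivative_iff intro: tendsto_unique[OF trivial_limit_at_left_real])

text \<open>
If \<open>f = \<Sum> a\<^sub>i \<phi>\<^sub>i\<close>, then \<open>m = \<Sum> \<bar>a\<^sub>i\<bar> (\<phi>\<^sub>i)'\<^sub>-\<close> is increasing and its increments dominate those of the left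
derivative of \<open>f\<close>. All later estimates on the integrand only see this one monotone function.
\<close>

lemma left_deriv_lin_comb_convex:
  assumes "lin_comb_convex f"
  shows "\<exists>m. mono m \<and> (\<forall>x y. \<bar>left_deriv f x - left_deriv f y\<bar> \<le> \<bar>m x - m y\<bar>)"
    and "left_deriv f \<in> borel_measurable borel"
proof -
  obtain n :: nat and a :: "nat \<Rightarrow> real" and \<phi> :: "nat \<Rightarrow> real \<Rightarrow> real"
    where cv: "\<And>i. i < n \<Longrightarrow> convex_on UNIV (\<phi> i)"
    and f: "f = (\<lambda>x. \<Sum>i<n. a i * \<phi> i x)"
    using assms unfolding lin_comb_convex_def by blast
  have "\<exists>D. i < n \<longrightarrow> mono D \<and> (\<forall>x. (\<phi> i has_real_derivative D x) (at_left x))" for i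
    using convex_left_deriv_exists[OF cv, of i] by blast
  then obtain D where mono: "\<And>i. i < n \<Longrightarrow> mono (D i)"
    and D: "\<And>i x. i < n \<Longrightarrow> (\<phi> i has_real_derivative D i x) (at_left x)"
    by metis
  have ld: "left_deriv f = (\<lambda>x. \<Sum>i<n. a i * D i x)"
    by (rule ext, rule left_deriv_eq) (auto simp: f intro!: DERIV_sum DERIV_cmult D)
  show "left_deriv f \<in> borel_measurable borel"
    unfolding ld by (intro borel_measurable_sum borel_measurable_times borel_measurable_const borel_measurable_mono mono) auto
  define m where "m = (\<lambda>x. \<Sum>i<n. \<bar>a i\<bar> * D i x)"
  have le: "\<bar>left_deriv f x - left_deriv f y\<bar> \<le> m y - m x" if "x \<le> y" for x y
  proof -
    have "\<bar>left_deriv f x - left_deriv f y\<bar> = \<bar>\<Sum>i<n. a i * (D i x - D i y)\<bar>"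
      unfolding ld by (simp add: sum_subtractf right_diff_distrib)
    also have "\<dots> \<le> (\<Sum>i<n. \<bar>a i\<bar> * (D i y - D i x))"
      using mono that
      by (intro order_trans[OF sum_abs] sum_mono) (auto simp: abs_mult mono_def intro!: mult_left_mono)
    also have "\<dots> = m y - m x"
      unfolding m_def by (simp add: sum_subtractf right_diff_distrib)
    finally show ?thesis .
  qed
  have "mono m"
    unfolding m_def mono_def using mono by (auto intro!: sum_mono mult_left_mono simp: mono_def)
  moreover have "\<bar>left_deriv f x - left_deriv f y\<bar> \<le> \<bar>m x - m y\<bar>" for x y
    using le[of x y] le[of y x] by (cases "x \<le> y") auto
  ultimately show "\<exists>m. mono m \<and> (\<forall>x y. \<bar>left_deriv f x - left_deriv f y\<bar> \<le> \<bar>m x - m y\<bar>)"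
    by blast
qed

section \<open>Power integrals and the inversion kernel\<close>

lemma has_bochner_integral_nonneg_has_integral:
  fixes f :: "real \<Rightarrow> real"
  assumes "f \<in> borel_measurable borel" "A \<in> sets borel" "\<And>x. x \<in> A \<Longrightarrow> 0 \<le> f x"
    and I: "(f has_integral I) A"
  shows "has_bochner_integral lborel (\<lambda>x. indicator A x * f x) I"
proof (rule has_bochner_integral_nn_integral)
  show "0 \<le> I" using has_integral_nonneg[OF I] assms(3) by blast
  show "(\<integral>\<^sup>+x. ennreal (indicator A x * f x) \<partial>lborel) = ennreal I"
    using nn_integral_has_integral_lebesgue[of A f I] assms(3) I by blast
qed (use assms in \<open>auto simp: indicator_def\<close>)

lemma has_bochner_integral_powr_near_0:
  assumes p: "(0::real) < p" and c: "0 \<le> c"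
  shows "has_bochner_integral lborel (\<lambda>r. indicator {0<..<c} r * r powr (p - 1)) (c powr p / p)"
proof (rule has_bochner_integral_nonneg_has_integral)
  have "((\<lambda>x. x powr (p - 1)) has_integral (c powr p / p)) {0..c}"
    using has_integral_powr_from_0[of "p-1" c] assms by simp
  then show "((\<lambda>x. x powr (p - 1)) has_integral (c powr p / p)) {0<..<c}"
    by (simp add: has_integral_Icc_iff_Ioo)
qed auto

lemma has_bochner_integral_powr_tail:
  assumes p: "(0::real) < p" and c: "0 < c"
  shows "has_bochner_integral lborel (\<lambda>r. indicator {c<..} r * r powr (-1 - p)) (c powr (-p) / p)"
proof (rule has_bochner_integral_nonneg_has_integral)
  have "((\<lambda>x. x powr (-1 - p)) has_integral - (c powr (- 1 - p + 1)) / (- 1 - p + 1)) {c..}"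
    using has_integral_powr_to_inf[of "-1-p" c] assms by simp
  then have "((\<lambda>x. x powr (-1 - p)) has_integral (c powr (-p) / p)) {c..}"
    using p by simp
  then show "((\<lambda>x. x powr (-1 - p)) has_integral (c powr (-p) / p)) {c<..}"
    by (subst has_integral_spike_set_eq[of _ "{c..}"]) (auto intro: negligible_subset[of "{c}"])
qed auto

text \<open>
The kernel that comes out when a truncated fractional derivative of order \<open>\<gamma>\<close> is integrated to the
same order: its rescalings form an approximate identity.
\<close>

definition frac_kernel :: "real \<Rightarrow> real \<Rightarrow> real" where
  "frac_kernel \<gamma> y = indicator {0<..} y * ((y powr \<gamma> - (max 0 (y - 1)) powr \<gamma>) / y)"

lemma frac_kernel_nonneg: "0 < \<gamma> \<Longrightarrow> 0 \<le> frac_kernel \<gamma> y"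
  unfolding frac_kernel_def by (auto simp: indicator_def intro!: divide_nonneg_nonneg powr_mono2)

lemma measurable_frac_kernel [measurable]: "frac_kernel \<gamma> \<in> borel_measurable borel"
  unfolding frac_kernel_def by measurable

text \<open>
For \<open>y > 0\<close>, substituting \<open>z = w y\<close> in \<open>y\<^sup>\<gamma> - (y - 1)\<^sub>+\<^sup>\<gamma> = \<integral> \<gamma> z\<^bsup>\<gamma>-1\<^esup> dz\<close> over \<open>(y - 1)\<^sub>+ < z < y\<close> displays the
kernel as an integral over \<open>w \<in> (0, 1)\<close> with the constraint \<open>y (1 - w) < 1\<close>. Integrating over \<open>y\<close> first
leaves the Beta integral of \<open>w\<^bsup>\<gamma>-1\<^esup> (1 - w)\<^bsup>-\<gamma>\<^esup>\<close>.
\<close>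

lemma frac_kernel_mass:
  assumes \<gamma>: "0 < \<gamma>" "\<gamma> < 1"
  shows "has_bochner_integral lborel (frac_kernel \<gamma>) (Gamma \<gamma> * Gamma (1 - \<gamma>))"
proof (rule has_bochner_integral_nn_integral)
  let ?F = "\<lambda>y w. ennreal (indicator {0<..} y * indicator {0<..<1} w *
      (if y * (1 - w) < 1 then \<gamma> * w powr (\<gamma> - 1) * y powr (\<gamma> - 1) else 0))"
  have inner1: "(\<integral>\<^sup>+w. ?F y w \<partial>lborel) = ennreal (frac_kernel \<gamma> y)" for y :: real
  proof (cases "y > 0")
    case True
    define w0 where "w0 = max 0 (1 - 1 / y)"
    have w0: "0 \<le> w0" "w0 \<le> 1" using True by (auto simp: w0_def)
    have "((\<lambda>w. \<gamma> * w powr (\<gamma> - 1)) has_integral 1 powr \<gamma> - w0 powr \<gamma>) {w0..1}"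
    proof (rule fundamental_theorem_of_calculus_interior)
      show "continuous_on {w0..1} (\<lambda>w. w powr \<gamma>)"
        using w0 \<gamma> by (intro continuous_on_powr') (auto intro!: continuous_intros)
      fix w assume "w \<in> {w0<..<1}"
      then have "w > 0" using w0 by auto
      then show "((\<lambda>w. w powr \<gamma>) has_vector_derivative \<gamma> * w powr (\<gamma> - 1)) (at w)"
        unfolding has_real_derivative_iff_has_vector_derivative[symmetric]
        by (auto intro!: derivative_eq_intros)
    qed (use w0 in auto)
    then have hi: "((\<lambda>w. \<gamma> * w powr (\<gamma> - 1)) has_integral 1 - w0 powr \<gamma>) {w0<..<1}"
      by (simp add: has_integral_Icc_iff_Ioo)
    have "(\<integral>\<^sup>+w. ?F y w \<partial>lborel)
        = (\<integral>\<^sup>+w. ennreal (y powr (\<gamma> - 1)) * ennreal (indicator {w0<..<1} w * (\<gamma> * w powr (\<gamma> - 1))) \<partial>lborel)"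
    proof (intro nn_integral_cong)
      fix w :: real
      have "y * (1 - w) < 1 \<longleftrightarrow> w > 1 - 1 / y" using True by (auto simp: field_simps)
      then show "?F y w = ennreal (y powr (\<gamma> - 1)) * ennreal (indicator {w0<..<1} w * (\<gamma> * w powr (\<gamma> - 1)))"
        using True \<gamma> by (auto simp: w0_def indicator_def ennreal_mult[symmetric] mult_ac)
    qed
    also have "\<dots> = ennreal (y powr (\<gamma> - 1)) * ennreal (1 - w0 powr \<gamma>)"
      by (subst nn_integral_cmult, measurable)
         (subst nn_integral_has_integral_lebesgue[OF _ hi], use w0 \<gamma> in auto)
    also have "\<dots> = ennreal (y powr (\<gamma> - 1) * (1 - w0 powr \<gamma>))"
      using w0 \<gamma> by (subst ennreal_mult) (auto intro!: powr_le1)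
    also have "y powr (\<gamma> - 1) * (1 - w0 powr \<gamma>) = frac_kernel \<gamma> y"
    proof -
      have "max 0 (y - 1) = y * w0" using True by (auto simp: w0_def max_def field_simps)
      then show ?thesis
        using True w0 by (simp add: frac_kernel_def powr_mult powr_diff field_simps)
    qed
    finally show ?thesis .
  qed (simp add: frac_kernel_def)
  have inner2: "(\<integral>\<^sup>+y. ?F y w \<partial>lborel) = ennreal (indicator {0<..<1} w * (w powr (\<gamma> - 1) * (1 - w) powr (1 - \<gamma> - 1)))"
    for w :: real
  proof (cases "w \<in> {0<..<1}")
    case True
    have "(\<integral>\<^sup>+y. ?F y w \<partial>lborel)
        = (\<integral>\<^sup>+y. ennreal (\<gamma> * w powr (\<gamma> - 1)) * ennreal (indicator {0<..<1/(1-w)} y * y powr (\<gamma> - 1)) \<partial>lborel)"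
      using True \<gamma> by (intro nn_integral_cong) (auto simp: indicator_def ennreal_mult[symmetric] field_simps)
    also have "\<dots> = ennreal (\<gamma> * w powr (\<gamma> - 1)) * ennreal ((1/(1-w)) powr \<gamma> / \<gamma>)"
      using has_bochner_integral_powr_near_0[of \<gamma> "1/(1-w)"] True \<gamma>
      by (subst nn_integral_cmult, measurable)
         (subst nn_integral_eq_integral, auto dest: has_bochner_integral_integral_eq intro: has_bochner_integral_integrable simp: has_bochner_integral_iff)
    also have "\<dots> = ennreal (w powr (\<gamma> - 1) * (1 - w) powr (1 - \<gamma> - 1))"
      using True \<gamma> by (subst ennreal_mult[symmetric]) (auto simp: powr_divide powr_minus field_simps)
    finally show ?thesis using True by simp
  qed simp
  have "((\<lambda>t. t powr (\<gamma> - 1) * (1 - t) powr (1 - \<gamma> - 1)) has_integral Beta \<gamma> (1 - \<gamma>)) {0<..<1}"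
    using has_integral_Beta_real[of \<gamma> "1-\<gamma>"] \<gamma> by (simp add: has_integral_Icc_iff_Ioo)
  moreover have "Beta \<gamma> (1 - \<gamma>) = Gamma \<gamma> * Gamma (1 - \<gamma>)" by (simp add: Beta_def)
  ultimately have "(\<integral>\<^sup>+w. ennreal (indicator {0<..<1} w * (w powr (\<gamma> - 1) * (1 - w) powr (1 - \<gamma> - 1))) \<partial>lborel)
       = ennreal (Gamma \<gamma> * Gamma (1 - \<gamma>))"
    by (subst nn_integral_has_integral_lebesgue) auto
  moreover have "(\<integral>\<^sup>+y. (\<integral>\<^sup>+w. ?F y w \<partial>lborel) \<partial>lborel) = (\<integral>\<^sup>+w. (\<integral>\<^sup>+y. ?F y w \<partial>lborel) \<partial>lborel)"
    by (rule lborel_pair.Fubini') measurable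
  ultimately show "(\<integral>\<^sup>+y. ennreal (frac_kernel \<gamma> y) \<partial>lborel) = ennreal (Gamma \<gamma> * Gamma (1 - \<gamma>))"
    by (simp add: inner1 inner2)
  show "0 \<le> Gamma \<gamma> * Gamma (1 - \<gamma>)" using \<gamma> by (auto intro!: mult_nonneg_nonneg Gamma_real_nonneg)
qed (use \<gamma> in \<open>auto simp: frac_kernel_nonneg\<close>)

text \<open>
The integrand has the elementary antiderivative \<open>- ((x - r) / r)\<^sup>\<gamma> / (\<gamma> x)\<close>.
\<close>

lemma kernel_convolution:
  assumes \<gamma>: "0 < \<gamma>" "\<gamma> < 1" and e: "0 < \<epsilon>" "\<epsilon> < x"
  shows "(\<integral>\<^sup>+r. ennreal (indicator {\<epsilon><..<x} r * ((x - r) powr (\<gamma> - 1) * r powr (-1 - \<gamma>))) \<partial>lborel)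
     = ennreal ((x - \<epsilon>) powr \<gamma> / (\<gamma> * x * \<epsilon> powr \<gamma>))"
proof -
  define F where "F = (\<lambda>r. - (((x - r) / r) powr \<gamma> / (\<gamma> * x)))"
  have "((\<lambda>r. (x - r) powr (\<gamma> - 1) * r powr (-1 - \<gamma>)) has_integral F x - F \<epsilon>) {\<epsilon>..x}"
  proof (rule fundamental_theorem_of_calculus_interior)
    show "continuous_on {\<epsilon>..x} F" unfolding F_def
      using e \<gamma> by (intro continuous_intros continuous_on_powr') auto
    fix r assume r: "r \<in> {\<epsilon><..<x}"
    then have pos: "0 < r" "0 < x - r" using e by auto
    have "(F has_real_derivative - (\<gamma> * ((x - r) / r) powr (\<gamma> - 1) * (- x / r\<^sup>2) / (\<gamma> * x))) (at r)"
      unfolding F_def using pos \<gamma> e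
      by (auto intro!: derivative_eq_intros simp: power2_eq_square field_simps)
    moreover have "- (\<gamma> * ((x - r) / r) powr (\<gamma> - 1) * (- x / r\<^sup>2) / (\<gamma> * x)) = (x - r) powr (\<gamma> - 1) * r powr (-1 - \<gamma>)"
    proof -
      have "r powr (-1-\<gamma>) = inverse (r powr (\<gamma> - 1)) * inverse (r\<^sup>2)"
        using pos by (simp add: powr_minus[symmetric] powr_numeral[symmetric] powr_add[symmetric] del: powr_numeral)
      then show ?thesis using pos \<gamma> e by (simp add: powr_divide field_simps)
    qed
    ultimately show "(F has_vector_derivative (x - r) powr (\<gamma> - 1) * r powr (-1 - \<gamma>)) (at r)"
      by (simp add: has_real_derivative_iff_has_vector_derivative)
  qed (use e in auto)
  moreover have "F x - F \<epsilon> = (x - \<epsilon>) powr \<gamma> / (\<gamma> * x * \<epsilon> powr \<gamma>)"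
    unfolding F_def using e \<gamma> by (simp add: powr_divide field_simps)
  ultimately have "((\<lambda>r. (x - r) powr (\<gamma> - 1) * r powr (-1 - \<gamma>)) has_integral (x - \<epsilon>) powr \<gamma> / (\<gamma> * x * \<epsilon> powr \<gamma>)) {\<epsilon><..<x}"
    by (simp add: has_integral_Icc_iff_Ioo)
  then show ?thesis by (subst nn_integral_has_integral_lebesgue) auto
qed

section \<open>Inversion of the fractional integral\<close>

text \<open>
Cutting the singular integral off at \<open>r > \<epsilon>\<close> makes the two parts of \<open>H q - H (q + r)\<close> separately
integrable. In the second part the substitution \<open>x = q + r\<close> and Fubini collect everything in front of
\<open>H x\<close>, where \<open>kernel_convolution\<close> evaluates the remaining integral over \<open>r\<close>.
\<close>

lemma truncated_inversion:
  fixes H :: "real \<Rightarrow> real"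
  assumes \<gamma>: "0 < \<gamma>" "\<gamma> < 1" and e: "0 < \<epsilon>" and L: "0 \<le> L"
    and [measurable]: "H \<in> borel_measurable borel"
    and bd: "\<And>x. \<bar>H x\<bar> \<le> B" and zero: "\<And>x. L \<le> x \<Longrightarrow> H x = 0"
  shows "(LINT q|lborel. indicator {0<..} q * (q powr (\<gamma> - 1) *
            (\<gamma> * (LINT r|lborel. indicator {\<epsilon><..} r * ((H q - H (q + r)) * r powr (-1 - \<gamma>))))))
       = (LINT y|lborel. H (\<epsilon> * y) * frac_kernel \<gamma> y)"
proof -
  let ?c = "\<lambda>x. H x * (indicator {\<epsilon><..} x * ((x - \<epsilon>) powr \<gamma> / (\<gamma> * x * \<epsilon> powr \<gamma>)))"
  have B: "0 \<le> B" using bd[of 0] by linarith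
  define f where "f = (\<lambda>q r. indicator {0<..} q * indicator {\<epsilon><..} r * (q powr (\<gamma> - 1) * r powr (-1 - \<gamma>)) * H (q + r))"
  have [measurable]: "case_prod f \<in> borel_measurable (lborel \<Otimes>\<^sub>M lborel)" unfolding f_def by measurable
  have tail: "has_bochner_integral lborel (\<lambda>r. indicator {\<epsilon><..} r * r powr (-1 - \<gamma>)) (\<epsilon> powr (-\<gamma>) / \<gamma>)"
    using has_bochner_integral_powr_tail[of \<gamma> \<epsilon>] \<gamma> e by simp
  have near0: "integrable lborel (\<lambda>q. indicator {0<..<L} q * q powr (\<gamma> - 1))"
    using has_bochner_integral_powr_near_0[of \<gamma> L] \<gamma> L by (auto simp: has_bochner_integral_iff)
  have int_r: "integrable lborel (\<lambda>r. indicator {\<epsilon><..} r * (H (q + r) * r powr (-1 - \<gamma>)))" for q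
  proof (rule Bochner_Integration.integrable_bound)
    show "integrable lborel (\<lambda>r. B * (indicator {\<epsilon><..} r * r powr (-1 - \<gamma>)))"
      using tail by (auto simp: has_bochner_integral_iff)
  qed (use bd B in \<open>auto simp: indicator_def abs_mult intro!: mult_right_mono\<close>)
  have inner: "\<gamma> * (LINT r|lborel. indicator {\<epsilon><..} r * ((H q - H (q + r)) * r powr (-1 - \<gamma>)))
      = H q * \<epsilon> powr (-\<gamma>) - \<gamma> * (LINT r|lborel. indicator {\<epsilon><..} r * (H (q + r) * r powr (-1 - \<gamma>)))" for q
  proof -
    have "(LINT r|lborel. indicator {\<epsilon><..} r * ((H q - H (q + r)) * r powr (-1 - \<gamma>)))
       = (LINT r|lborel. H q * (indicator {\<epsilon><..} r * r powr (-1 - \<gamma>)) - indicator {\<epsilon><..} r * (H (q + r) * r powr (-1 - \<gamma>)))"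
      by (intro Bochner_Integration.integral_cong) (auto simp: algebra_simps)
    also have "\<dots> = H q * (\<epsilon> powr (-\<gamma>) / \<gamma>) - (LINT r|lborel. indicator {\<epsilon><..} r * (H (q + r) * r powr (-1 - \<gamma>)))"
      using tail int_r[of q] by (simp add: has_bochner_integral_iff)
    finally show ?thesis using \<gamma> by (simp add: field_simps)
  qed
  have conv: "has_bochner_integral lborel (\<lambda>r. f (x - r) r) (?c x)" for x
  proof (cases "\<epsilon> < x")
    case True
    have "has_bochner_integral lborel (\<lambda>r. indicator {\<epsilon><..<x} r * ((x - r) powr (\<gamma> - 1) * r powr (-1 - \<gamma>)))
        ((x - \<epsilon>) powr \<gamma> / (\<gamma> * x * \<epsilon> powr \<gamma>))"
      using kernel_convolution[OF \<gamma> e True] True \<gamma> e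
      by (intro has_bochner_integral_nn_integral) (auto simp: indicator_def)
    from has_bochner_integral_mult_right[OF this, of "H x"] show ?thesis
      by (rule has_bochner_integral_cong[THEN iffD1, rotated -1]) (use True in \<open>auto simp: f_def indicator_def\<close>)
  next
    case False
    then have "(\<lambda>r. f (x - r) r) = (\<lambda>r. 0)" by (auto simp: f_def indicator_def)
    with False show ?thesis by (simp add: has_bochner_integral_zero)
  qed
  have fin: "(\<integral>\<^sup>+x. \<integral>\<^sup>+r. ennreal \<bar>f (x - r) r\<bar> \<partial>lborel \<partial>lborel) < \<infinity>"
  proof -
    have "(\<integral>\<^sup>+r. ennreal \<bar>f (x - r) r\<bar> \<partial>lborel) \<le> ennreal (B * L powr \<gamma> / (\<gamma> * \<epsilon> * \<epsilon> powr \<gamma>)) * indicator {\<epsilon>..L} x" for x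
    proof (cases "\<epsilon> < x \<and> x < L")
      case True
      have "(\<integral>\<^sup>+r. ennreal \<bar>f (x - r) r\<bar> \<partial>lborel)
         = (\<integral>\<^sup>+r. ennreal \<bar>H x\<bar> * ennreal (indicator {\<epsilon><..<x} r * ((x - r) powr (\<gamma> - 1) * r powr (-1 - \<gamma>))) \<partial>lborel)"
        using True by (intro nn_integral_cong) (auto simp: f_def indicator_def abs_mult ennreal_mult'[symmetric])
      also have "\<dots> = ennreal (\<bar>H x\<bar> * ((x - \<epsilon>) powr \<gamma> / (\<gamma> * x * \<epsilon> powr \<gamma>)))"
        using kernel_convolution[OF \<gamma> e, of x] True by (subst nn_integral_cmult) (auto simp: ennreal_mult'[symmetric])
      also have "\<dots> \<le> ennreal (B * (L powr \<gamma> / (\<gamma> * \<epsilon> * \<epsilon> powr \<gamma>)))"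
        using True \<gamma> e B bd[of x]
        by (intro ennreal_leI mult_mono frac_le mult_right_mono mult_left_mono powr_mono2) auto
      finally show ?thesis using True by simp
    next
      case False
      then have "f (x - r) r = 0" for r
        using zero[of x] by (cases "x < L") (auto simp: f_def indicator_def)
      then show ?thesis by simp
    qed
    then have "(\<integral>\<^sup>+x. \<integral>\<^sup>+r. ennreal \<bar>f (x - r) r\<bar> \<partial>lborel \<partial>lborel)
      \<le> (\<integral>\<^sup>+x. ennreal (B * L powr \<gamma> / (\<gamma> * \<epsilon> * \<epsilon> powr \<gamma>)) * indicator {\<epsilon>..L} x \<partial>lborel)"
      by (intro nn_integral_mono) auto
    also have "\<dots> < \<infinity>"
      by (subst nn_integral_cmult_indicator) (auto simp: ennreal_mult_less_top emeasure_lborel_Icc_eq)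
    finally show ?thesis .
  qed
  have int_f': "integrable (lborel \<Otimes>\<^sub>M lborel) (case_prod (\<lambda>x r. f (x - r) r))"
  proof (rule integrableI_bounded)
    show "(\<integral>\<^sup>+z. ennreal (norm (case z of (x, r) \<Rightarrow> f (x - r) r)) \<partial>(lborel \<Otimes>\<^sub>M lborel)) < \<infinity>"
      using fin by (subst lborel.nn_integral_fst[symmetric]) (auto simp: f_def)
  qed (simp add: f_def)
  have int_f: "integrable (lborel \<Otimes>\<^sub>M lborel) (case_prod f)"
  proof (rule integrableI_bounded)
    have "(\<integral>\<^sup>+z. ennreal (norm (case_prod f z)) \<partial>(lborel \<Otimes>\<^sub>M lborel)) = (\<integral>\<^sup>+r. \<integral>\<^sup>+q. ennreal \<bar>f q r\<bar> \<partial>lborel \<partial>lborel)"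
      by (subst lborel_pair.nn_integral_snd[symmetric]) auto
    also have "\<dots> = (\<integral>\<^sup>+r. \<integral>\<^sup>+x. ennreal \<bar>f (x - r) r\<bar> \<partial>lborel \<partial>lborel)"
    proof (rule nn_integral_cong)
      fix r :: real
      show "(\<integral>\<^sup>+q. ennreal \<bar>f q r\<bar> \<partial>lborel) = (\<integral>\<^sup>+x. ennreal \<bar>f (x - r) r\<bar> \<partial>lborel)"
        by (subst nn_integral_real_affine[where c=1 and t="-r"]) auto
    qed
    also have "\<dots> = (\<integral>\<^sup>+x. \<integral>\<^sup>+r. ennreal \<bar>f (x - r) r\<bar> \<partial>lborel \<partial>lborel)"
      by (rule lborel_pair.Fubini') (simp add: f_def)
    also note fin
    finally show "(\<integral>\<^sup>+z. ennreal (norm (case_prod f z)) \<partial>(lborel \<Otimes>\<^sub>M lborel)) < \<infinity>" .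
  qed simp
  have "(LINT q|lborel. LINT r|lborel. f q r) = (LINT r|lborel. LINT q|lborel. f q r)"
    using lborel_pair.Fubini_integral[OF int_f] by simp
  also have "\<dots> = (LINT r|lborel. LINT x|lborel. f (x - r) r)"
  proof (rule Bochner_Integration.integral_cong[OF refl])
    fix r :: real
    show "(LINT q|lborel. f q r) = (LINT x|lborel. f (x - r) r)"
      by (subst lborel_integral_real_affine[where c=1 and t="-r"]) auto
  qed
  also have "\<dots> = (LINT x|lborel. LINT r|lborel. f (x - r) r)"
    using lborel_pair.Fubini_integral[OF int_f'] by simp
  also have "\<dots> = (LINT x|lborel. ?c x)"
    using conv by (simp add: has_bochner_integral_iff)
  finally have swap: "(LINT q|lborel. LINT r|lborel. f q r)
     = (LINT x|lborel. ?c x)" .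
  have int1: "integrable lborel (\<lambda>q. indicator {0<..} q * (q powr (\<gamma> - 1) * (H q * \<epsilon> powr (-\<gamma>))))"
  proof (rule Bochner_Integration.integrable_bound)
    show "integrable lborel (\<lambda>q. (B * \<epsilon> powr (-\<gamma>)) * (indicator {0<..<L} q * q powr (\<gamma> - 1)))"
      using near0 by simp
    show "AE q in lborel. norm (indicator {0<..} q * (q powr (\<gamma> - 1) * (H q * \<epsilon> powr (-\<gamma>))))
       \<le> norm ((B * \<epsilon> powr (-\<gamma>)) * (indicator {0<..<L} q * q powr (\<gamma> - 1)))"
    proof (rule AE_I2)
      fix q
      show "norm (indicator {0<..} q * (q powr (\<gamma> - 1) * (H q * \<epsilon> powr (-\<gamma>))))
       \<le> norm ((B * \<epsilon> powr (-\<gamma>)) * (indicator {0<..<L} q * q powr (\<gamma> - 1)))"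
        using B bd[of q] zero[of q]
        by (cases "q < L") (auto simp: indicator_def abs_mult mult_ac intro!: mult_right_mono)
    qed
  qed simp
  have int2: "integrable lborel (\<lambda>q. LINT r|lborel. f q r)"
    using lborel_pair.integrable_fst'[OF int_f] by simp
  have int3: "integrable lborel (\<lambda>x. ?c x)"
    using lborel_pair.integrable_fst'[OF int_f'] conv by (simp add: has_bochner_integral_iff)
  have "(LINT q|lborel. indicator {0<..} q * (q powr (\<gamma> - 1) *
            (\<gamma> * (LINT r|lborel. indicator {\<epsilon><..} r * ((H q - H (q + r)) * r powr (-1 - \<gamma>))))))
     = (LINT q|lborel. indicator {0<..} q * (q powr (\<gamma> - 1) * (H q * \<epsilon> powr (-\<gamma>))) - \<gamma> * (LINT r|lborel. f q r))"
  proof (rule Bochner_Integration.integral_cong[OF refl])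
    fix q :: real
    have "(LINT r|lborel. f q r) = indicator {0<..} q * q powr (\<gamma> - 1) * (LINT r|lborel. indicator {\<epsilon><..} r * (H (q + r) * r powr (-1 - \<gamma>)))"
      unfolding f_def by (subst integral_mult_right_zero[symmetric]) (intro Bochner_Integration.integral_cong, auto)
    then show "indicator {0<..} q * (q powr (\<gamma> - 1) *
            (\<gamma> * (LINT r|lborel. indicator {\<epsilon><..} r * ((H q - H (q + r)) * r powr (-1 - \<gamma>)))))
       = indicator {0<..} q * (q powr (\<gamma> - 1) * (H q * \<epsilon> powr (-\<gamma>))) - \<gamma> * (LINT r|lborel. f q r)"
      unfolding inner by (simp add: algebra_simps)
  qed
  also have "\<dots> = (LINT q|lborel. indicator {0<..} q * (q powr (\<gamma> - 1) * (H q * \<epsilon> powr (-\<gamma>))))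
      - \<gamma> * (LINT x|lborel. ?c x)"
    using int1 int2 swap by simp
  also have "\<dots> = (LINT x|lborel. indicator {0<..} x * (x powr (\<gamma> - 1) * (H x * \<epsilon> powr (-\<gamma>)))
      - \<gamma> * (?c x))"
    by (simp only: Bochner_Integration.integral_diff[OF int1 integrable_mult_right[OF int3, of \<gamma>]] integral_mult_right_zero)
  also have "\<dots> = (LINT x|lborel. H x * (frac_kernel \<gamma> (x / \<epsilon>) / \<epsilon>))"
  proof (rule Bochner_Integration.integral_cong[OF refl])
    fix x :: real
    have m: "max 0 (x / \<epsilon> - 1) = max 0 (x - \<epsilon>) / \<epsilon>" using e by (auto simp: max_def field_simps)
    show "indicator {0<..} x * (x powr (\<gamma> - 1) * (H x * \<epsilon> powr (-\<gamma>)))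
      - \<gamma> * (?c x)
      = H x * (frac_kernel \<gamma> (x / \<epsilon>) / \<epsilon>)"
      using e \<gamma> unfolding frac_kernel_def m
      by (auto simp: indicator_def powr_divide powr_minus powr_diff field_simps)
  qed
  also have "\<dots> = (LINT y|lborel. H (\<epsilon> * y) * frac_kernel \<gamma> y)"
    by (subst lborel_integral_real_affine[where c=\<epsilon> and t=0]) (use e in auto)
  finally show ?thesis .
qed

text \<open>
The fractional integral of order \<open>\<gamma>\<close> inverts the fractional derivative of order \<open>\<gamma>\<close>, up to the constant
that the normalisations by Gamma functions would cancel. As \<open>\<epsilon> \<rightarrow> 0\<close> the left side of
\<open>truncated_inversion\<close> converges because the derivatives are bounded uniformly in \<open>\<epsilon>\<close>, and the right side
because \<open>H\<close> is continuous and the kernel integrable.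
\<close>

lemma fractional_inversion:
  fixes H :: "real \<Rightarrow> real"
  assumes \<gamma>: "0 < \<gamma>" "\<gamma> < 1" and L: "0 \<le> L"
    and cont: "continuous_on UNIV H"
    and bd: "\<And>x. \<bar>H x\<bar> \<le> B" and zero: "\<And>x. L \<le> x \<Longrightarrow> H x = 0"
    and int: "\<And>q. 0 < q \<Longrightarrow> q < L \<Longrightarrow>
        integrable lborel (\<lambda>r. indicator {0<..} r * ((H q - H (q + r)) * r powr (-1 - \<gamma>)))"
    and A: "\<And>q. 0 < q \<Longrightarrow> q < L \<Longrightarrow>
        (LINT r|lborel. \<bar>indicator {0<..} r * ((H q - H (q + r)) * r powr (-1 - \<gamma>))\<bar>) \<le> A"
  shows "(LINT q|lborel. indicator {0<..<L} q * (q powr (\<gamma> - 1) *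
            (\<gamma> * (LINT r|lborel. indicator {0<..} r * ((H q - H (q + r)) * r powr (-1 - \<gamma>))))))
       = Gamma \<gamma> * Gamma (1 - \<gamma>) * H 0"
proof -
  have [measurable]: "H \<in> borel_measurable borel"
    using cont by (rule borel_measurable_continuous_onI)
  define \<epsilon> where "\<epsilon> = (\<lambda>n::nat. 1 / (real n + 1))"
  have e_pos: "0 < \<epsilon> n" for n by (simp add: \<epsilon>_def)
  have e_lim: "\<epsilon> \<longlonglongrightarrow> 0" unfolding \<epsilon>_def
    using LIMSEQ_Suc[OF lim_1_over_n] by (simp add: add.commute)
  define J where "J = (\<lambda>n q. LINT r|lborel. indicator {\<epsilon> n<..} r * ((H q - H (q + r)) * r powr (-1 - \<gamma>)))"
  define J0 where "J0 = (\<lambda>q. LINT r|lborel. indicator {0<..} r * ((H q - H (q + r)) * r powr (-1 - \<gamma>)))"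
  have [measurable]: "J n \<in> borel_measurable borel" "J0 \<in> borel_measurable borel" for n
    unfolding J_def J0_def by measurable
  have J_bound: "\<bar>J n q\<bar> \<le> A" if q: "0 < q" "q < L" for n q
  proof -
    have "\<bar>J n q\<bar> \<le> (LINT r|lborel. \<bar>indicator {\<epsilon> n<..} r * ((H q - H (q + r)) * r powr (-1 - \<gamma>))\<bar>)"
      unfolding J_def using integral_norm_bound by (auto simp: real_norm_def)
    also have "\<dots> \<le> (LINT r|lborel. \<bar>indicator {0<..} r * ((H q - H (q + r)) * r powr (-1 - \<gamma>))\<bar>)"
      using e_pos[of n] by (intro integral_mono' integrable_abs int q) (auto simp: indicator_def)
    also have "\<dots> \<le> A" using A q by simp
    finally show ?thesis .
  qed
  have J_lim: "(\<lambda>n. J n q) \<longlonglongrightarrow> J0 q" if q: "0 < q" "q < L" for q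
    unfolding J_def J0_def
  proof (rule integral_dominated_convergence)
    show "integrable lborel (\<lambda>r. \<bar>indicator {0<..} r * ((H q - H (q + r)) * r powr (-1 - \<gamma>))\<bar>)"
      by (intro integrable_abs int q)
    show "AE r in lborel. (\<lambda>n. indicator {\<epsilon> n<..} r * ((H q - H (q + r)) * r powr (-1 - \<gamma>)))
       \<longlonglongrightarrow> indicator {0<..} r * ((H q - H (q + r)) * r powr (-1 - \<gamma>))"
    proof (rule AE_I2, rule tendsto_mult[OF _ tendsto_const])
      fix r :: real
      show "(\<lambda>n. indicator {\<epsilon> n<..} r :: real) \<longlonglongrightarrow> indicator {0<..} r"
      proof (cases "r > 0")
        case True
        then have "\<forall>\<^sub>F n in sequentially. \<epsilon> n < r" using e_lim by (auto intro: order_tendstoD)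
        then have "\<forall>\<^sub>F n in sequentially. indicator {\<epsilon> n<..} r = (indicator {0<..} r :: real)"
          by eventually_elim (use True in auto)
        then show ?thesis by (rule tendsto_eventually)
      next
        case False
        then have "indicator {\<epsilon> n<..} r = (0::real)" for n using e_pos[of n] by auto
        then show ?thesis using False by simp
      qed
    qed
    fix n show "AE r in lborel. norm (indicator {\<epsilon> n<..} r * ((H q - H (q + r)) * r powr (-1 - \<gamma>)))
       \<le> \<bar>indicator {0<..} r * ((H q - H (q + r)) * r powr (-1 - \<gamma>))\<bar>"
      using e_pos[of n] by (auto simp: indicator_def)
  qed simp_all
  have lhs: "(\<lambda>n. LINT q|lborel. indicator {0<..<L} q * (q powr (\<gamma> - 1) * (\<gamma> * J n q)))
     \<longlonglongrightarrow> (LINT q|lborel. indicator {0<..<L} q * (q powr (\<gamma> - 1) * (\<gamma> * J0 q)))"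
  proof (rule integral_dominated_convergence)
    show "integrable lborel (\<lambda>q. (\<gamma> * A) * (indicator {0<..<L} q * q powr (\<gamma> - 1)))"
      using has_bochner_integral_powr_near_0[of \<gamma> L] \<gamma> L by (auto simp: has_bochner_integral_iff)
    show "AE q in lborel. (\<lambda>n. indicator {0<..<L} q * (q powr (\<gamma> - 1) * (\<gamma> * J n q)))
        \<longlonglongrightarrow> indicator {0<..<L} q * (q powr (\<gamma> - 1) * (\<gamma> * J0 q))"
      by (rule AE_I2) (auto simp: indicator_def intro!: tendsto_intros J_lim)
    fix n show "AE q in lborel. norm (indicator {0<..<L} q * (q powr (\<gamma> - 1) * (\<gamma> * J n q)))
        \<le> (\<gamma> * A) * (indicator {0<..<L} q * q powr (\<gamma> - 1))"
      using J_bound[of _ n] \<gamma> by (auto simp: indicator_def abs_mult mult_ac intro!: mult_left_mono)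
  qed simp_all
  have "(LINT q|lborel. indicator {0<..<L} q * (q powr (\<gamma> - 1) * (\<gamma> * J n q))) = (LINT y|lborel. H (\<epsilon> n * y) * frac_kernel \<gamma> y)" for n
  proof -
    have "(LINT q|lborel. indicator {0<..<L} q * (q powr (\<gamma> - 1) * (\<gamma> * J n q)))
      = (LINT q|lborel. indicator {0<..} q * (q powr (\<gamma> - 1) * (\<gamma> * J n q)))"
    proof (rule Bochner_Integration.integral_cong[OF refl])
      fix q
      have "J n q = 0" if "L \<le> q"
      proof -
        have "indicator {\<epsilon> n<..} r * ((H q - H (q + r)) * r powr (-1 - \<gamma>)) = 0" for r
          using zero[of q] zero[of "q+r"] that e_pos[of n] by (auto simp: indicator_def)
        note z = this
        show ?thesis by (simp only: J_def z Bochner_Integration.integral_zero)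
      qed
      then show "indicator {0<..<L} q * (q powr (\<gamma> - 1) * (\<gamma> * J n q)) = indicator {0<..} q * (q powr (\<gamma> - 1) * (\<gamma> * J n q))"
        by (cases "L \<le> q") (auto simp: indicator_def)
    qed
    then show ?thesis
      unfolding J_def using truncated_inversion[of \<gamma> "\<epsilon> n" L H B] \<gamma> e_pos L bd zero by simp
  qed
  then have lhs': "(\<lambda>n. LINT y|lborel. H (\<epsilon> n * y) * frac_kernel \<gamma> y)
     \<longlonglongrightarrow> (LINT q|lborel. indicator {0<..<L} q * (q powr (\<gamma> - 1) * (\<gamma> * J0 q)))"
    using lhs by simp
  have mass: "integrable lborel (frac_kernel \<gamma>)" "(LINT y|lborel. frac_kernel \<gamma> y) = Gamma \<gamma> * Gamma (1 - \<gamma>)"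
    using frac_kernel_mass[OF \<gamma>] by (auto simp: has_bochner_integral_iff)
  have "(\<lambda>n. LINT y|lborel. H (\<epsilon> n * y) * frac_kernel \<gamma> y) \<longlonglongrightarrow> (LINT y|lborel. H 0 * frac_kernel \<gamma> y)"
  proof (rule integral_dominated_convergence)
    show "integrable lborel (\<lambda>y. B * frac_kernel \<gamma> y)" using mass by simp
    show "AE y in lborel. (\<lambda>n. H (\<epsilon> n * y) * frac_kernel \<gamma> y) \<longlonglongrightarrow> H 0 * frac_kernel \<gamma> y"
    proof (rule AE_I2, rule tendsto_mult[OF _ tendsto_const])
      fix y
      have "isCont H 0" using cont by (simp add: continuous_on_eq_continuous_at)
      moreover have "(\<lambda>n. \<epsilon> n * y) \<longlonglongrightarrow> 0" using tendsto_mult_right[OF e_lim, of y] by simp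
      ultimately show "(\<lambda>n. H (\<epsilon> n * y)) \<longlonglongrightarrow> H 0"
        using isCont_tendsto_compose by blast
    qed
    fix n show "AE y in lborel. norm (H (\<epsilon> n * y) * frac_kernel \<gamma> y) \<le> B * frac_kernel \<gamma> y"
      using bd frac_kernel_nonneg \<gamma> by (auto simp: abs_mult intro!: mult_right_mono)
  qed simp_all
  then show ?thesis
    using LIMSEQ_unique[OF lhs'] mass unfolding J0_def by simp
qed

section \<open>Right-sided fractional derivative of a Besov integrator\<close>

lemma besov1_bounds:
  assumes "g \<in> besov1 T \<gamma>"
  obtains A where "0 \<le> A"
    and "\<And>s t. 0 \<le> s \<Longrightarrow> s < t \<Longrightarrow> t \<le> T \<Longrightarrow> \<bar>g t - g s\<bar> \<le> A * (t - s) powr \<gamma>"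
    and "\<And>s t. 0 \<le> s \<Longrightarrow> s < t \<Longrightarrow> t \<le> T \<Longrightarrow>
      (\<integral>\<^sup>+u\<in>{s..t}. ennreal (\<bar>g u - g s\<bar> / (u - s) powr (1 + \<gamma>)) \<partial>lebesgue) \<le> ennreal A"
proof
  define A where "A = enn2real (besov1_norm T \<gamma> g)"
  have A: "besov1_norm T \<gamma> g = ennreal A"
    using assms unfolding A_def besov1_def by (simp add: less_top)
  show "0 \<le> A" unfolding A_def by simp
  fix s t :: real assume st: "0 \<le> s" "s < t" "t \<le> T"
  let ?I = "\<integral>\<^sup>+u\<in>{s..t}. ennreal (\<bar>g u - g s\<bar> / (u - s) powr (1 + \<gamma>)) \<partial>lebesgue"
  have le: "ennreal (\<bar>g t - g s\<bar> / (t - s) powr \<gamma>) + ?I \<le> ennreal A"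
    unfolding A[symmetric] besov1_norm_def
    by (rule SUP_upper2[of "(s, t)"]) (use st in auto)
  from order_trans[OF add_increasing[OF zero_le order_refl] le] show "?I \<le> ennreal A" .
  have "ennreal (\<bar>g t - g s\<bar> / (t - s) powr \<gamma>) \<le> ennreal A"
    by (rule order_trans[OF add_increasing2[OF zero_le order_refl] le])
  then have "\<bar>g t - g s\<bar> / (t - s) powr \<gamma> \<le> A"
    using \<open>0 \<le> A\<close> by simp
  then show "\<bar>g t - g s\<bar> \<le> A * (t - s) powr \<gamma>"
    using st by (simp add: field_simps)
qed

lemma holder_imp_continuous_on:
  fixes g :: "real \<Rightarrow> real"
  assumes \<gamma>: "0 < \<gamma>" and hol: "\<And>s t. 0 \<le> s \<Longrightarrow> s < t \<Longrightarrow> t \<le> T \<Longrightarrow> \<bar>g t - g s\<bar> \<le> A * (t - s) powr \<gamma>"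
  shows "continuous_on {0..T} g"
  unfolding continuous_on
proof
  fix x assume x: "x \<in> {0..T}"
  have "((\<lambda>y. g y - g x) \<longlongrightarrow> 0) (at x within {0..T})"
  proof (rule Lim_null_comparison)
    have "((\<lambda>y. \<bar>y - x\<bar>) \<longlongrightarrow> 0) (at x within {0..T})"
      by (intro tendsto_rabs_zero LIM_zero tendsto_ident_at)
    then have "((\<lambda>y. \<bar>y - x\<bar> powr \<gamma>) \<longlongrightarrow> 0 powr \<gamma>) (at x within {0..T})"
      by (rule tendsto_powr') (use \<gamma> in auto)
    then have "((\<lambda>y. \<bar>y - x\<bar> powr \<gamma>) \<longlongrightarrow> 0) (at x within {0..T})"
      using \<gamma> by simp
    from tendsto_mult_left[OF this, of A] show "((\<lambda>y. A * \<bar>y - x\<bar> powr \<gamma>) \<longlongrightarrow> 0) (at x within {0..T})"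
      by simp
    show "\<forall>\<^sub>F y in at x within {0..T}. norm (g y - g x) \<le> A * \<bar>y - x\<bar> powr \<gamma>"
      unfolding eventually_at_filter
    proof (rule always_eventually, intro allI impI)
      fix y assume "y \<noteq> x" "y \<in> {0..T}"
      then show "norm (g y - g x) \<le> A * \<bar>y - x\<bar> powr \<gamma>"
        using hol[of x y] hol[of y x] x by (cases "x < y") (auto simp: abs_minus_commute)
    qed
  qed
  then show "(g \<longlongrightarrow> g x) (at x within {0..T})"
    using LIM_zero_iff by blast
qed

text \<open>
Continuing \<open>g - g T\<close> constantly to the left of \<open>0\<close> and by \<open>0\<close> to the right of \<open>T\<close> gives a continuous
function on the line; with it the boundary term of the fractional derivative need not be written
separately, see \<open>right_deriv_props\<close>.
\<close>

definition centred_ext :: "real \<Rightarrow> (real \<Rightarrow> real) \<Rightarrow> real \<Rightarrow> real" where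
  "centred_ext T g s = g (max 0 (min T s)) - g T"

text \<open>
Marchaud's form of the right-sided fractional derivative on the half-line, without the constant
\<open>1 / \<Gamma> (1 - \<gamma>)\<close> and the complex phase.
\<close>

definition right_deriv :: "real \<Rightarrow> (real \<Rightarrow> real) \<Rightarrow> real \<Rightarrow> real" where
  "right_deriv \<gamma> G s = \<gamma> * (LINT r|lborel. indicator {0<..} r * ((G s - G (s + r)) * r powr (-1 - \<gamma>)))"

lemma measurable_right_deriv [measurable]:
  assumes [measurable]: "G \<in> borel_measurable borel"
  shows "right_deriv \<gamma> G \<in> borel_measurable borel"
  unfolding right_deriv_def by measurable

context
  fixes T \<gamma> A :: real and g :: "real \<Rightarrow> real"
  assumes T: "0 < T" and \<gamma>: "0 < \<gamma>" "\<gamma> < 1" and A: "0 \<le> A"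
    and hol: "\<And>s t. 0 \<le> s \<Longrightarrow> s < t \<Longrightarrow> t \<le> T \<Longrightarrow> \<bar>g t - g s\<bar> \<le> A * (t - s) powr \<gamma>"
    and sing: "\<And>s t. 0 \<le> s \<Longrightarrow> s < t \<Longrightarrow> t \<le> T \<Longrightarrow>
      (\<integral>\<^sup>+u\<in>{s..t}. ennreal (\<bar>g u - g s\<bar> / (u - s) powr (1 + \<gamma>)) \<partial>lebesgue) \<le> ennreal A"
begin

private abbreviation "G \<equiv> centred_ext T g"

lemma centred_ext_continuous: "continuous_on UNIV (centred_ext T g)"
  unfolding centred_ext_def
  by (intro continuous_intros continuous_on_compose2[OF holder_imp_continuous_on[OF \<gamma>(1) hol]])
     (use T in auto)

lemma centred_ext_measurable: "centred_ext T g \<in> borel_measurable borel"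
  using centred_ext_continuous by (rule borel_measurable_continuous_onI)

lemma centred_ext_beyond: "T \<le> x \<Longrightarrow> centred_ext T g x = 0"
  using T by (simp add: centred_ext_def)

lemma centred_ext_inside: "0 \<le> x \<Longrightarrow> x \<le> T \<Longrightarrow> centred_ext T g x = g x - g T"
  by (simp add: centred_ext_def)

lemma centred_ext_bound: "\<bar>centred_ext T g x\<bar> \<le> A * T powr \<gamma>"
proof -
  let ?y = "max 0 (min T x)"
  have "\<bar>g T - g ?y\<bar> \<le> A * (T - ?y) powr \<gamma>" if "?y < T"
    using hol[of ?y T] that by auto
  also have "A * (T - ?y) powr \<gamma> \<le> A * T powr \<gamma>"
    using A \<gamma> T by (intro mult_left_mono powr_mono2) auto
  finally show ?thesis
    using A T by (cases "?y < T") (auto simp: centred_ext_def abs_minus_commute min_def max_def split: if_splits)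
qed

text \<open>
The part \<open>r \<le> T - s\<close> of the Marchaud integral is the singular integral of the Besov norm.
\<close>

lemma lint_right_near:
  assumes s: "0 \<le> s" "s < T"
  shows "integrable lborel (\<lambda>r. indicator {0<..T-s} r * ((G s - G (s + r)) * r powr (-1 - \<gamma>)))" (is "integrable _ ?f")
    and "(LINT r|lborel. \<bar>indicator {0<..T-s} r * ((G s - G (s + r)) * r powr (-1 - \<gamma>))\<bar>) \<le> A"
    and "(LINT r|lborel. indicator {0<..T-s} r * ((G s - G (s + r)) * r powr (-1 - \<gamma>)))
       = (LINT u:{s..T}|lebesgue. (G s - G u) / (u - s) powr (\<gamma> + 1))"
proof -
  note [measurable] = centred_ext_measurable
  let ?h = "\<lambda>u. indicator {s..T} u * ((G s - G u) / (u - s) powr (\<gamma> + 1))"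
  have eq: "?f r = ?h (s + 1 * r)" for r
    using s by (cases "r = 0") (auto simp: indicator_def powr_minus powr_diff divide_simps powr_add)
  have nn: "(\<integral>\<^sup>+r. ennreal \<bar>?f r\<bar> \<partial>lborel) \<le> ennreal A"
  proof -
    have "(\<integral>\<^sup>+r. ennreal \<bar>?f r\<bar> \<partial>lborel) = (\<integral>\<^sup>+r. ennreal \<bar>?h (s + 1 * r)\<bar> \<partial>lborel)"
      by (simp only: eq)
    also have "\<dots> = (\<integral>\<^sup>+u. ennreal \<bar>?h u\<bar> \<partial>lborel)"
      by (subst (2) nn_integral_real_affine[where c=1 and t=s]) auto
    also have "\<dots> = (\<integral>\<^sup>+u\<in>{s..T}. ennreal (\<bar>g u - g s\<bar> / (u - s) powr (1 + \<gamma>)) \<partial>lborel)"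
      by (intro nn_integral_cong)
         (use s in \<open>auto simp: indicator_def centred_ext_inside abs_minus_commute add.commute\<close>)
    also have "\<dots> \<le> ennreal A"
      using sing[of s T] s by (simp add: nn_integral_completion)
    finally show ?thesis .
  qed
  show int: "integrable lborel ?f"
    by (rule integrableI_bounded) (use nn in \<open>auto simp: less_top[symmetric] top_unique\<close>)
  then have "ennreal (LINT r|lborel. \<bar>?f r\<bar>) = (\<integral>\<^sup>+r. ennreal \<bar>?f r\<bar> \<partial>lborel)"
    by (intro nn_integral_eq_integral[symmetric] integrable_abs) auto
  with nn A show "(LINT r|lborel. \<bar>?f r\<bar>) \<le> A" by (metis ennreal_le_iff)
  have "(LINT u:{s..T}|lebesgue. (G s - G u) / (u - s) powr (\<gamma> + 1)) = (LINT u|lborel. ?h u)"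
    unfolding set_lebesgue_integral_def by (subst integral_completion) auto
  also have "\<dots> = (LINT r|lborel. ?f r)"
    by (subst lborel_integral_real_affine[where c=1 and t=s]) (auto simp only: eq, auto)
  finally show "(LINT r|lborel. ?f r) = (LINT u:{s..T}|lebesgue. (G s - G u) / (u - s) powr (\<gamma> + 1))" ..
qed

text \<open>
For \<open>r > T - s\<close> the extension vanishes at \<open>s + r\<close>, so this part of the Marchaud integral is
\<open>G s \<integral> r\<^bsup>-1-\<gamma>\<^esup> dr = G s (T - s)\<^bsup>-\<gamma>\<^esup> / \<gamma>\<close>, which is the boundary term; the Hoelder part of the Besov norm
bounds it.
\<close>

lemma right_deriv_props:
  assumes s: "0 \<le> s" "s < T"
  shows "integrable lborel (\<lambda>r. indicator {0<..} r * ((G s - G (s + r)) * r powr (-1 - \<gamma>)))" (is "integrable _ ?f")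
    and "(LINT r|lborel. \<bar>indicator {0<..} r * ((G s - G (s + r)) * r powr (-1 - \<gamma>))\<bar>) \<le> A + A / \<gamma>"
    and "right_deriv \<gamma> G s = G s / (T - s) powr \<gamma> + \<gamma> * (LINT u:{s..T}|lebesgue. (G s - G u) / (u - s) powr (\<gamma> + 1))"
    and "\<bar>right_deriv \<gamma> G s\<bar> \<le> \<gamma> * (A + A / \<gamma>)"
proof -
  let ?f1 = "\<lambda>r. indicator {0<..T-s} r * ((G s - G (s + r)) * r powr (-1 - \<gamma>))"
  let ?f2 = "\<lambda>r. G s * (indicator {T-s<..} r * r powr (-1 - \<gamma>))"
  have split: "?f r = ?f1 r + ?f2 r" for r
    using s by (auto simp: indicator_def centred_ext_beyond)
  have f2: "has_bochner_integral lborel ?f2 (G s * ((T - s) powr (-\<gamma>) / \<gamma>))"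
    using has_bochner_integral_powr_tail[of \<gamma> "T-s"] \<gamma> s by (intro has_bochner_integral_mult_right) auto
  have f2a: "has_bochner_integral lborel (\<lambda>r. \<bar>?f2 r\<bar>) (\<bar>G s\<bar> * ((T - s) powr (-\<gamma>) / \<gamma>))"
  proof -
    have "(\<lambda>r. \<bar>?f2 r\<bar>) = (\<lambda>r. \<bar>G s\<bar> * (indicator {T-s<..} r * r powr (-1 - \<gamma>)))"
      by (auto simp: abs_mult)
    then show ?thesis
      by (simp only:) (rule has_bochner_integral_mult_right,
        use has_bochner_integral_powr_tail[of \<gamma> "T-s"] \<gamma> s in simp)
  qed
  show int: "integrable lborel ?f"
    using lint_right_near(1)[OF s] f2 unfolding split by (auto simp: has_bochner_integral_iff)
  have Gs: "\<bar>G s\<bar> * (T - s) powr (-\<gamma>) \<le> A"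
    using hol[of s T] s by (auto simp: centred_ext_inside abs_minus_commute powr_minus field_simps)
  have "(LINT r|lborel. \<bar>?f r\<bar>) \<le> (LINT r|lborel. \<bar>?f1 r\<bar> + \<bar>?f2 r\<bar>)"
    unfolding split using lint_right_near(1)[OF s] f2
    by (intro integral_mono' Bochner_Integration.integrable_add integrable_abs) (auto simp: has_bochner_integral_iff)
  also have "\<dots> = (LINT r|lborel. \<bar>?f1 r\<bar>) + (LINT r|lborel. \<bar>?f2 r\<bar>)"
    using lint_right_near(1)[OF s] f2
    by (intro Bochner_Integration.integral_add integrable_abs) (auto simp: has_bochner_integral_iff)
  also have "(LINT r|lborel. \<bar>?f2 r\<bar>) = \<bar>G s\<bar> * ((T - s) powr (-\<gamma>) / \<gamma>)"
    using f2a by (simp add: has_bochner_integral_iff)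
  also have "(LINT r|lborel. \<bar>?f1 r\<bar>) + \<bar>G s\<bar> * ((T - s) powr (-\<gamma>) / \<gamma>) \<le> A + A / \<gamma>"
    using lint_right_near(2)[OF s] Gs \<gamma> by (intro add_mono) (auto simp: field_simps)
  finally show bound: "(LINT r|lborel. \<bar>?f r\<bar>) \<le> A + A / \<gamma>" .
  have "(LINT r|lborel. ?f r) = (LINT r|lborel. ?f1 r) + (LINT r|lborel. ?f2 r)"
    unfolding split using lint_right_near(1)[OF s] f2
    by (intro Bochner_Integration.integral_add) (auto simp: has_bochner_integral_iff)
  also have "(LINT r|lborel. ?f2 r) = G s * ((T - s) powr (-\<gamma>) / \<gamma>)"
    using f2 by (simp only: has_bochner_integral_iff)
  finally show "right_deriv \<gamma> G s = G s / (T - s) powr \<gamma> + \<gamma> * (LINT u:{s..T}|lebesgue. (G s - G u) / (u - s) powr (\<gamma> + 1))"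
    unfolding right_deriv_def lint_right_near(3)[OF s] using \<gamma> s by (simp add: powr_minus field_simps)
  have "\<bar>LINT r|lborel. ?f r\<bar> \<le> (LINT r|lborel. \<bar>?f r\<bar>)"
    using integral_norm_bound[of lborel ?f] by (simp only: real_norm_def)
  from order_trans[OF this bound] show "\<bar>right_deriv \<gamma> G s\<bar> \<le> \<gamma> * (A + A / \<gamma>)"
    unfolding right_deriv_def abs_mult using \<gamma> by (auto intro!: mult_left_mono)
qed

lemma integral_right_deriv:
  assumes a: "0 \<le> a" "a \<le> T"
  shows "(LINT s|lborel. indicator {a<..<T} s * ((s - a) powr (\<gamma> - 1) * right_deriv \<gamma> G s))
     = Gamma \<gamma> * Gamma (1 - \<gamma>) * (g a - g T)"
proof -
  let ?H = "\<lambda>x. G (a + x)"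
  have "(LINT s|lborel. indicator {a<..<T} s * ((s - a) powr (\<gamma> - 1) * right_deriv \<gamma> G s))
     = (LINT q|lborel. indicator {0<..<T-a} q * (q powr (\<gamma> - 1) *
            (\<gamma> * (LINT r|lborel. indicator {0<..} r * ((?H q - ?H (q + r)) * r powr (-1 - \<gamma>))))))"
    unfolding right_deriv_def
    by (subst lborel_integral_real_affine[where c=1 and t=a])
       (auto simp: indicator_def add.assoc intro!: Bochner_Integration.integral_cong)
  also have "\<dots> = Gamma \<gamma> * Gamma (1 - \<gamma>) * ?H 0"
  proof (rule fractional_inversion[where B="A * T powr \<gamma>" and A="A + A / \<gamma>"])
    show "continuous_on UNIV ?H"
      by (intro continuous_on_compose2[OF centred_ext_continuous] continuous_intros) auto
  next
    fix q assume q: "0 < q" "q < T - a"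
    then show "integrable lborel (\<lambda>r. indicator {0<..} r * ((?H q - ?H (q + r)) * r powr (-1 - \<gamma>)))"
      "(LINT r|lborel. \<bar>indicator {0<..} r * ((?H q - ?H (q + r)) * r powr (-1 - \<gamma>))\<bar>) \<le> A + A / \<gamma>"
      using right_deriv_props(1,2)[of "a+q"] a by (auto simp: add.assoc)
  qed (use a \<gamma> in \<open>auto intro: centred_ext_bound centred_ext_beyond\<close>)
  finally show ?thesis using a by (simp add: centred_ext_inside)
qed

end

section \<open>The generalized Lebesgue--Stieltjes integral as a pairing\<close>

lemma frac_deriv_0plus_sum:
  assumes "finite I"
    and int: "\<And>i. i \<in> I \<Longrightarrow> set_integrable lebesgue {0..s} (\<lambda>u. (e i s - e i u) / (s - u) powr (\<beta> + 1))"
  shows "frac_deriv_0plus \<beta> (\<lambda>x. \<Sum>i\<in>I. c i * e i x) s = (\<Sum>i\<in>I. c i * frac_deriv_0plus \<beta> (e i) s)"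
proof -
  let ?J = "\<lambda>i. LINT u:{0..s}|lebesgue. (e i s - e i u) / (s - u) powr (\<beta> + 1)"
  have "(LINT u:{0..s}|lebesgue. ((\<Sum>i\<in>I. c i * e i s) - (\<Sum>i\<in>I. c i * e i u)) / (s - u) powr (\<beta> + 1))
     = (LINT u:{0..s}|lebesgue. (\<Sum>i\<in>I. c i * ((e i s - e i u) / (s - u) powr (\<beta> + 1))))"
    by (rule arg_cong[where f="set_lebesgue_integral lebesgue {0..s}"], rule ext)
       (simp add: sum_subtractf[symmetric] sum_divide_distrib right_diff_distrib)
  also have "\<dots> = (\<Sum>i\<in>I. c i * ?J i)"
  proof -
    have "(LINT u:{0..s}|lebesgue. (\<Sum>i\<in>I. c i * ((e i s - e i u) / (s - u) powr (\<beta> + 1))))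
       = (LINT u|lebesgue. (\<Sum>i\<in>I. c i * (indicator {0..s} u *\<^sub>R ((e i s - e i u) / (s - u) powr (\<beta> + 1)))))"
      unfolding set_lebesgue_integral_def by (simp add: sum_distrib_left mult_ac)
    also have "\<dots> = (\<Sum>i\<in>I. c i * ?J i)"
      using int unfolding set_integrable_def set_lebesgue_integral_def
      by (subst Bochner_Integration.integral_sum, intro integrable_mult_right) (assumption, simp only: integral_mult_right_zero)
    finally show ?thesis .
  qed
  finally show ?thesis
    unfolding frac_deriv_0plus_def
    by (simp add: sum_distrib_left sum_divide_distrib sum.distrib algebra_simps)
qed

lemma frac_deriv_0plus_diff:
  assumes "set_integrable lebesgue {0..s} (\<lambda>u. (h s - h u) / (s - u) powr (\<beta> + 1))"
    and "set_integrable lebesgue {0..s} (\<lambda>u. (k s - k u) / (s - u) powr (\<beta> + 1))"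
  shows "frac_deriv_0plus \<beta> (\<lambda>x. h x - k x) s = frac_deriv_0plus \<beta> h s - frac_deriv_0plus \<beta> k s"
  using frac_deriv_0plus_sum[of "{False, True}" s "\<lambda>b. if b then h else k" \<beta> "\<lambda>b. if b then 1 else -1"] assms
  by (simp add: algebra_simps)

text \<open>
For \<open>s > a\<close> the singular integral only sees \<open>u < a\<close> and equals \<open>((s - a)\<^bsup>-\<beta>\<^esup> - s\<^bsup>-\<beta>\<^esup>) / \<beta>\<close>; its second term
cancels the boundary term of the derivative.
\<close>

lemma frac_deriv_0plus_indicator:
  fixes a s \<beta> :: real
  assumes \<beta>: "0 < \<beta>" and a: "0 \<le> a" and s: "0 < s" "s \<noteq> a"
  shows "set_integrable lebesgue {0..s} (\<lambda>u. (indicator {a..} s - indicator {a..} u) / (s - u) powr (\<beta> + 1))"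
    and "frac_deriv_0plus \<beta> (indicator {a..}) s = 1 / Gamma (1 - \<beta>) * (indicator {a<..} s * (s - a) powr (- \<beta>))"
proof -
  let ?f = "\<lambda>u. (indicator {a..} s - indicator {a..} u) / (s - u) powr (\<beta> + 1) :: real"
  let ?I = "indicator {a<..} s * (((s - a) powr (- \<beta>) - s powr (- \<beta>)) / \<beta>)"
  have "has_bochner_integral lborel (\<lambda>u. indicator {0..s} u * ?f u) ?I"
  proof (cases "s < a")
    case True
    then have "(\<lambda>u. indicator {0..s} u * ?f u) = (\<lambda>u. 0)" by (auto simp: indicator_def)
    with True show ?thesis by (simp add: has_bochner_integral_zero)
  next
    case False
    then have as: "a < s" using s by simp
    have "((\<lambda>u. (s - u) powr (-\<beta> - 1)) has_integral (s - a) powr (-\<beta>) / \<beta> - (s - 0) powr (-\<beta>) / \<beta>) {0..a}"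
    proof (rule fundamental_theorem_of_calculus[OF a])
      fix u assume "u \<in> {0..a}"
      then have "((\<lambda>u. (s - u) powr (-\<beta>) / \<beta>) has_real_derivative (s - u) powr (-\<beta> - 1)) (at u within {0..a})"
        using as \<beta> by (auto intro!: derivative_eq_intros)
      then show "((\<lambda>u. (s - u) powr (-\<beta>) / \<beta>) has_vector_derivative (s - u) powr (-\<beta> - 1)) (at u within {0..a})"
        by (simp add: has_real_derivative_iff_has_vector_derivative)
    qed
    then have "((\<lambda>u. (s - u) powr (-\<beta> - 1)) has_integral ?I) {0..<a}"
      by (subst has_integral_spike_set_eq[of _ "{0..a}"])
         (use as in \<open>auto simp: diff_divide_distrib intro: negligible_subset[of "{a}"]\<close>)
    then have "has_bochner_integral lborel (\<lambda>u. indicator {0..<a} u * (s - u) powr (-\<beta> - 1)) ?I"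
      by (intro has_bochner_integral_nonneg_has_integral) auto
    moreover have "indicator {0..<a} u * (s - u) powr (-\<beta> - 1) = indicator {0..s} u * ?f u" for u
    proof -
      have "- \<beta> - 1 = - (\<beta> + 1)" by simp
      then have "(s - u) powr (- \<beta> - 1) = 1 / (s - u) powr (\<beta> + 1)" by (simp only: powr_minus_divide)
      then show ?thesis using as by (auto simp: indicator_def)
    qed
    ultimately show ?thesis by simp
  qed
  then have *: "has_bochner_integral lebesgue (\<lambda>u. indicator {0..s} u *\<^sub>R ?f u) ?I"
    by (auto simp: has_bochner_integral_iff integrable_completion integral_completion)
  then show "set_integrable lebesgue {0..s} ?f"
    unfolding set_integrable_def by (simp add: has_bochner_integral_iff)
  from * have J: "(LINT u:{0..s}|lebesgue. ?f u) = ?I"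
    unfolding set_lebesgue_integral_def by (simp only: has_bochner_integral_iff)
  have "indicator {a..} s / s powr \<beta> + \<beta> * ?I = indicator {a<..} s * (s - a) powr (- \<beta>)"
    using s \<beta> by (cases "a < s") (auto simp: powr_minus_divide)
  then show "frac_deriv_0plus \<beta> (indicator {a..}) s = 1 / Gamma (1 - \<beta>) * (indicator {a<..} s * (s - a) powr (- \<beta>))"
    unfolding frac_deriv_0plus_def J by simp
qed

lemma measurable_frac_deriv_0plus [measurable]:
  assumes [measurable]: "h \<in> borel_measurable borel"
  shows "frac_deriv_0plus \<beta> h \<in> borel_measurable borel"
proof -
  have "frac_deriv_0plus \<beta> h = (\<lambda>s. 1 / Gamma (1 - \<beta>) *
       (h s / s powr \<beta> + \<beta> * (LINT u|lborel. (if 0 \<le> u \<and> u \<le> s then (h s - h u) / (s - u) powr (\<beta> + 1) else 0))))"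
  proof (rule ext)
    fix s
    have "(LINT u:{0..s}|lebesgue. (h s - h u) / (s - u) powr (\<beta> + 1))
       = (LINT u|lborel. indicator {0..s} u *\<^sub>R ((h s - h u) / (s - u) powr (\<beta> + 1)))"
      unfolding set_lebesgue_integral_def by (rule integral_completion) simp
    also have "\<dots> = (LINT u|lborel. (if 0 \<le> u \<and> u \<le> s then (h s - h u) / (s - u) powr (\<beta> + 1) else 0))"
      by (rule Bochner_Integration.integral_cong[OF refl]) (auto simp: indicator_def)
    finally show "frac_deriv_0plus \<beta> h s = 1 / Gamma (1 - \<beta>) *
       (h s / s powr \<beta> + \<beta> * (LINT u|lborel. (if 0 \<le> u \<and> u \<le> s then (h s - h u) / (s - u) powr (\<beta> + 1) else 0)))"
      unfolding frac_deriv_0plus_def by simp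
  qed
  then show ?thesis by simp
qed

text \<open>
The bound holds for every function, since the Bochner integral of a non-integrable one is \<open>0\<close>.
\<close>

lemma ennreal_abs_lint_le:
  fixes f :: "'a \<Rightarrow> real"
  shows "ennreal \<bar>integral\<^sup>L M f\<bar> \<le> (\<integral>\<^sup>+x. ennreal \<bar>f x\<bar> \<partial>M)"
  by (cases "integrable M f")
     (use integral_norm_bound_ennreal[of M f] in \<open>auto simp: not_integrable_integral_eq\<close>)

definition besov2_inner :: "real \<Rightarrow> (real \<Rightarrow> real) \<Rightarrow> real \<Rightarrow> ennreal" where
  "besov2_inner \<beta> h s = (\<integral>\<^sup>+u\<in>{0..s}. ennreal (\<bar>h u - h s\<bar> / (s - u) powr (1 + \<beta>)) \<partial>lborel)"

lemma measurable_besov2_inner [measurable]: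
  assumes [measurable]: "h \<in> borel_measurable borel"
  shows "besov2_inner \<beta> h \<in> borel_measurable borel"
proof -
  have "besov2_inner \<beta> h = (\<lambda>s. \<integral>\<^sup>+u. (if 0 \<le> u \<and> u \<le> s then ennreal (\<bar>h u - h s\<bar> / (s - u) powr (1 + \<beta>)) else 0) \<partial>lborel)"
    unfolding besov2_inner_def by (intro ext nn_integral_cong) (auto simp: indicator_def)
  then show ?thesis by simp
qed

lemma besov2_norm_borel:
  assumes [measurable]: "h \<in> borel_measurable borel"
  shows "besov2_norm T \<beta> h = (\<integral>\<^sup>+s\<in>{0..T}. (ennreal (\<bar>h s\<bar> / s powr \<beta>) + besov2_inner \<beta> h s) \<partial>lborel)"
  unfolding besov2_norm_def nn_integral_completion besov2_inner_def[symmetric]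
  by (subst nn_integral_add[symmetric]) (auto simp: distrib_right intro!: nn_integral_cong)

lemma besov2_norm_diff_le:
  assumes [measurable]: "h \<in> borel_measurable borel" "k \<in> borel_measurable borel"
  shows "besov2_norm T \<beta> (\<lambda>x. h x - k x) \<le> besov2_norm T \<beta> h + besov2_norm T \<beta> k"
proof -
  have tri: "ennreal (\<bar>x - y\<bar> / z) \<le> ennreal (\<bar>x\<bar> / z) + ennreal (\<bar>y\<bar> / z)" if "0 \<le> z" for x y z :: real
    using that by (subst ennreal_plus[symmetric])
      (auto simp: add_divide_distrib[symmetric] simp del: ennreal_plus intro!: ennreal_leI divide_right_mono)
  have inner: "besov2_inner \<beta> (\<lambda>x. h x - k x) s \<le> besov2_inner \<beta> h s + besov2_inner \<beta> k s" for s
  proof -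
    have "besov2_inner \<beta> (\<lambda>x. h x - k x) s
       \<le> (\<integral>\<^sup>+u. ennreal (\<bar>h u - h s\<bar> / (s - u) powr (1 + \<beta>)) * indicator {0..s} u
           + ennreal (\<bar>k u - k s\<bar> / (s - u) powr (1 + \<beta>)) * indicator {0..s} u \<partial>lborel)"
      unfolding besov2_inner_def
    proof (rule nn_integral_mono)
      fix u
      show "ennreal (\<bar>h u - k u - (h s - k s)\<bar> / (s - u) powr (1 + \<beta>)) * indicator {0..s} u
        \<le> ennreal (\<bar>h u - h s\<bar> / (s - u) powr (1 + \<beta>)) * indicator {0..s} u
           + ennreal (\<bar>k u - k s\<bar> / (s - u) powr (1 + \<beta>)) * indicator {0..s} u"
        using tri[of "(s - u) powr (1 + \<beta>)" "h u - h s" "k u - k s"]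
        by (auto simp: indicator_def algebra_simps)
    qed
    also have "\<dots> = besov2_inner \<beta> h s + besov2_inner \<beta> k s"
      unfolding besov2_inner_def by (rule nn_integral_add) auto
    finally show ?thesis .
  qed
  have "besov2_norm T \<beta> (\<lambda>x. h x - k x)
     \<le> (\<integral>\<^sup>+s. (ennreal (\<bar>h s\<bar> / s powr \<beta>) + besov2_inner \<beta> h s) * indicator {0..T} s
         + (ennreal (\<bar>k s\<bar> / s powr \<beta>) + besov2_inner \<beta> k s) * indicator {0..T} s \<partial>lborel)"
  proof (subst besov2_norm_borel, measurable, rule nn_integral_mono)
    fix s
    have "ennreal (\<bar>h s - k s\<bar> / s powr \<beta>) + besov2_inner \<beta> (\<lambda>x. h x - k x) s
      \<le> (ennreal (\<bar>h s\<bar> / s powr \<beta>) + ennreal (\<bar>k s\<bar> / s powr \<beta>)) + (besov2_inner \<beta> h s + besov2_inner \<beta> k s)"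
      by (intro add_mono tri inner) simp
    then show "(ennreal (\<bar>h s - k s\<bar> / s powr \<beta>) + besov2_inner \<beta> (\<lambda>x. h x - k x) s) * indicator {0..T} s
      \<le> (ennreal (\<bar>h s\<bar> / s powr \<beta>) + besov2_inner \<beta> h s) * indicator {0..T} s
         + (ennreal (\<bar>k s\<bar> / s powr \<beta>) + besov2_inner \<beta> k s) * indicator {0..T} s"
      by (auto simp: indicator_def ac_simps)
  qed
  also have "\<dots> = besov2_norm T \<beta> h + besov2_norm T \<beta> k"
    by (subst nn_integral_add) (auto simp: besov2_norm_borel)
  finally show ?thesis .
qed

lemma besov2_AE_integrable:
  assumes [measurable]: "h \<in> borel_measurable borel" and fin: "besov2_norm T \<beta> h < \<infinity>"
  shows "AE s in lborel. s \<in> {0..T} \<longrightarrow>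
    set_integrable lebesgue {0..s} (\<lambda>u. (h s - h u) / (s - u) powr (\<beta> + 1))"
proof -
  have "AE s in lborel. (ennreal (\<bar>h s\<bar> / s powr \<beta>) + besov2_inner \<beta> h s) * indicator {0..T} s \<noteq> \<infinity>"
    using fin unfolding besov2_norm_borel[OF assms(1)] by (intro nn_integral_PInf_AE) auto
  then show ?thesis
  proof (rule AE_mp, intro AE_I2 impI)
    fix s assume s: "s \<in> {0..T}" and *: "(ennreal (\<bar>h s\<bar> / s powr \<beta>) + besov2_inner \<beta> h s) * indicator {0..T} s \<noteq> \<infinity>"
    then have "besov2_inner \<beta> h s < \<infinity>" by (simp add: less_top)
    moreover have "besov2_inner \<beta> h s = (\<integral>\<^sup>+u. ennreal (norm (indicator {0..s} u *\<^sub>R ((h s - h u) / (s - u) powr (\<beta> + 1)))) \<partial>lborel)"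
      unfolding besov2_inner_def by (intro nn_integral_cong) (auto simp: indicator_def abs_minus_commute add.commute)
    ultimately have "integrable lborel (\<lambda>u. indicator {0..s} u *\<^sub>R ((h s - h u) / (s - u) powr (\<beta> + 1)))"
      by (intro integrableI_bounded) auto
    then show "set_integrable lebesgue {0..s} (\<lambda>u. (h s - h u) / (s - u) powr (\<beta> + 1))"
      unfolding set_integrable_def by (subst integrable_completion) auto
  qed
qed

text \<open>
The \<open>L\<^sup>1\<close> norm of the left-sided fractional derivative is at most \<open>1 / \<Gamma> (1 - \<beta>)\<close> times the Besov norm.
\<close>

lemma frac_deriv_pairing_bound:
  assumes \<beta>: "0 < \<beta>" "\<beta> < 1" and [measurable]: "h \<in> borel_measurable borel" "\<phi> \<in> borel_measurable borel"
    and fin: "besov2_norm T \<beta> h < \<infinity>" and C: "0 \<le> C" "\<And>s. 0 < s \<Longrightarrow> s < T \<Longrightarrow> \<bar>\<phi> s\<bar> \<le> C"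
  shows "integrable lborel (\<lambda>s. indicator {0<..<T} s * (frac_deriv_0plus \<beta> h s * \<phi> s))" (is "integrable _ ?f")
    and "\<bar>LINT s|lborel. indicator {0<..<T} s * (frac_deriv_0plus \<beta> h s * \<phi> s)\<bar>
       \<le> C / Gamma (1 - \<beta>) * enn2real (besov2_norm T \<beta> h)"
proof -
  have Gam: "0 < Gamma (1 - \<beta>)" using \<beta> by (intro Gamma_real_pos) auto
  have pt: "ennreal \<bar>?f s\<bar> \<le> ennreal (C / Gamma (1 - \<beta>)) * ((ennreal (\<bar>h s\<bar> / s powr \<beta>) + besov2_inner \<beta> h s) * indicator {0..T} s)" for s
  proof (cases "s \<in> {0<..<T}")
    case True
    let ?J = "LINT u:{0..s}|lebesgue. (h s - h u) / (s - u) powr (\<beta> + 1)"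
    have J: "ennreal \<bar>?J\<bar> \<le> besov2_inner \<beta> h s"
    proof -
      have "ennreal \<bar>?J\<bar> \<le> (\<integral>\<^sup>+u. ennreal \<bar>indicator {0..s} u *\<^sub>R ((h s - h u) / (s - u) powr (\<beta> + 1))\<bar> \<partial>lebesgue)"
        unfolding set_lebesgue_integral_def by (rule ennreal_abs_lint_le)
      also have "\<dots> = besov2_inner \<beta> h s"
        unfolding besov2_inner_def nn_integral_completion
        by (intro nn_integral_cong) (auto simp: indicator_def abs_minus_commute add.commute)
      finally show ?thesis .
    qed
    have "\<bar>?f s\<bar> = 1 / Gamma (1 - \<beta>) * \<bar>h s / s powr \<beta> + \<beta> * ?J\<bar> * \<bar>\<phi> s\<bar>"
      using True Gam unfolding frac_deriv_0plus_def by (simp add: abs_mult)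
    also have "\<dots> \<le> 1 / Gamma (1 - \<beta>) * (\<bar>h s\<bar> / s powr \<beta> + 1 * \<bar>?J\<bar>) * C"
    proof (intro mult_mono mult_left_mono)
      have "\<bar>h s / s powr \<beta> + \<beta> * ?J\<bar> \<le> \<bar>h s / s powr \<beta>\<bar> + \<bar>\<beta> * ?J\<bar>" by (rule abs_triangle_ineq)
      also have "\<dots> \<le> \<bar>h s\<bar> / s powr \<beta> + 1 * \<bar>?J\<bar>"
        unfolding abs_mult using \<beta> by (intro add_mono mult_right_mono) auto
      finally show "\<bar>h s / s powr \<beta> + \<beta> * ?J\<bar> \<le> \<bar>h s\<bar> / s powr \<beta> + 1 * \<bar>?J\<bar>" .
    qed (use True C Gam in auto)
    also have "\<dots> = C / Gamma (1 - \<beta>) * (\<bar>h s\<bar> / s powr \<beta> + \<bar>?J\<bar>)" by simp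
    finally have "ennreal \<bar>?f s\<bar> \<le> ennreal (C / Gamma (1 - \<beta>)) * (ennreal (\<bar>h s\<bar> / s powr \<beta>) + ennreal \<bar>?J\<bar>)"
      using C Gam by (subst ennreal_plus[symmetric]) (auto simp: ennreal_mult[symmetric] simp del: ennreal_plus intro!: ennreal_leI)
    also have "\<dots> \<le> ennreal (C / Gamma (1 - \<beta>)) * (ennreal (\<bar>h s\<bar> / s powr \<beta>) + besov2_inner \<beta> h s)"
      by (intro mult_left_mono add_left_mono J) auto
    finally show ?thesis using True by simp
  qed simp
  have nn: "(\<integral>\<^sup>+s. ennreal \<bar>?f s\<bar> \<partial>lborel) \<le> ennreal (C / Gamma (1 - \<beta>)) * besov2_norm T \<beta> h"
    unfolding besov2_norm_borel[OF assms(3)]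
    by (subst nn_integral_cmult[symmetric]) (auto intro!: nn_integral_mono pt)
  have fin2: "ennreal (C / Gamma (1 - \<beta>)) * besov2_norm T \<beta> h < \<infinity>"
    using fin by (simp add: ennreal_mult_less_top)
  show int: "integrable lborel ?f"
    by (rule integrableI_bounded) (use nn fin2 in \<open>auto intro: order.strict_trans1\<close>)
  have "ennreal \<bar>LINT s|lborel. ?f s\<bar> \<le> ennreal (C / Gamma (1 - \<beta>)) * besov2_norm T \<beta> h"
    using order_trans[OF ennreal_abs_lint_le nn] .
  also have "\<dots> = ennreal (C / Gamma (1 - \<beta>) * enn2real (besov2_norm T \<beta> h))"
    using fin C Gam by (subst ennreal_mult) (auto simp: less_top)
  finally show "\<bar>LINT s|lborel. ?f s\<bar> \<le> C / Gamma (1 - \<beta>) * enn2real (besov2_norm T \<beta> h)"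
    using C Gam by (subst (asm) ennreal_le_iff) auto
qed

context
  fixes T \<beta> A :: real and g :: "real \<Rightarrow> real"
  assumes T: "0 < T" and \<beta>: "0 < \<beta>" "\<beta> < 1" and A: "0 \<le> A"
    and hol: "\<And>s t. 0 \<le> s \<Longrightarrow> s < t \<Longrightarrow> t \<le> T \<Longrightarrow> \<bar>g t - g s\<bar> \<le> A * (t - s) powr (1 - \<beta>)"
    and sing: "\<And>s t. 0 \<le> s \<Longrightarrow> s < t \<Longrightarrow> t \<le> T \<Longrightarrow>
      (\<integral>\<^sup>+u\<in>{s..t}. ennreal (\<bar>g u - g s\<bar> / (u - s) powr (1 + (1 - \<beta>))) \<partial>lebesgue) \<le> ennreal A"
begin

private abbreviation "\<phi> \<equiv> right_deriv (1 - \<beta>) (centred_ext T g)"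

private lemma \<gamma>: "0 < 1 - \<beta>" "1 - \<beta> < 1" using \<beta> by auto

private lemmas props = T \<gamma> A hol sing

private lemma measurable_phi [measurable]: "\<phi> \<in> borel_measurable borel"
  using measurable_right_deriv[OF centred_ext_measurable[OF props]] .

private lemma phi_bound: "0 < s \<Longrightarrow> s < T \<Longrightarrow> \<bar>\<phi> s\<bar> \<le> (1 - \<beta>) * (A + A / (1 - \<beta>))"
  using right_deriv_props(4)[OF props] by simp

lemma Lim_at_left_holder: "Lim (at_left T) g = g T"
proof (rule tendsto_Lim)
  have "continuous_on {0..T} g" using holder_imp_continuous_on[OF \<gamma>(1) hol] .
  then have "(g \<longlongrightarrow> g T) (at T within {0..T})" using T by (auto simp: continuous_on)
  then show "(g \<longlongrightarrow> g T) (at_left T)"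
    using T by (simp add: at_within_Icc_at_left)
qed simp

text \<open>
The generalized integral up to the factor \<open>- 1 / \<Gamma> \<beta>\<close>, see \<open>gls_integral_eq\<close>.
\<close>

definition pairing :: "(real \<Rightarrow> real) \<Rightarrow> real" where
  "pairing h = (LINT s|lborel. indicator {0<..<T} s * (frac_deriv_0plus \<beta> h s * \<phi> s))"

text \<open>
The phases of the definition multiply to \<open>e\<^bsup>i\<pi>\<beta>\<^esup> e\<^bsup>i\<pi>(1-\<beta>)\<^esup> = -1\<close>, so the generalized integral is real.
\<close>

lemma gls_integral_eq:
  assumes [measurable]: "h \<in> borel_measurable borel"
  shows "gls_integral \<beta> T h g = complex_of_real (- (1 / Gamma \<beta> * pairing h))"
proof -
  have fd: "frac_deriv_minus (1 - \<beta>) T (\<lambda>r. g r - Lim (at_left T) g) s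
      = cis (pi * (1 - \<beta>)) / complex_of_real (Gamma \<beta>) * complex_of_real (\<phi> s)" if s: "s \<in> {0<..<T}" for s
  proof -
    have "(LINT u:{s..T}|lebesgue. (g s - g T - (g u - g T)) / (u - s) powr (1 - \<beta> + 1))
        = (LINT u:{s..T}|lebesgue. (centred_ext T g s - centred_ext T g u) / (u - s) powr (1 - \<beta> + 1))"
      unfolding set_lebesgue_integral_def
      by (rule Bochner_Integration.integral_cong[OF refl]) (use s in \<open>auto simp: indicator_def centred_ext_def\<close>)
    moreover have "centred_ext T g s = g s - g T" using s by (simp add: centred_ext_def)
    ultimately show ?thesis
      unfolding frac_deriv_minus_def Lim_at_left_holder
      using right_deriv_props(3)[OF props, of s] s by simp
  qed
  have cis1: "cis (pi * \<beta>) * cis (pi * (1 - \<beta>)) = -1"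
    by (simp add: cis_mult algebra_simps)
  define K where "K = cis (pi * (1 - \<beta>)) / complex_of_real (Gamma \<beta>)"
  define F where "F = (\<lambda>s. indicat_real {0..T} s *\<^sub>R (complex_of_real (frac_deriv_0plus \<beta> h s) *
          frac_deriv_minus (1 - \<beta>) T (\<lambda>r. g r - Lim (at_left T) g) s))"
  \<comment> \<open>The endpoints, where the integrand takes default values, are null.\<close>
  have Feq: "F = (\<lambda>s. K * complex_of_real (indicator {0<..<T} s * (frac_deriv_0plus \<beta> h s * \<phi> s))
      + indicat_real {0} s *\<^sub>R F 0 + indicat_real {T} s *\<^sub>R F T)"
  proof (rule ext)
    fix s
    consider "s \<in> {0<..<T}" | "s = 0" | "s = T" | "s \<notin> {0..T}" by fastforce
    then show "F s = K * complex_of_real (indicator {0<..<T} s * (frac_deriv_0plus \<beta> h s * \<phi> s))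
      + indicat_real {0} s *\<^sub>R F 0 + indicat_real {T} s *\<^sub>R F T"
      by cases (use T fd in \<open>auto simp: F_def K_def indicator_def\<close>)
  qed
  have "(LINT s:{0..T}|lebesgue. complex_of_real (frac_deriv_0plus \<beta> h s) *
          frac_deriv_minus (1 - \<beta>) T (\<lambda>r. g r - Lim (at_left T) g) s)
     = (LINT s|lebesgue. cis (pi * (1 - \<beta>)) / complex_of_real (Gamma \<beta>) *
          complex_of_real (indicator {0<..<T} s * (frac_deriv_0plus \<beta> h s * \<phi> s)))"
    unfolding set_lebesgue_integral_def F_def[symmetric] K_def[symmetric]
  proof (rule integral_cong_AE)
    show "F \<in> borel_measurable lebesgue"
      by (subst Feq, rule measurable_completion) measurable
    show "(\<lambda>s. K * complex_of_real (indicator {0<..<T} s * (frac_deriv_0plus \<beta> h s * \<phi> s))) \<in> borel_measurable lebesgue"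
      by (rule measurable_completion) measurable
    have "AE s in lborel. s \<noteq> 0 \<and> s \<noteq> T"
      using AE_lborel_singleton[of 0] AE_lborel_singleton[of T] by eventually_elim simp
    then have "AE s in lebesgue. s \<noteq> 0 \<and> s \<noteq> T" by (rule AE_completion)
    then show "AE s in lebesgue. F s = K * complex_of_real (indicator {0<..<T} s * (frac_deriv_0plus \<beta> h s * \<phi> s))"
      by eventually_elim (subst Feq, simp)
  qed
  also have "\<dots> = cis (pi * (1 - \<beta>)) / complex_of_real (Gamma \<beta>) * complex_of_real (pairing h)"
    unfolding pairing_def by (subst integral_completion) (measurable, simp only: integral_mult_right_zero integral_complex_of_real)
  finally show ?thesis
    unfolding gls_integral_def using cis1 by (simp add: mult.assoc[symmetric])
qed

text \<open>
By \<open>frac_deriv_0plus_indicator\<close> this is \<open>\<Gamma> (1 - \<beta>)\<close> times the pairing of the indicator of the half-line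
from \<open>a\<close>, and the inversion formula evaluates it to an increment of the integrator.
\<close>

private lemma weighted_phi:
  assumes a: "0 \<le> a" "a \<le> T"
  shows "has_bochner_integral lborel (\<lambda>s. indicator {a<..<T} s * ((s - a) powr (- \<beta>) * \<phi> s))
     (Gamma (1 - \<beta>) * Gamma \<beta> * (g a - g T))"
proof -
  define C where "C = (1 - \<beta>) * (A + A / (1 - \<beta>))"
  have C: "0 \<le> C" "\<And>s. 0 < s \<Longrightarrow> s < T \<Longrightarrow> \<bar>\<phi> s\<bar> \<le> C"
    using A \<beta> phi_bound unfolding C_def by auto
  have "integrable lborel (\<lambda>r. indicator {0<..<T - a} r * r powr (1 - \<beta> - 1))"
    using has_bochner_integral_powr_near_0[of "1 - \<beta>" "T - a"] \<beta> a by (auto simp: has_bochner_integral_iff)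
  from lborel_integrable_real_affine[OF this, of 1 "-a"]
  have *: "integrable lborel (\<lambda>s. C * (indicator {a<..<T} s * (s - a) powr (- \<beta>)))"
    by (intro integrable_mult_right) (auto elim!: integrable_cong[THEN iffD1, rotated -1] simp: indicator_def)
  have "integrable lborel (\<lambda>s. indicator {a<..<T} s * ((s - a) powr (- \<beta>) * \<phi> s))"
    by (rule Bochner_Integration.integrable_bound[OF *], measurable, rule AE_I2)
       (use C a in \<open>auto simp: indicator_def abs_mult mult.commute intro!: mult_right_mono\<close>)
  moreover have "(LINT s|lborel. indicator {a<..<T} s * ((s - a) powr (- \<beta>) * \<phi> s)) = Gamma (1 - \<beta>) * Gamma \<beta> * (g a - g T)"
    using integral_right_deriv[OF props a] by simp
  ultimately show ?thesis by (simp only: has_bochner_integral_iff)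
qed

text \<open>
On step functions the generalized integral is the Riemann--Stieltjes sum: write the indicator of each
cell as a difference of indicators of half-lines and use \<open>weighted_phi\<close>.
\<close>

lemma pairing_step_function:
  fixes u c :: "nat \<Rightarrow> real" and k :: nat
  assumes u: "\<And>j. j \<le> k \<Longrightarrow> 0 \<le> u j \<and> u j \<le> T"
  defines "h \<equiv> (\<lambda>x. \<Sum>j<k. c j * (indicator {u j..} x - indicator {u (Suc j)..} x))"
  shows "- (1 / Gamma \<beta> * pairing h) = (\<Sum>j<k. c j * (g (u (Suc j)) - g (u j)))"
proof -
  have Gam: "0 < Gamma (1 - \<beta>)" "0 < Gamma \<beta>" using \<beta> by (auto intro: Gamma_real_pos)
  let ?w = "\<lambda>a s. indicator {a<..<T} s * ((s - a) powr (- \<beta>) * \<phi> s)"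
  have [measurable]: "h \<in> borel_measurable borel" unfolding h_def by measurable
  have pt: "indicator {0<..<T} s * (frac_deriv_0plus \<beta> h s * \<phi> s)
      = (\<Sum>j<k. c j / Gamma (1 - \<beta>) * (?w (u j) s - ?w (u (Suc j)) s))" if s: "\<forall>j\<le>k. s \<noteq> u j" for s
  proof (cases "s \<in> {0<..<T}")
    case True
    have "frac_deriv_0plus \<beta> h s
      = (\<Sum>j<k. c j * frac_deriv_0plus \<beta> (\<lambda>x. indicator {u j..} x - indicator {u (Suc j)..} x) s)"
      unfolding h_def
    proof (rule frac_deriv_0plus_sum)
      fix j assume "j \<in> {..<k}"
      then have "set_integrable lebesgue {0..s} (\<lambda>x. (indicator {u j..} s - indicator {u j..} x) / (s - x) powr (\<beta> + 1)
         - (indicator {u (Suc j)..} s - indicator {u (Suc j)..} x) / (s - x) powr (\<beta> + 1))"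
        using True s u[of j] u[of "Suc j"] \<beta>
        by (intro set_integral_diff(1) frac_deriv_0plus_indicator(1)) auto
      then show "set_integrable lebesgue {0..s} (\<lambda>x. (indicator {u j..} s - indicator {u (Suc j)..} s -
          (indicator {u j..} x - indicator {u (Suc j)..} x)) / (s - x) powr (\<beta> + 1))"
        by (rule set_integrable_cong[THEN iffD1, rotated -1]) (auto simp: diff_divide_distrib)
    qed simp
    also have "\<dots> = (\<Sum>j<k. c j * (1 / Gamma (1 - \<beta>) * (indicator {u j<..} s * (s - u j) powr (- \<beta>))
         - 1 / Gamma (1 - \<beta>) * (indicator {u (Suc j)<..} s * (s - u (Suc j)) powr (- \<beta>))))"
    proof (rule sum.cong[OF refl])
      fix j assume "j \<in> {..<k}"
      then show "c j * frac_deriv_0plus \<beta> (\<lambda>x. indicator {u j..} x - indicator {u (Suc j)..} x) s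
        = c j * (1 / Gamma (1 - \<beta>) * (indicator {u j<..} s * (s - u j) powr (- \<beta>))
         - 1 / Gamma (1 - \<beta>) * (indicator {u (Suc j)<..} s * (s - u (Suc j)) powr (- \<beta>)))"
        using True s u[of j] u[of "Suc j"] \<beta>
        by (subst frac_deriv_0plus_diff) (auto simp: frac_deriv_0plus_indicator)
    qed
    finally show ?thesis
      using True by (simp add: sum_distrib_right sum_distrib_left indicator_def algebra_simps cong: sum.cong)
  next
    case False
    then have "indicator {u j<..<T} s = (0::real)" if "j \<le> k" for j
      using u[OF that] by (auto simp: indicator_def)
    then show ?thesis using False by (auto intro!: sum.neutral)
  qed
  have "AE s in lborel. \<forall>j\<in>{..k}. s \<noteq> u j"
    by (rule AE_ball_countable[THEN iffD2]) (auto intro: AE_lborel_singleton)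
  then have "AE s in lborel. indicator {0<..<T} s * (frac_deriv_0plus \<beta> h s * \<phi> s)
      = (\<Sum>j<k. c j / Gamma (1 - \<beta>) * (?w (u j) s - ?w (u (Suc j)) s))"
    by eventually_elim (rule pt, auto)
  then have "pairing h = (LINT s|lborel. (\<Sum>j<k. c j / Gamma (1 - \<beta>) * (?w (u j) s - ?w (u (Suc j)) s)))"
    unfolding pairing_def by (intro integral_cong_AE) measurable
  also have "\<dots> = (\<Sum>j<k. c j / Gamma (1 - \<beta>) * (Gamma (1 - \<beta>) * Gamma \<beta> * (g (u j) - g T)
        - Gamma (1 - \<beta>) * Gamma \<beta> * (g (u (Suc j)) - g T)))"
    by (intro has_bochner_integral_integral_eq has_bochner_integral_sum has_bochner_integral_mult_right
         has_bochner_integral_diff weighted_phi) (use u in auto)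
  also have "\<dots> = - Gamma \<beta> * (\<Sum>j<k. c j * (g (u (Suc j)) - g (u j)))"
    unfolding sum_distrib_left using Gam by (intro sum.cong) (auto simp: field_simps)
  finally show ?thesis using Gam by simp
qed

text \<open>
The integrator contributes a bounded function, so the generalized integral is Lipschitz continuous in
the Besov norm of the integrand.
\<close>

lemma pairing_diff_bound:
  assumes [measurable]: "h \<in> borel_measurable borel" "k \<in> borel_measurable borel"
    and fin: "besov2_norm T \<beta> h < \<infinity>" "besov2_norm T \<beta> (\<lambda>x. h x - k x) < \<infinity>"
  shows "\<bar>pairing h - pairing k\<bar>
     \<le> (1 - \<beta>) * (A + A / (1 - \<beta>)) / Gamma (1 - \<beta>) * enn2real (besov2_norm T \<beta> (\<lambda>x. h x - k x))"
proof -
  let ?C = "(1 - \<beta>) * (A + A / (1 - \<beta>))"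
  have C: "0 \<le> ?C" using A \<beta> by simp
  have "besov2_norm T \<beta> (\<lambda>x. h x - (h x - k x)) \<le> besov2_norm T \<beta> h + besov2_norm T \<beta> (\<lambda>x. h x - k x)"
    by (rule besov2_norm_diff_le) measurable
  then have fin_k: "besov2_norm T \<beta> k < \<infinity>"
    using fin by (auto intro: order.strict_trans1)
  note bd = frac_deriv_pairing_bound[OF \<beta> _ measurable_phi _ C phi_bound]
  have "pairing h - pairing k = (LINT s|lborel. indicator {0<..<T} s * (frac_deriv_0plus \<beta> h s * \<phi> s)
       - indicator {0<..<T} s * (frac_deriv_0plus \<beta> k s * \<phi> s))"
    unfolding pairing_def using bd(1)[OF assms(1) fin(1)] bd(1)[OF assms(2) fin_k]
    by (subst Bochner_Integration.integral_diff) auto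
  also have "\<dots> = pairing (\<lambda>x. h x - k x)"
    unfolding pairing_def
  proof (rule integral_cong_AE)
    show "AE s in lborel. indicator {0<..<T} s * (frac_deriv_0plus \<beta> h s * \<phi> s)
       - indicator {0<..<T} s * (frac_deriv_0plus \<beta> k s * \<phi> s)
       = indicator {0<..<T} s * (frac_deriv_0plus \<beta> (\<lambda>x. h x - k x) s * \<phi> s)"
      using besov2_AE_integrable[OF assms(1) fin(1)] besov2_AE_integrable[OF assms(2) fin_k]
      by eventually_elim (auto simp: indicator_def frac_deriv_0plus_diff algebra_simps)
  qed measurable
  finally show ?thesis
    unfolding pairing_def using bd(2)[OF _ fin(2)] by simp
qed

end

section \<open>Integrands with dominated oscillation\<close>

text \<open>
\<open>\<Delta> s r\<close> plays the role of the oscillation of a function on \<open>[s - r, s + r]\<close>, and \<open>osc_mass\<close> weighs its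
values at scales below \<open>c\<close> by the singular kernel of the Besov norm.
\<close>

definition osc_mass :: "real \<Rightarrow> (real \<Rightarrow> real \<Rightarrow> real) \<Rightarrow> real \<Rightarrow> real \<Rightarrow> ennreal" where
  "osc_mass \<beta> \<Delta> c s = (\<integral>\<^sup>+r\<in>{0<..<c}. ennreal (\<Delta> s r * r powr (-1 - \<beta>)) \<partial>lborel)"

lemma measurable_osc_mass [measurable]:
  assumes [measurable]: "case_prod \<Delta> \<in> borel_measurable (borel \<Otimes>\<^sub>M borel)"
  shows "osc_mass \<beta> \<Delta> c \<in> borel_measurable borel"
  unfolding osc_mass_def by measurable

lemma osc_mass_mono: "c \<le> d \<Longrightarrow> osc_mass \<beta> \<Delta> c s \<le> osc_mass \<beta> \<Delta> d s"
  unfolding osc_mass_def by (intro nn_integral_mono) (auto simp: indicator_def)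

lemma nn_integral_powr_tail_shift:
  fixes x b \<beta> :: real
  assumes "0 < \<beta>" "x < b"
  shows "(\<integral>\<^sup>+s. ennreal ((s - x) powr (-1 - \<beta>)) * indicator {b..} s \<partial>lborel) = ennreal ((b - x) powr (-\<beta>) / \<beta>)"
proof -
  have "(\<integral>\<^sup>+s. ennreal ((s - x) powr (-1 - \<beta>)) * indicator {b..} s \<partial>lborel)
     = (\<integral>\<^sup>+r. ennreal (indicator {b - x<..} r * r powr (-1 - \<beta>)) \<partial>lborel)"
  proof (subst nn_integral_real_affine[where c=1 and t=x])
    show "ennreal \<bar>1\<bar> * (\<integral>\<^sup>+r. ennreal ((x + 1 * r - x) powr (-1 - \<beta>)) * indicator {b..} (x + 1 * r) \<partial>lborel)
       = (\<integral>\<^sup>+r. ennreal (indicator {b - x<..} r * r powr (-1 - \<beta>)) \<partial>lborel)"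
      using AE_lborel_singleton[of "b - x"]
      by (simp, intro nn_integral_cong_AE) (auto elim!: eventually_mono simp: indicator_def)
  qed auto
  also have "\<dots> = ennreal ((b - x) powr (-\<beta>) / \<beta>)"
    using has_bochner_integral_powr_tail[of \<beta> "b - x"] assms
    by (subst nn_integral_eq_integral) (auto simp: has_bochner_integral_iff)
  finally show ?thesis .
qed

lemma nn_integral_powr_tail_reflect:
  fixes s a \<beta> :: real
  assumes "0 < \<beta>" "a < s"
  shows "(\<integral>\<^sup>+x. ennreal ((s - x) powr (-1 - \<beta>)) * indicator {..<a} x \<partial>lborel) = ennreal ((s - a) powr (-\<beta>) / \<beta>)"
proof -
  have "(\<integral>\<^sup>+x. ennreal ((s - x) powr (-1 - \<beta>)) * indicator {..<a} x \<partial>lborel)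
     = (\<integral>\<^sup>+r. ennreal (indicator {s - a<..} r * r powr (-1 - \<beta>)) \<partial>lborel)"
    by (subst nn_integral_real_affine[where c="-1" and t=s]) (auto simp: indicator_def intro!: nn_integral_cong)
  also have "\<dots> = ennreal ((s - a) powr (-\<beta>) / \<beta>)"
    using has_bochner_integral_powr_tail[of \<beta> "s - a"] assms
    by (subst nn_integral_eq_integral) (auto simp: has_bochner_integral_iff)
  finally show ?thesis .
qed

lemma nn_integral_powr_right_end:
  fixes a b \<beta> :: real
  assumes "\<beta> < 1" "a < b"
  shows "(\<integral>\<^sup>+x. ennreal ((b - x) powr (-\<beta>)) * indicator {a..<b} x \<partial>lborel) = ennreal ((b - a) powr (1 - \<beta>) / (1 - \<beta>))"
proof -
  have "(\<integral>\<^sup>+x. ennreal ((b - x) powr (-\<beta>)) * indicator {a..<b} x \<partial>lborel)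
     = (\<integral>\<^sup>+r. ennreal (r powr (-\<beta>)) * indicator {0<..b - a} r \<partial>lborel)"
    by (subst nn_integral_real_affine[where c="-1" and t=b]) (auto simp: indicator_def intro!: nn_integral_cong)
  also have "\<dots> = (\<integral>\<^sup>+r. ennreal (indicator {0<..<b - a} r * r powr (1 - \<beta> - 1)) \<partial>lborel)"
    using AE_lborel_singleton[of "b - a"]
    by (intro nn_integral_cong_AE) (auto elim!: eventually_mono simp: indicator_def)
  also have "\<dots> = ennreal ((b - a) powr (1 - \<beta>) / (1 - \<beta>))"
    using has_bochner_integral_powr_near_0[of "1 - \<beta>" "b - a"] assms
    by (subst nn_integral_eq_integral) (auto simp: has_bochner_integral_iff)
  finally show ?thesis .
qed

text \<open>
The property of a path on which the convergence of Riemann sums rests. It is stronger than finiteness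
of the Besov norm of \<open>h\<close>: \<open>\<Delta> s r\<close> controls \<open>h\<close> on the whole neighbourhood of \<open>s\<close>, hence also at
partition points nearby. Scales up to \<open>2 T\<close> enter since a value at scale \<open>d\<close> is recovered from
the scales in \<open>(d, 2 d)\<close>.
\<close>

locale dominated_oscillation =
  fixes T \<beta> :: real and h :: "real \<Rightarrow> real" and \<Delta> :: "real \<Rightarrow> real \<Rightarrow> real"
  assumes T: "0 < T" and \<beta>: "0 < \<beta>" "\<beta> < 1"
    and meas_h [measurable]: "h \<in> borel_measurable borel"
    and meas_\<Delta> [measurable]: "case_prod \<Delta> \<in> borel_measurable (borel \<Otimes>\<^sub>M borel)"
    and \<Delta>_nonneg: "\<And>s r. 0 < r \<Longrightarrow> 0 \<le> \<Delta> s r"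
    and \<Delta>_mono: "\<And>s r r'. 0 < r \<Longrightarrow> r \<le> r' \<Longrightarrow> \<Delta> s r \<le> \<Delta> s r'"
    and osc: "\<And>s x. s \<in> {0..T} \<Longrightarrow> x \<in> {0..T} \<Longrightarrow> s \<noteq> x \<Longrightarrow> \<bar>h s - h x\<bar> \<le> \<Delta> s \<bar>s - x\<bar>"
    and h_bounded: "\<exists>B. \<forall>s\<in>{0..T}. \<bar>h s\<bar> \<le> B"
    and finite_mass: "(\<integral>\<^sup>+s\<in>{0..T}. osc_mass \<beta> \<Delta> (2 * T) s \<partial>lborel) < \<infinity>"
begin

lemma osc_le:
  assumes "s \<in> {0..T}" "x \<in> {0..T}" "\<bar>s - x\<bar> \<le> c" "0 < c"
  shows "\<bar>h s - h x\<bar> \<le> \<Delta> s c"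
  using osc[OF assms(1,2)] \<Delta>_mono[of "\<bar>s - x\<bar>" c s] \<Delta>_nonneg[of c s] assms by (cases "s = x") auto

text \<open>
By monotonicity \<open>\<Delta> s r \<ge> \<Delta> s d\<close> for \<open>d < r < 2 d\<close>, and integrating \<open>r\<^bsup>-1-\<beta>\<^esup>\<close> over this range yields \<open>d\<^bsup>-\<beta>\<^esup>\<close> up to
the factor \<open>2\<^bsup>1+\<beta>\<^esup> \<le> 4\<close>.
\<close>

lemma osc_weight_le:
  assumes d: "0 < d"
  shows "ennreal (\<Delta> s d * d powr (-\<beta>)) \<le> 4 * osc_mass \<beta> \<Delta> (2 * d) s"
proof -
  have nn: "0 \<le> \<Delta> s d" using \<Delta>_nonneg d by auto
  have pw: "(2 * d) powr (-1 - \<beta>) = 2 powr (-1 - \<beta>) * d powr (-\<beta>) / d"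
    using d by (simp add: powr_mult powr_diff powr_minus field_simps)
  have two: "4 * 2 powr (-1 - \<beta>) \<ge> (1::real)"
  proof -
    have "2 powr (-2) \<le> (2::real) powr (-1 - \<beta>)" using \<beta> by (intro powr_mono) auto
    then show ?thesis by (simp add: powr_minus)
  qed
  have "\<Delta> s d * d powr (-\<beta>) \<le> 4 * (\<Delta> s d * (2 * d) powr (-1 - \<beta>) * d)"
    using mult_right_mono[OF two, of "\<Delta> s d * d powr (-\<beta>)"] nn d unfolding pw by (simp add: mult_ac)
  then have "ennreal (\<Delta> s d * d powr (-\<beta>)) \<le> ennreal 4 * ennreal (\<Delta> s d * (2 * d) powr (-1 - \<beta>) * d)"
    by (subst ennreal_mult'[symmetric]) (auto intro: ennreal_leI)
  also have "ennreal (\<Delta> s d * (2 * d) powr (-1 - \<beta>) * d)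
      = (\<integral>\<^sup>+r. ennreal (\<Delta> s d * (2 * d) powr (-1 - \<beta>)) * indicator {d<..<2*d} r \<partial>lborel)"
    using d nn by (subst nn_integral_cmult_indicator) (auto simp: ennreal_mult)
  also have "\<dots> \<le> osc_mass \<beta> \<Delta> (2 * d) s"
    unfolding osc_mass_def
  proof (rule nn_integral_mono)
    fix r
    show "ennreal (\<Delta> s d * (2 * d) powr (-1 - \<beta>)) * indicator {d<..<2*d} r
       \<le> ennreal (\<Delta> s r * r powr (-1 - \<beta>)) * indicator {0<..<2*d} r"
      using d nn \<Delta>_mono[of d r s] \<Delta>_nonneg[of r s] \<beta>
      by (auto simp: indicator_def intro!: ennreal_leI mult_mono powr_mono2')
  qed
  finally show ?thesis by (simp add: mult_left_mono)
qed

lemma besov2_norm_finite: "besov2_norm T \<beta> h < \<infinity>"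
proof -
  obtain B where B: "\<And>s. s \<in> {0..T} \<Longrightarrow> \<bar>h s\<bar> \<le> B" using h_bounded by blast
  have B0: "0 \<le> B" using B[of 0] T by auto
  have inner: "besov2_inner \<beta> h s \<le> osc_mass \<beta> \<Delta> (2 * T) s" if s: "s \<in> {0..T}" for s
  proof -
    have "besov2_inner \<beta> h s = (\<integral>\<^sup>+r. ennreal (\<bar>h (s - r) - h s\<bar> / r powr (1 + \<beta>)) * indicator {0..s} (s - r) \<partial>lborel)"
      unfolding besov2_inner_def
      by (subst nn_integral_real_affine[where c="-1" and t=s]) auto
    also have "\<dots> \<le> osc_mass \<beta> \<Delta> (2 * T) s"
      unfolding osc_mass_def
    proof (rule nn_integral_mono)
      fix r
      show "ennreal (\<bar>h (s - r) - h s\<bar> / r powr (1 + \<beta>)) * indicator {0..s} (s - r)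
        \<le> ennreal (\<Delta> s r * r powr (-1 - \<beta>)) * indicator {0<..<2 * T} r"
      proof (cases "0 < r \<and> r \<le> s")
        case True
        then have "\<bar>h (s - r) - h s\<bar> \<le> \<Delta> s r" using osc[of s "s - r"] s by (auto simp: abs_minus_commute)
        then have "\<bar>h (s - r) - h s\<bar> / r powr (1 + \<beta>) \<le> \<Delta> s r * r powr (-1 - \<beta>)"
          using True powr_minus_divide[of r "1 + \<beta>"] by (simp add: divide_right_mono)
        then show ?thesis using True s T by (auto simp: indicator_def intro!: ennreal_leI)
      next
        case False
        then show ?thesis by (cases "r = 0") (auto simp: indicator_def)
      qed
    qed
    finally show ?thesis .
  qed
  have "besov2_norm T \<beta> h \<le> (\<integral>\<^sup>+s. ennreal B * ennreal (indicator {0<..<2*T} s * s powr (1 - \<beta> - 1))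
       + osc_mass \<beta> \<Delta> (2 * T) s * indicator {0..T} s \<partial>lborel)"
  proof (subst besov2_norm_borel[OF meas_h], rule nn_integral_mono)
    fix s
    show "(ennreal (\<bar>h s\<bar> / s powr \<beta>) + besov2_inner \<beta> h s) * indicator {0..T} s
      \<le> ennreal B * ennreal (indicator {0<..<2*T} s * s powr (1 - \<beta> - 1)) + osc_mass \<beta> \<Delta> (2 * T) s * indicator {0..T} s"
    proof (cases "s \<in> {0..T}")
      case True
      have "ennreal (\<bar>h s\<bar> / s powr \<beta>) \<le> ennreal B * ennreal (indicator {0<..<2*T} s * s powr (1 - \<beta> - 1))"
        using True B[OF True] B0 T
        by (cases "s = 0") (auto simp: ennreal_mult[symmetric] powr_minus_divide intro!: ennreal_leI divide_right_mono)
      then show ?thesis using True inner by (auto intro: add_mono)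
    qed auto
  qed
  also have "\<dots> = ennreal B * (\<integral>\<^sup>+s. ennreal (indicator {0<..<2*T} s * s powr (1 - \<beta> - 1)) \<partial>lborel)
      + (\<integral>\<^sup>+s\<in>{0..T}. osc_mass \<beta> \<Delta> (2 * T) s \<partial>lborel)"
    by (subst nn_integral_add, measurable) (subst nn_integral_cmult, auto)
  also have "\<dots> < \<infinity>"
  proof -
    have "(\<integral>\<^sup>+s. ennreal (indicator {0<..<2*T} s * s powr (1 - \<beta> - 1)) \<partial>lborel) = ennreal ((2*T) powr (1 - \<beta>) / (1 - \<beta>))"
      using has_bochner_integral_powr_near_0[of "1 - \<beta>" "2*T"] \<beta> T
      by (subst nn_integral_eq_integral) (auto simp: has_bochner_integral_iff)
    then show ?thesis using finite_mass by (simp add: ennreal_mult_less_top)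
  qed
  finally show ?thesis .
qed

lemma osc_mass_vanishes:
  assumes m: "m \<longlonglongrightarrow> (0::real)" and mT: "\<And>n. m n \<le> T"
  shows "(\<lambda>n. \<integral>\<^sup>+s\<in>{0..T}. osc_mass \<beta> \<Delta> (2 * m n) s \<partial>lborel) \<longlonglongrightarrow> 0"
proof -
  define F where "F = (\<lambda>c z. ennreal (\<Delta> (fst z) (snd z) * snd z powr (-1 - \<beta>)) * indicator {0<..<c} (snd z) * indicator {0..T} (fst z :: real))"
  have [measurable]: "F c \<in> borel_measurable (lborel \<Otimes>\<^sub>M lborel)" for c
    unfolding F_def by measurable
  have F: "(\<integral>\<^sup>+s\<in>{0..T}. osc_mass \<beta> \<Delta> c s \<partial>lborel) = (\<integral>\<^sup>+z. F c z \<partial>(lborel \<Otimes>\<^sub>M lborel))" for c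
    by (subst lborel.nn_integral_fst[symmetric]) (auto simp: F_def osc_mass_def nn_integral_multc)
  have "(\<lambda>n. \<integral>\<^sup>+z. F (2 * m n) z \<partial>(lborel \<Otimes>\<^sub>M lborel)) \<longlonglongrightarrow> (\<integral>\<^sup>+z. 0 \<partial>(lborel \<Otimes>\<^sub>M lborel :: (real \<times> real) measure))"
  proof (rule nn_integral_dominated_convergence[where w="F (2 * T)"])
    show "(\<integral>\<^sup>+z. F (2 * T) z \<partial>(lborel \<Otimes>\<^sub>M lborel)) < \<infinity>" using finite_mass unfolding F .
    show "AE z in lborel \<Otimes>\<^sub>M lborel. F (2 * m n) z \<le> F (2 * T) z" for n
      using mT[of n] by (intro AE_I2) (auto simp: F_def indicator_def)
    show "AE z in lborel \<Otimes>\<^sub>M lborel. (\<lambda>n. F (2 * m n) z) \<longlonglongrightarrow> 0"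
    proof (rule AE_I2)
      fix z :: "real \<times> real"
      have "\<forall>\<^sub>F n in sequentially. F (2 * m n) z = 0"
      proof (cases "0 < snd z")
        case True
        have "(\<lambda>n. 2 * m n) \<longlonglongrightarrow> 0" using tendsto_mult_left[OF m, of 2] by simp
        then have "\<forall>\<^sub>F n in sequentially. 2 * m n < snd z" using True by (rule order_tendstoD)
        then show ?thesis by eventually_elim (auto simp: F_def)
      qed (auto simp: F_def)
      then show "(\<lambda>n. F (2 * m n) z) \<longlonglongrightarrow> 0" by (rule tendsto_eventually)
    qed
  qed auto
  then show ?thesis unfolding F by simp
qed

end

section \<open>Besov distance to the step function of a partition\<close>

text \<open>
The step function with value \<open>c j\<close> on the cell \<open>[u j, u (j + 1))\<close>, written with half-lines so that
\<open>pairing_step_function\<close> applies to it.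
\<close>

definition step_sum :: "nat \<Rightarrow> (nat \<Rightarrow> real) \<Rightarrow> (nat \<Rightarrow> real) \<Rightarrow> real \<Rightarrow> real" where
  "step_sum k u c x = (\<Sum>j<k. c j * (indicator {u j..} x - indicator {u (Suc j)..} x))"

lemma measurable_step_sum [measurable]: "step_sum k u c \<in> borel_measurable borel"
  unfolding step_sum_def by measurable

context dominated_oscillation
begin

context
  fixes k :: nat and u :: "nat \<Rightarrow> real" and m :: real
  assumes part: "is_partition T k u" and m: "0 < m" "m \<le> T"
    and mesh_le: "\<And>j. j < k \<Longrightarrow> u (Suc j) - u j \<le> m"
begin

private lemma u_less: "i < j \<Longrightarrow> j \<le> k \<Longrightarrow> u i < u j"
  using part strict_mono_onD[of "{..k}" u i j] unfolding is_partition_def by simp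

private lemma u_le: "i \<le> j \<Longrightarrow> j \<le> k \<Longrightarrow> u i \<le> u j"
  using u_less[of i j] by (cases "i = j") auto

private lemma u_range: "j \<le> k \<Longrightarrow> u j \<in> {0..T}"
  using u_le[of 0 j] u_le[of j k] part unfolding is_partition_def by simp

private lemma interval_unique:
  assumes "i < k" "j < k" "x \<in> {u i..<u (Suc i)}" "x \<in> {u j..<u (Suc j)}"
  shows "i = j"
proof (rule ccontr)
  assume "i \<noteq> j"
  then consider "Suc i \<le> j" | "Suc j \<le> i" by linarith
  then show False using u_le[of "Suc i" j] u_le[of "Suc j" i] assms by cases auto
qed

private lemma interval_ex:
  assumes "0 \<le> x" "x < T" shows "\<exists>j<k. x \<in> {u j..<u (Suc j)}"
proof -
  have ex: "\<exists>j. j \<le> k \<and> x < u j" using part assms unfolding is_partition_def by auto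
  define j where "j = (LEAST j. j \<le> k \<and> x < u j)"
  have j: "j \<le> k" "x < u j" using LeastI_ex[OF ex] unfolding j_def by auto
  have "j \<noteq> 0" using j part assms unfolding is_partition_def by (metis not_less)
  then obtain i where i: "j = Suc i" by (cases j) auto
  have "\<not> x < u i" using not_less_Least[of i "\<lambda>j. j \<le> k \<and> x < u j"] j i unfolding j_def by auto
  then show ?thesis using j i by (intro exI[of _ i]) auto
qed

lemma step_sum_eq:
  assumes j: "j < k" and x: "x \<in> {u j..<u (Suc j)}"
  shows "step_sum k u c x = c j"
proof -
  have "indicator {u i..} x - indicator {u (Suc i)..} x = (if i = j then 1 else 0 :: real)" if "i < k" for i
  proof (cases "i = j")
    case False
    then have "x \<notin> {u i..<u (Suc i)}" using interval_unique[OF that j _ x] by blast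
    moreover have "u i \<le> u (Suc i)" using u_le[of i "Suc i"] that by simp
    ultimately show ?thesis using False by (auto simp: indicator_def)
  qed (use x in \<open>auto simp: indicator_def\<close>)
  then have "step_sum k u c x = (\<Sum>i<k. if i = j then c i else 0)"
    unfolding step_sum_def by (intro sum.cong) auto
  also have "\<dots> = c j" using j by simp
  finally show ?thesis .
qed

text \<open>
\<open>hn\<close> approximates \<open>h\<close> by its value at the left end \<open>a x\<close> of the cell \<open>[a x, b x)\<close> around \<open>x\<close>; \<open>e\<close> is the error.
\<close>

private abbreviation "hn \<equiv> step_sum k u (\<lambda>j. h (u j))"
private abbreviation "a \<equiv> step_sum k u u"
private abbreviation "b \<equiv> step_sum k u (\<lambda>j. u (Suc j))"
private abbreviation "e \<equiv> (\<lambda>x. h x - hn x)"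
private abbreviation "osc2 \<equiv> osc_mass \<beta> \<Delta> (2 * m)"
private abbreviation "\<Theta> \<equiv> \<integral>\<^sup>+x\<in>{0..T}. osc2 x \<partial>lborel"

private lemma cell:
  assumes "0 \<le> x" "x < T"
  shows "0 \<le> a x" "a x \<le> x" "x < b x" "b x \<le> T" "b x - a x \<le> m" "hn x = h (a x)" "a x < b x"
proof -
  obtain j where j: "j < k" "x \<in> {u j..<u (Suc j)}" using interval_ex[OF assms] by blast
  show "0 \<le> a x" "a x \<le> x" "x < b x" "b x \<le> T" "b x - a x \<le> m" "hn x = h (a x)" "a x < b x"
    using j u_range[of j] u_range[of "Suc j"] mesh_le[OF j(1)]
    unfolding step_sum_eq[OF j] by auto
qed

private lemma cell_cases:
  assumes "0 \<le> x" "x < s" "s < T"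
  shows "s < b x \<and> a s = a x \<or> b x \<le> a s"
proof -
  obtain i where i: "i < k" "x \<in> {u i..<u (Suc i)}" using interval_ex[of x] assms by auto
  obtain j where j: "j < k" "s \<in> {u j..<u (Suc j)}" using interval_ex[of s] assms by auto
  consider "i = j" | "Suc i \<le> j" | "Suc j \<le> i" by linarith
  then show ?thesis
  proof cases
    case 1
    then show ?thesis using i j unfolding step_sum_eq[OF i] step_sum_eq[OF j] by simp
  next
    case 2
    then show ?thesis using u_le[of "Suc i" j] j unfolding step_sum_eq[OF i] step_sum_eq[OF j] by simp
  next
    case 3
    then have False using u_le[of "Suc j" i] i j assms by simp
    then show ?thesis ..
  qed
qed

text \<open>
If \<open>x\<close> and \<open>s\<close> share a cell, \<open>hn\<close> drops out of the increment and \<open>s - x < m\<close>. Otherwise both errors are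
estimated separately, which is affordable because \<open>s - x\<close> is then at least the distance of \<open>s\<close> to the
left end of its cell and of \<open>x\<close> to the right end of its cell.
\<close>

private lemma diff_le:
  assumes x: "0 \<le> x" "x < s" and s: "s < T"
  shows "ennreal (\<bar>e x - e s\<bar> / (s - x) powr (1 + \<beta>))
     \<le> ennreal (\<Delta> s (s - x) * (s - x) powr (-1 - \<beta>)) * indicator {0<..<m} (s - x)
       + ennreal \<bar>e s\<bar> * (ennreal ((s - x) powr (-1 - \<beta>)) * indicator {..<a s} x)
       + ennreal \<bar>e x\<bar> * (ennreal ((s - x) powr (-1 - \<beta>)) * indicator {b x..} s)"
proof -
  have p: "\<bar>z\<bar> / (s - x) powr (1 + \<beta>) = \<bar>z\<bar> * (s - x) powr (-1 - \<beta>)" for z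
    using x powr_minus_divide[of "s - x" "1 + \<beta>"] by simp
  note cx = cell[of x] and cs = cell[of s]
  consider "s < b x" "a s = a x" | "b x \<le> a s" using cell_cases[OF x s] by blast
  then show ?thesis
  proof cases
    case 1
    have "e x - e s = h x - h s" using 1 cx cs x s by auto
    then have "\<bar>e x - e s\<bar> \<le> \<Delta> s (s - x)" using osc[of s x] x s by (auto simp: abs_minus_commute)
    then have "ennreal (\<bar>e x - e s\<bar> / (s - x) powr (1 + \<beta>)) \<le> ennreal (\<Delta> s (s - x) * (s - x) powr (-1 - \<beta>))"
      unfolding p by (intro ennreal_leI mult_right_mono) auto
    moreover have "s - x \<in> {0<..<m}" using 1 cx x s by auto
    ultimately show ?thesis by (simp add: add_increasing2)
  next
    case 2
    have "x < a s" using cx 2 x s by auto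
    have "b x \<le> s" using cs 2 x s by auto
    have "\<bar>e x - e s\<bar> \<le> \<bar>e s\<bar> + \<bar>e x\<bar>" by simp
    then have "ennreal (\<bar>e x - e s\<bar> / (s - x) powr (1 + \<beta>)) \<le> ennreal (\<bar>e s\<bar> * (s - x) powr (-1 - \<beta>) + \<bar>e x\<bar> * (s - x) powr (-1 - \<beta>))"
      unfolding p by (intro ennreal_leI) (auto simp: distrib_right[symmetric] intro!: mult_right_mono)
    also have "\<dots> = ennreal \<bar>e s\<bar> * ennreal ((s - x) powr (-1 - \<beta>)) + ennreal \<bar>e x\<bar> * ennreal ((s - x) powr (-1 - \<beta>))"
      by (simp add: ennreal_mult)
    finally show ?thesis using \<open>x < a s\<close> \<open>b x \<le> s\<close> by (simp add: add_increasing add.assoc)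
  qed
qed

text \<open>
The weight is the integral of the kernel over everything to the left of the cell of \<open>s\<close>. The error
compares \<open>h\<close> at the two end points of \<open>[a s, s]\<close>, so it is small when the weight is large.
\<close>
private lemma e_left_le:
  assumes s: "0 \<le> s" "s < T" "s \<noteq> a s"
  shows "ennreal (\<bar>e s\<bar> * (s - a s) powr (-\<beta>)) \<le> 4 * osc2 s"
proof -
  have d: "0 < s - a s" "s - a s \<le> m" using cell[OF s(1,2)] s(3) by auto
  have "\<bar>e s\<bar> \<le> \<Delta> s (s - a s)" using osc_le[of s "a s" "s - a s"] cell[OF s(1,2)] s d by auto
  then have "ennreal (\<bar>e s\<bar> * (s - a s) powr (-\<beta>)) \<le> ennreal (\<Delta> s (s - a s) * (s - a s) powr (-\<beta>))"
    by (intro ennreal_leI mult_right_mono) auto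
  also have "\<dots> \<le> 4 * osc_mass \<beta> \<Delta> (2 * (s - a s)) s" by (rule osc_weight_le[OF d(1)])
  also have "\<dots> \<le> 4 * osc2 s"
    by (intro mult_left_mono osc_mass_mono) (use d in auto)
  finally show ?thesis .
qed

text \<open>
The jump of the step function at \<open>b x\<close> is not small when \<open>x\<close> is close to \<open>b x\<close>, so a pointwise
estimate fails. But the jump is constant on the cell: integrating the weight over a cell of length
\<open>l\<close> gives \<open>l\<^bsup>1-\<beta>\<^esup> / (1 - \<beta>)\<close>, which is redistributed over the cell as the constant density \<open>l\<^bsup>-\<beta>\<^esup> / (1 - \<beta>)\<close>.
From any point of the cell both ends are within distance \<open>l\<close>, so the jump is at most twice the
oscillation there at scale \<open>l\<close>.
\<close>

private lemma jump_le:
  shows "(\<integral>\<^sup>+x\<in>{0..<T}. ennreal (\<bar>h (b x) - h (a x)\<bar> * (b x - x) powr (-\<beta>)) \<partial>lborel)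
     \<le> ennreal (8 / (1 - \<beta>)) * \<Theta>"
proof -
  let ?I = "\<lambda>j. {u j..<u (Suc j)}"
  have split: "(indicator {0..<T} x :: ennreal) = (\<Sum>j<k. indicator (?I j) x)" for x
  proof (cases "0 \<le> x \<and> x < T")
    case True
    then obtain j where j: "j < k" "x \<in> ?I j" using interval_ex by blast
    have "(\<Sum>i<k. indicator (?I i) x) = (\<Sum>i<k. if i = j then 1 else 0 :: ennreal)"
    proof (rule sum.cong[OF refl])
      fix i assume "i \<in> {..<k}"
      then have "x \<in> ?I i \<longleftrightarrow> i = j" using interval_unique[of i j x] j by auto
      then show "indicator (?I i) x = (if i = j then 1 else 0 :: ennreal)" by (simp add: indicator_def)
    qed
    then show ?thesis using True j by simp
  next
    case False
    have "x \<notin> ?I i" if "i < k" for i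
      using False u_range[of i] u_range[of "Suc i"] that by auto
    then show ?thesis using False by simp
  qed
  have cell_sum: "(\<integral>\<^sup>+x\<in>{0..<T}. F x \<partial>lborel) = (\<Sum>j<k. \<integral>\<^sup>+x\<in>?I j. F x \<partial>lborel)"
    if [measurable]: "F \<in> borel_measurable borel" for F
    unfolding split sum_distrib_left by (rule nn_integral_sum) measurable
  have one: "(\<integral>\<^sup>+x\<in>?I j. ennreal (\<bar>h (b x) - h (a x)\<bar> * (b x - x) powr (-\<beta>)) \<partial>lborel)
      \<le> (\<integral>\<^sup>+x\<in>?I j. ennreal (8 / (1 - \<beta>)) * osc2 x \<partial>lborel)" if j: "j < k" for j
  proof -
    define l where "l = u (Suc j) - u j"
    define H where "H = \<bar>h (u (Suc j)) - h (u j)\<bar>"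
    have l: "0 < l" "l \<le> m" using u_less[of j "Suc j"] mesh_le[OF j] j by (auto simp: l_def)
    have H: "0 \<le> H" by (simp add: H_def)
    have "(\<integral>\<^sup>+x\<in>?I j. ennreal (\<bar>h (b x) - h (a x)\<bar> * (b x - x) powr (-\<beta>)) \<partial>lborel)
       = (\<integral>\<^sup>+x. ennreal H * (ennreal ((u (Suc j) - x) powr (-\<beta>)) * indicator (?I j) x) \<partial>lborel)"
      using j by (intro nn_integral_cong) (auto simp: indicator_def step_sum_eq[OF j] H_def ennreal_mult)
    also have "\<dots> = ennreal H * ennreal (l powr (1 - \<beta>) / (1 - \<beta>))"
      using nn_integral_powr_right_end[of \<beta> "u j" "u (Suc j)"] \<beta> l by (subst nn_integral_cmult) (auto simp: l_def)
    also have "\<dots> = ennreal (1 / (1 - \<beta>)) * (ennreal (H * l powr (-\<beta>)) * ennreal l)"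
      using H \<beta> l by (simp add: ennreal_mult[symmetric] powr_diff powr_minus field_simps)
    also have "\<dots> = ennreal (1 / (1 - \<beta>)) * (\<integral>\<^sup>+x. ennreal (H * l powr (-\<beta>)) * indicator (?I j) x \<partial>lborel)"
      using l by (subst nn_integral_cmult_indicator) (auto simp: l_def)
    also have "\<dots> \<le> ennreal (1 / (1 - \<beta>)) * (\<integral>\<^sup>+x. 8 * osc2 x * indicator (?I j) x \<partial>lborel)"
    proof (intro mult_left_mono nn_integral_mono)
      fix x
      show "ennreal (H * l powr (-\<beta>)) * indicator (?I j) x \<le> 8 * osc2 x * indicator (?I j) x"
      proof (cases "x \<in> ?I j")
        case True
        then have x: "x \<in> {0..T}" using u_range[of j] u_range[of "Suc j"] j by auto
        have "\<bar>h x - h (u (Suc j))\<bar> \<le> \<Delta> x l" "\<bar>h x - h (u j)\<bar> \<le> \<Delta> x l"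
          using True x l u_range[of j] u_range[of "Suc j"] j by (auto intro!: osc_le simp: l_def)
        then have "H \<le> 2 * \<Delta> x l" unfolding H_def by simp
        then have "ennreal (H * l powr (-\<beta>)) \<le> ennreal (2 * (\<Delta> x l * l powr (-\<beta>)))"
          by (intro ennreal_leI) (metis mult.assoc mult_right_mono powr_ge_zero)
        also have "\<dots> = 2 * ennreal (\<Delta> x l * l powr (-\<beta>))"
          using \<Delta>_nonneg[of l x] l by (subst ennreal_mult) auto
        also have "\<dots> \<le> 2 * (4 * osc_mass \<beta> \<Delta> (2 * l) x)"
          by (intro mult_left_mono osc_weight_le l) auto
        also have "\<dots> \<le> 2 * (4 * osc2 x)"
          by (intro mult_left_mono osc_mass_mono) (use l in auto)
        also have "\<dots> = 8 * osc2 x" by (simp add: mult.assoc[symmetric])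
        finally show ?thesis using True by simp
      qed simp
    qed simp
    also have "\<dots> = (\<integral>\<^sup>+x\<in>?I j. ennreal (8 / (1 - \<beta>)) * osc2 x \<partial>lborel)"
    proof -
      have "ennreal (1 / (1 - \<beta>)) * 8 = ennreal (8 / (1 - \<beta>))"
        using \<beta> ennreal_mult[of "1 / (1 - \<beta>)" 8] by simp
      then show ?thesis by (subst nn_integral_cmult[symmetric]) (auto simp: mult.assoc[symmetric])
    qed
    finally show ?thesis .
  qed
  have "(\<integral>\<^sup>+x\<in>{0..<T}. ennreal (\<bar>h (b x) - h (a x)\<bar> * (b x - x) powr (-\<beta>)) \<partial>lborel)
     \<le> (\<integral>\<^sup>+x\<in>{0..<T}. ennreal (8 / (1 - \<beta>)) * osc2 x \<partial>lborel)"
    by (subst (1 2) cell_sum, measurable) (auto intro!: sum_mono one)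
  also have "\<dots> \<le> (\<integral>\<^sup>+x. ennreal (8 / (1 - \<beta>)) * (osc2 x * indicator {0..T} x) \<partial>lborel)"
    by (intro nn_integral_mono) (auto simp: indicator_def)
  also have "\<dots> = ennreal (8 / (1 - \<beta>)) * \<Theta>"
    by (rule nn_integral_cmult) measurable
  finally show ?thesis .
qed

text \<open>
Here the weight blows up at the other end of the cell. The error is the change of \<open>h\<close> from \<open>x\<close> to \<open>b x\<close>,
which behaves as in \<open>e_left_le\<close>, plus the jump of the step function at \<open>b x\<close>.
\<close>

private lemma e_right_le:
  shows "(\<integral>\<^sup>+x\<in>{0..<T}. ennreal (\<bar>e x\<bar> * (b x - x) powr (-\<beta>)) \<partial>lborel)
     \<le> ennreal (4 + 8 / (1 - \<beta>)) * \<Theta>"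
proof -
  have "(\<integral>\<^sup>+x\<in>{0..<T}. ennreal (\<bar>e x\<bar> * (b x - x) powr (-\<beta>)) \<partial>lborel)
     \<le> (\<integral>\<^sup>+x. 4 * (osc2 x * indicator {0..T} x)
          + ennreal (\<bar>h (b x) - h (a x)\<bar> * (b x - x) powr (-\<beta>)) * indicator {0..<T} x \<partial>lborel)"
  proof (rule nn_integral_mono)
    fix x
    show "ennreal (\<bar>e x\<bar> * (b x - x) powr (-\<beta>)) * indicator {0..<T} x \<le>
      4 * (osc2 x * indicator {0..T} x) + ennreal (\<bar>h (b x) - h (a x)\<bar> * (b x - x) powr (-\<beta>)) * indicator {0..<T} x"
    proof (cases "x \<in> {0..<T}")
      case True
      then have x: "0 \<le> x" "x < T" by auto
      note c = cell[OF x]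
      have "\<bar>h x - h (b x)\<bar> \<le> \<Delta> x (b x - x)" using c x by (intro osc_le) auto
      then have "\<bar>e x\<bar> \<le> \<Delta> x (b x - x) + \<bar>h (b x) - h (a x)\<bar>" using c by auto
      then have "\<bar>e x\<bar> * (b x - x) powr (-\<beta>) \<le> (\<Delta> x (b x - x) + \<bar>h (b x) - h (a x)\<bar>) * (b x - x) powr (-\<beta>)"
        by (intro mult_right_mono) auto
      then have "ennreal (\<bar>e x\<bar> * (b x - x) powr (-\<beta>)) \<le>
          ennreal (\<Delta> x (b x - x) * (b x - x) powr (-\<beta>)) + ennreal (\<bar>h (b x) - h (a x)\<bar> * (b x - x) powr (-\<beta>))"
        using \<Delta>_nonneg[of "b x - x" x] c
        by (subst ennreal_plus[symmetric]) (auto simp: distrib_right[symmetric] simp del: ennreal_plus intro!: ennreal_leI)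
      also have "ennreal (\<Delta> x (b x - x) * (b x - x) powr (-\<beta>)) \<le> 4 * osc_mass \<beta> \<Delta> (2 * (b x - x)) x"
        using c by (intro osc_weight_le) auto
      also have "\<dots> \<le> 4 * osc2 x"
        by (intro mult_left_mono osc_mass_mono) (use c in auto)
      finally show ?thesis using x by (simp add: add_right_mono)
    qed simp
  qed
  also have "\<dots> = 4 * \<Theta>
      + (\<integral>\<^sup>+x\<in>{0..<T}. ennreal (\<bar>h (b x) - h (a x)\<bar> * (b x - x) powr (-\<beta>)) \<partial>lborel)"
    by (subst nn_integral_add, measurable) (subst nn_integral_cmult, auto)
  also have "\<dots> \<le> 4 * \<Theta>
      + ennreal (8 / (1 - \<beta>)) * \<Theta>"
    by (intro add_left_mono jump_le)
  also have "\<dots> = ennreal (4 + 8 / (1 - \<beta>)) * \<Theta>"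
    using \<beta> by (subst ennreal_plus) (auto simp: distrib_right)
  finally show ?thesis .
qed


private definition left_part :: "real \<Rightarrow> ennreal" where
  "left_part s = ennreal (\<bar>e s\<bar> * (s - a s) powr (-\<beta>))"

private definition right_part :: "real \<Rightarrow> real \<Rightarrow> ennreal" where
  "right_part s x = ennreal \<bar>e x\<bar> * (ennreal ((s - x) powr (-1 - \<beta>)) * indicator {b x..} s) * indicator {0..<T} x"

private lemma measurable_parts [measurable]:
  "left_part \<in> borel_measurable borel" "case_prod right_part \<in> borel_measurable (borel \<Otimes>\<^sub>M borel)"
proof -
  show "left_part \<in> borel_measurable borel" unfolding left_part_def by measurable
  have "case_prod right_part = (\<lambda>(s, x). ennreal \<bar>e x\<bar> *
      (ennreal ((s - x) powr (-1 - \<beta>)) * (if b x \<le> s then 1 else 0)) * indicator {0..<T} x)"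
    unfolding right_part_def by (auto simp: fun_eq_iff indicator_def)
  then show "case_prod right_part \<in> borel_measurable (borel \<Otimes>\<^sub>M borel)" by simp
qed

private lemma integrand_le:
  assumes s: "0 \<le> s" "s < T" "s \<noteq> a s"
  shows "ennreal (\<bar>e s\<bar> / s powr \<beta>) + besov2_inner \<beta> e s
     \<le> ennreal (1 + 1 / \<beta>) * left_part s + osc2 s + (\<integral>\<^sup>+x. right_part s x \<partial>lborel)"
proof -
  have d: "0 < s - a s" "s - a s \<le> s" using cell[OF s(1,2)] s(3) by auto
  \<comment> \<open>The weight at the origin is dominated by the weight at the left end of the cell.\<close>
  have "s powr (-\<beta>) \<le> (s - a s) powr (-\<beta>)" using d \<beta> by (intro powr_mono2') auto
  then have "\<bar>e s\<bar> * s powr (-\<beta>) \<le> \<bar>e s\<bar> * (s - a s) powr (-\<beta>)" by (rule mult_left_mono) simp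
  moreover have "\<bar>e s\<bar> / s powr \<beta> = \<bar>e s\<bar> * s powr (-\<beta>)" by (simp add: powr_minus_divide)
  ultimately have "\<bar>e s\<bar> / s powr \<beta> \<le> \<bar>e s\<bar> * (s - a s) powr (-\<beta>)" by simp
  then have one: "ennreal (\<bar>e s\<bar> / s powr \<beta>) \<le> left_part s" unfolding left_part_def by (rule ennreal_leI)
  have "besov2_inner \<beta> e s \<le> (\<integral>\<^sup>+x. ennreal (\<Delta> s (s - x) * (s - x) powr (-1 - \<beta>)) * indicator {0<..<m} (s - x)
       + ennreal \<bar>e s\<bar> * (ennreal ((s - x) powr (-1 - \<beta>)) * indicator {..<a s} x) + right_part s x \<partial>lborel)"
    unfolding besov2_inner_def
  proof (rule nn_integral_mono)
    fix x
    show "ennreal (\<bar>e x - e s\<bar> / (s - x) powr (1 + \<beta>)) * indicator {0..s} x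
      \<le> ennreal (\<Delta> s (s - x) * (s - x) powr (-1 - \<beta>)) * indicator {0<..<m} (s - x)
       + ennreal \<bar>e s\<bar> * (ennreal ((s - x) powr (-1 - \<beta>)) * indicator {..<a s} x) + right_part s x"
    proof (cases "0 \<le> x \<and> x < s")
      case True
      then show ?thesis using diff_le[of x s] s unfolding right_part_def by simp
    next
      case False
      then show ?thesis by (cases "x = s") (auto simp: indicator_def)
    qed
  qed
  also have "\<dots> = (\<integral>\<^sup>+x. ennreal (\<Delta> s (s - x) * (s - x) powr (-1 - \<beta>)) * indicator {0<..<m} (s - x) \<partial>lborel)
       + (\<integral>\<^sup>+x. ennreal \<bar>e s\<bar> * (ennreal ((s - x) powr (-1 - \<beta>)) * indicator {..<a s} x) \<partial>lborel)
       + (\<integral>\<^sup>+x. right_part s x \<partial>lborel)"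
  proof -
    let ?f1 = "\<lambda>x. ennreal (\<Delta> s (s - x) * (s - x) powr (-1 - \<beta>)) * indicator {0<..<m} (s - x)"
    let ?f2 = "\<lambda>x. ennreal \<bar>e s\<bar> * (ennreal ((s - x) powr (-1 - \<beta>)) * indicator {..<a s} x)"
    have [measurable]: "?f1 \<in> borel_measurable lborel" "?f2 \<in> borel_measurable lborel" "right_part s \<in> borel_measurable lborel"
      by measurable
    show ?thesis
      using nn_integral_add[of "\<lambda>x. ?f1 x + ?f2 x" lborel "right_part s"] nn_integral_add[of ?f1 lborel ?f2] by simp
  qed
  also have "(\<integral>\<^sup>+x. ennreal (\<Delta> s (s - x) * (s - x) powr (-1 - \<beta>)) * indicator {0<..<m} (s - x) \<partial>lborel) = osc_mass \<beta> \<Delta> m s"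
    unfolding osc_mass_def by (subst nn_integral_real_affine[where c="-1" and t=s]) auto
  also have "\<dots> \<le> osc2 s" using m by (intro osc_mass_mono) auto
  also have "(\<integral>\<^sup>+x. ennreal \<bar>e s\<bar> * (ennreal ((s - x) powr (-1 - \<beta>)) * indicator {..<a s} x) \<partial>lborel) = ennreal (1 / \<beta>) * left_part s"
  proof -
    have "(\<integral>\<^sup>+x. ennreal \<bar>e s\<bar> * (ennreal ((s - x) powr (-1 - \<beta>)) * indicator {..<a s} x) \<partial>lborel)
       = ennreal \<bar>e s\<bar> * ennreal ((s - a s) powr (-\<beta>) / \<beta>)"
      using nn_integral_powr_tail_reflect[of \<beta> "a s" s] \<beta> d by (subst nn_integral_cmult) auto
    also have "\<dots> = ennreal (1 / \<beta>) * left_part s"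
      unfolding left_part_def using \<beta> by (simp add: ennreal_mult[symmetric])
    finally show ?thesis .
  qed
  finally have two: "besov2_inner \<beta> e s \<le> osc2 s + ennreal (1 / \<beta>) * left_part s + (\<integral>\<^sup>+x. right_part s x \<partial>lborel)"
    by (simp add: add_right_mono)
  have "ennreal (1 + 1 / \<beta>) * left_part s = left_part s + ennreal (1 / \<beta>) * left_part s"
    using \<beta> by (subst ennreal_plus) (auto simp: distrib_right)
  then show ?thesis using add_mono[OF one two] by (simp add: ac_simps)
qed

text \<open>
By Tonelli the integral over \<open>s \<ge> b x\<close> is taken first and produces the weight of \<open>e_right_le\<close>.
\<close>

private lemma right_part_le:
  "(\<integral>\<^sup>+s. \<integral>\<^sup>+x. right_part s x \<partial>lborel \<partial>lborel)
     \<le> ennreal ((4 + 8 / (1 - \<beta>)) / \<beta>) * \<Theta>"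
proof -
  have "(\<integral>\<^sup>+s. \<integral>\<^sup>+x. right_part s x \<partial>lborel \<partial>lborel) = (\<integral>\<^sup>+x. \<integral>\<^sup>+s. right_part s x \<partial>lborel \<partial>lborel)"
    by (rule lborel_pair.Fubini') simp
  also have "\<dots> = (\<integral>\<^sup>+x. ennreal (1 / \<beta>) * (ennreal (\<bar>e x\<bar> * (b x - x) powr (-\<beta>)) * indicator {0..<T} x) \<partial>lborel)"
  proof (rule nn_integral_cong)
    fix x
    show "(\<integral>\<^sup>+s. right_part s x \<partial>lborel) = ennreal (1 / \<beta>) * (ennreal (\<bar>e x\<bar> * (b x - x) powr (-\<beta>)) * indicator {0..<T} x)"
    proof (cases "x \<in> {0..<T}")
      case True
      then have "(\<integral>\<^sup>+s. right_part s x \<partial>lborel) = ennreal \<bar>e x\<bar> * ennreal ((b x - x) powr (-\<beta>) / \<beta>)"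
        using nn_integral_powr_tail_shift[of \<beta> x "b x"] cell[of x] \<beta>
        unfolding right_part_def by (simp add: nn_integral_cmult)
      also have "\<dots> = ennreal (1 / \<beta>) * ennreal (\<bar>e x\<bar> * (b x - x) powr (-\<beta>))"
        using \<beta> by (simp add: ennreal_mult[symmetric])
      finally show ?thesis using True by simp
    qed (simp add: right_part_def)
  qed
  also have "\<dots> = ennreal (1 / \<beta>) * (\<integral>\<^sup>+x\<in>{0..<T}. ennreal (\<bar>e x\<bar> * (b x - x) powr (-\<beta>)) \<partial>lborel)"
    by (rule nn_integral_cmult) measurable
  also have "\<dots> \<le> ennreal (1 / \<beta>) * (ennreal (4 + 8 / (1 - \<beta>)) * \<Theta>)"
    by (intro mult_left_mono e_right_le) simp
  also have "\<dots> = ennreal ((4 + 8 / (1 - \<beta>)) / \<beta>) * \<Theta>"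
    using \<beta> by (simp add: ennreal_mult[symmetric] mult.assoc[symmetric] del: ennreal_plus)
  finally show ?thesis .
qed

text \<open>
Integrate \<open>integrand_le\<close> over \<open>s\<close>: the weights at the left ends of the cells are absorbed pointwise by
\<open>e_left_le\<close>, those at the right ends after integration by \<open>right_part_le\<close>.
\<close>

lemma besov2_norm_step_error:
  "besov2_norm T \<beta> (\<lambda>x. h x - step_sum k u (\<lambda>j. h (u j)) x)
     \<le> ennreal (4 * (1 + 1 / \<beta>) + 1 + (4 + 8 / (1 - \<beta>)) / \<beta>) * (\<integral>\<^sup>+x\<in>{0..T}. osc_mass \<beta> \<Delta> (2 * m) x \<partial>lborel)"
proof -
  have AE_cell: "AE s in lborel. \<forall>j\<in>{..k}. s \<noteq> u j"
    by (rule AE_ball_countable[THEN iffD2]) (auto intro: AE_lborel_singleton)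
  have ae: "AE s in lborel. (ennreal (\<bar>e s\<bar> / s powr \<beta>) + besov2_inner \<beta> e s) * indicator {0..T} s
     \<le> ennreal (4 * (1 + 1 / \<beta>) + 1) * (osc2 s * indicator {0..T} s) + (\<integral>\<^sup>+x. right_part s x \<partial>lborel)"
    using AE_cell
  proof eventually_elim
    fix s assume s: "\<forall>j\<in>{..k}. s \<noteq> u j"
    show "(ennreal (\<bar>e s\<bar> / s powr \<beta>) + besov2_inner \<beta> e s) * indicator {0..T} s
     \<le> ennreal (4 * (1 + 1 / \<beta>) + 1) * (osc2 s * indicator {0..T} s) + (\<integral>\<^sup>+x. right_part s x \<partial>lborel)"
    proof (cases "s \<in> {0..T}")
      case True
      then have sT: "0 \<le> s" "s < T" using s part unfolding is_partition_def by (auto simp: less_le)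
      obtain j where j: "j < k" "s \<in> {u j..<u (Suc j)}" using interval_ex[OF sT] by blast
      have "s \<noteq> a s" using s j step_sum_eq[OF j, of u] by simp
      have "left_part s \<le> 4 * osc2 s"
        unfolding left_part_def by (rule e_left_le[OF sT \<open>s \<noteq> a s\<close>])
      then have "ennreal (1 + 1 / \<beta>) * left_part s \<le> ennreal (1 + 1 / \<beta>) * (4 * osc2 s)"
        by (intro mult_left_mono) auto
      also have "\<dots> = ennreal (4 * (1 + 1 / \<beta>)) * osc2 s"
        using \<beta> ennreal_mult[of 4 "1 + 1 / \<beta>"] by (simp add: mult_ac del: ennreal_plus)
      finally have "ennreal (1 + 1 / \<beta>) * left_part s + osc2 s
         \<le> ennreal (4 * (1 + 1 / \<beta>) + 1) * osc2 s"
        using \<beta> by (subst ennreal_plus) (auto simp: distrib_right add_right_mono)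
      then show ?thesis
        using order_trans[OF integrand_le[OF sT \<open>s \<noteq> a s\<close>] add_right_mono] True by simp
    qed simp
  qed
  have "besov2_norm T \<beta> e \<le> (\<integral>\<^sup>+s. ennreal (4 * (1 + 1 / \<beta>) + 1) * (osc2 s * indicator {0..T} s)
       + (\<integral>\<^sup>+x. right_part s x \<partial>lborel) \<partial>lborel)"
    by (subst besov2_norm_borel, measurable) (rule nn_integral_mono_AE[OF ae])
  also have "\<dots> = ennreal (4 * (1 + 1 / \<beta>) + 1) * \<Theta> + (\<integral>\<^sup>+s. \<integral>\<^sup>+x. right_part s x \<partial>lborel \<partial>lborel)"
    by (subst nn_integral_add, measurable) (subst nn_integral_cmult, auto)
  also have "\<dots> \<le> ennreal (4 * (1 + 1 / \<beta>) + 1) * \<Theta> + ennreal ((4 + 8 / (1 - \<beta>)) / \<beta>) * \<Theta>"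
    by (intro add_left_mono right_part_le)
  also have "\<dots> = ennreal (4 * (1 + 1 / \<beta>) + 1 + (4 + 8 / (1 - \<beta>)) / \<beta>) * \<Theta>"
    using \<beta> ennreal_plus[of "4 * (1 + 1 / \<beta>) + 1" "(4 + 8 / (1 - \<beta>)) / \<beta>"]
    by (simp add: distrib_right del: ennreal_plus)
  finally show ?thesis .
qed

end
end

section \<open>Pathwise convergence of Riemann sums\<close>

lemma partition_mesh:
  assumes "is_partition T k u" "0 < T"
  shows "0 < mesh k u" "mesh k u \<le> T" "\<And>j. j < k \<Longrightarrow> u (Suc j) - u j \<le> mesh k u"
    and "\<And>j. j \<le> k \<Longrightarrow> 0 \<le> u j \<and> u j \<le> T"
proof -
  have ends: "u 0 = 0" "u k = T" and sm: "strict_mono_on {..k} u"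
    using assms unfolding is_partition_def by auto
  have k: "0 < k" using ends assms(2) by (cases k) auto
  have le: "u i \<le> u j" if "i \<le> j" "j \<le> k" for i j
    using strict_mono_onD[OF sm, of i j] that by (cases "i = j") auto
  show range: "0 \<le> u j \<and> u j \<le> T" if "j \<le> k" for j
    using le[of 0 j] le[of j k] ends that by simp
  have mem: "\<bar>u (Suc j) - u j\<bar> \<in> (\<lambda>j. \<bar>u j - u (j - 1)\<bar>) ` {1..k}" if "j < k" for j
    using that by (intro image_eqI[of _ _ "Suc j"]) auto
  then have "\<bar>u (Suc j) - u j\<bar> \<le> mesh k u" if "j < k" for j
    unfolding mesh_def using that by (intro Max_ge) auto
  note abs_le = this
  show "u (Suc j) - u j \<le> mesh k u" if "j < k" for j
    using abs_le[OF that] by simp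
  have "0 < \<bar>u (Suc 0) - u 0\<bar>"
    using strict_mono_onD[OF sm, of 0 "Suc 0"] k by simp
  then show "0 < mesh k u" using abs_le[OF k] by linarith
  show "mesh k u \<le> T"
    unfolding mesh_def
  proof (rule Max.boundedI)
    fix x assume "x \<in> (\<lambda>j. \<bar>u j - u (j - 1)\<bar>) ` {1..k}"
    then obtain j where j: "j \<in> {1..k}" "x = \<bar>u j - u (j - 1)\<bar>" by blast
    then have "0 \<le> u j \<and> u j \<le> T" "0 \<le> u (j - 1) \<and> u (j - 1) \<le> T" by (auto intro!: range)
    then show "x \<le> T" unfolding j(2) by linarith
  qed (use k in auto)
qed

text \<open>
The Riemann sum is the generalized integral of the step function, which converges to \<open>h\<close> in the Besov
norm of the integrands; no rate of decay of the mesh enters.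
\<close>

theorem (in dominated_oscillation) riemann_sums_converge:
  assumes g: "g \<in> besov1 T (1 - \<beta>)"
    and part: "\<And>n. is_partition T (k n) (u n)"
    and mesh: "(\<lambda>n. mesh (k n) (u n)) \<longlonglongrightarrow> 0"
  shows "(\<lambda>n. complex_of_real (\<Sum>j<k n. h (u n j) * (g (u n (Suc j)) - g (u n j))))
     \<longlonglongrightarrow> gls_integral \<beta> T h g"
proof -
  obtain A where A: "0 \<le> A"
    "\<And>s t. 0 \<le> s \<Longrightarrow> s < t \<Longrightarrow> t \<le> T \<Longrightarrow> \<bar>g t - g s\<bar> \<le> A * (t - s) powr (1 - \<beta>)"
    "\<And>s t. 0 \<le> s \<Longrightarrow> s < t \<Longrightarrow> t \<le> T \<Longrightarrow>
      (\<integral>\<^sup>+u\<in>{s..t}. ennreal (\<bar>g u - g s\<bar> / (u - s) powr (1 + (1 - \<beta>))) \<partial>lebesgue) \<le> ennreal A"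
    by (rule besov1_bounds[OF g]) (rule that)
  note pr = T \<beta> A
  define hn where "hn = (\<lambda>n. step_sum (k n) (u n) (\<lambda>j. h (u n j)))"
  have [measurable]: "hn n \<in> borel_measurable borel" for n unfolding hn_def by measurable
  define C where "C = 4 * (1 + 1 / \<beta>) + 1 + (4 + 8 / (1 - \<beta>)) / \<beta>"
  define N where "N = (\<lambda>n. besov2_norm T \<beta> (\<lambda>x. h x - hn n x))"
  have N_le: "N n \<le> ennreal C * (\<integral>\<^sup>+x\<in>{0..T}. osc_mass \<beta> \<Delta> (2 * mesh (k n) (u n)) x \<partial>lborel)" for n
    unfolding N_def C_def hn_def
    by (rule besov2_norm_step_error[OF part]) (intro partition_mesh(1,2,3)[OF part T] | assumption)+
  have "(\<lambda>n. \<integral>\<^sup>+x\<in>{0..T}. osc_mass \<beta> \<Delta> (2 * mesh (k n) (u n)) x \<partial>lborel) \<longlonglongrightarrow> 0"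
    by (rule osc_mass_vanishes[OF mesh]) (rule partition_mesh(2)[OF part T])
  from ennreal_tendsto_cmult[OF _ this, of "ennreal C"]
  have lim: "(\<lambda>n. ennreal C * (\<integral>\<^sup>+x\<in>{0..T}. osc_mass \<beta> \<Delta> (2 * mesh (k n) (u n)) x \<partial>lborel)) \<longlonglongrightarrow> 0"
    by simp
  have N_lim: "N \<longlonglongrightarrow> 0"
    by (rule tendsto_sandwich[OF _ _ tendsto_const lim]) (auto intro: always_eventually N_le)
  define K where "K = (1 - \<beta>) * (A + A / (1 - \<beta>)) / Gamma (1 - \<beta>)"
  have bound: "norm (pairing T \<beta> g (hn n) - pairing T \<beta> g h) \<le> K * enn2real (N n)" if "N n < \<infinity>" for n
    using pairing_diff_bound[OF pr meas_h _ besov2_norm_finite, of "hn n"] that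
    unfolding N_def K_def by (simp add: abs_minus_commute)
  have "(\<lambda>n. pairing T \<beta> g (hn n) - pairing T \<beta> g h) \<longlonglongrightarrow> 0"
  proof (rule Lim_null_comparison)
    have "\<forall>\<^sub>F n in sequentially. N n < \<infinity>" using N_lim by (rule order_tendstoD) simp
    then show "\<forall>\<^sub>F n in sequentially. norm (pairing T \<beta> g (hn n) - pairing T \<beta> g h) \<le> K * enn2real (N n)"
      by (rule eventually_mono) (rule bound)
    have "(\<lambda>n. enn2real (N n)) \<longlonglongrightarrow> 0"
      by (rule tendsto_enn2real) (use N_lim in simp_all)
    then show "(\<lambda>n. K * enn2real (N n)) \<longlonglongrightarrow> 0"
      by (rule tendsto_mult_right_zero)
  qed
  then have "(\<lambda>n. pairing T \<beta> g (hn n)) \<longlonglongrightarrow> pairing T \<beta> g h"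
    by (rule LIM_zero_cancel)
  then have "(\<lambda>n. complex_of_real (- (1 / Gamma \<beta> * pairing T \<beta> g (hn n))))
      \<longlonglongrightarrow> complex_of_real (- (1 / Gamma \<beta> * pairing T \<beta> g h))"
    by (intro tendsto_intros)
  moreover have sums: "- (1 / Gamma \<beta> * pairing T \<beta> g (hn n)) = (\<Sum>j<k n. h (u n j) * (g (u n (Suc j)) - g (u n j)))" for n
    unfolding hn_def step_sum_def[abs_def]
    by (rule pairing_step_function[OF pr]) (assumption | rule partition_mesh(4)[OF part T])+
  moreover have "gls_integral \<beta> T h g = complex_of_real (- (1 / Gamma \<beta> * pairing T \<beta> g h))"
    by (rule gls_integral_eq[OF pr meas_h]) assumption+
  ultimately show ?thesis by (simp only: sums)
qed

section \<open>Gaussian estimates for the class\<close>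

lemma integral_std_normal_cos:
  "(LINT y|lborel. std_normal_density y * cos (\<sigma> * y)) = exp (- \<sigma>\<^sup>2 / 2)"
proof -
  interpret N: real_distribution std_normal_distribution by (rule real_dist_normal_dist)
  have int: "integrable std_normal_distribution (\<lambda>x. iexp (\<sigma> * x))"
    by (intro N.integrable_const_bound[where B=1]) auto
  have "(LINT y|lborel. std_normal_density y * cos (\<sigma> * y)) = (LINT y|std_normal_distribution. cos (\<sigma> * y))"
    by (subst integral_real_density) auto
  also have "\<dots> = (LINT y|std_normal_distribution. Re (iexp (\<sigma> * y)))"
    by (simp add: Re_exp)
  also have "\<dots> = Re (char std_normal_distribution \<sigma>)"
    unfolding char_def using int by (rule integral_Re)
  also have "\<dots> = exp (- \<sigma>\<^sup>2 / 2)" by (simp only: char_std_normal_distribution Re_complex_of_real)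
  finally show ?thesis .
qed

lemma integral_normal_cos:
  assumes "0 < \<sigma>"
  shows "(LINT x|lborel. normal_density 0 \<sigma> x * cos x) = exp (- \<sigma>\<^sup>2 / 2)"
proof -
  have "(LINT x|lborel. normal_density 0 \<sigma> x * cos x)
      = \<bar>\<sigma>\<bar> *\<^sub>R (LINT y|lborel. normal_density 0 \<sigma> (0 + \<sigma> * y) * cos (0 + \<sigma> * y))"
    by (rule lborel_integral_real_affine) (use assms in simp)
  also have "\<dots> = (LINT y|lborel. \<sigma> * (normal_density 0 \<sigma> (\<sigma> * y) * cos (\<sigma> * y)))"
    using assms by (simp only: integral_mult_right_zero real_scaleR_def abs_of_pos add_0)
  also have "\<dots> = (LINT y|lborel. std_normal_density y * cos (\<sigma> * y))"
    using assms by (intro Bochner_Integration.integral_cong)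
      (auto simp: normal_density_def real_sqrt_mult power_mult_distrib field_simps)
  finally show ?thesis by (simp only: integral_std_normal_cos)
qed

lemma (in prob_space) centred_gaussian_cases:
  assumes g: "gaussian_rv M Z" and mean: "expectation Z = 0"
  obtains "expectation (\<lambda>\<omega>. (Z \<omega>)\<^sup>2) = 0" "AE \<omega> in M. Z \<omega> = 0"
  | \<sigma> where "0 < \<sigma>" "expectation (\<lambda>\<omega>. (Z \<omega>)\<^sup>2) = \<sigma>\<^sup>2" "distributed M lborel Z (normal_density 0 \<sigma>)"
proof -
  have [measurable]: "Z \<in> borel_measurable M" using g unfolding gaussian_rv_def by blast
  obtain \<mu> where "(AE \<omega> in M. Z \<omega> = \<mu>) \<or> (\<exists>\<sigma>>0. distributed M lborel Z (\<lambda>x. ennreal (normal_density \<mu> \<sigma> x)))"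
    using g unfolding gaussian_rv_def by blast
  then show thesis
  proof
    assume ae: "AE \<omega> in M. Z \<omega> = \<mu>"
    then have "expectation Z = expectation (\<lambda>_. \<mu>)" by (intro integral_cong_AE) auto
    then have "\<mu> = 0" using mean by (simp add: prob_space)
    moreover from ae have "expectation (\<lambda>\<omega>. (Z \<omega>)\<^sup>2) = expectation (\<lambda>_. \<mu>\<^sup>2)" by (intro integral_cong_AE) auto
    ultimately show thesis using that(1) ae by (simp add: prob_space)
  next
    assume "\<exists>\<sigma>>0. distributed M lborel Z (\<lambda>x. ennreal (normal_density \<mu> \<sigma> x))"
    then obtain \<sigma> where \<sigma>: "0 < \<sigma>" "distributed M lborel Z (normal_density \<mu> \<sigma>)" by blast
    have "\<mu> = 0" using normal_distributed_expectation[OF \<sigma>] mean by simp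
    then show thesis using that(2)[of \<sigma>] \<sigma> normal_distributed_variance[OF \<sigma>] mean by simp
  qed
qed

text \<open>
The characteristic function expresses the variance through a bounded continuous function of the
variable, which makes it accessible to dominated convergence.
\<close>

lemma (in prob_space) centred_gaussian_cos:
  assumes g: "gaussian_rv M Z" and mean: "expectation Z = 0"
  shows "expectation (\<lambda>\<omega>. cos (Z \<omega>)) = exp (- expectation (\<lambda>\<omega>. (Z \<omega>)\<^sup>2) / 2)"
proof -
  have [measurable]: "Z \<in> borel_measurable M" using g unfolding gaussian_rv_def by blast
  show ?thesis using g mean
  proof (cases rule: centred_gaussian_cases)
    case 1
    then have "expectation (\<lambda>\<omega>. cos (Z \<omega>)) = expectation (\<lambda>_. 1)"
      by (intro integral_cong_AE) (auto elim!: eventually_mono)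
    then show ?thesis using 1 by (simp add: prob_space)
  next
    case (2 \<sigma>)
    then show ?thesis
      using distributed_integral[OF 2(3), of cos] integral_normal_cos[OF 2(1)] by simp
  qed
qed

lemma (in prob_space) centred_gaussian_even_moment:
  assumes g: "gaussian_rv M Z" and mean: "expectation Z = 0" and k: "0 < k"
  shows "(\<integral>\<^sup>+\<omega>. ennreal (Z \<omega> ^ (2 * k)) \<partial>M)
     = ennreal (fact (2 * k) / (2 ^ k * fact k) * expectation (\<lambda>\<omega>. (Z \<omega>)\<^sup>2) ^ k)"
proof -
  have [measurable]: "Z \<in> borel_measurable M" using g unfolding gaussian_rv_def by blast
  show ?thesis using g mean
  proof (cases rule: centred_gaussian_cases)
    case 1
    then have "(\<integral>\<^sup>+\<omega>. ennreal (Z \<omega> ^ (2 * k)) \<partial>M) = (\<integral>\<^sup>+\<omega>. 0 \<partial>M)"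
      using k by (intro nn_integral_cong_AE) (auto elim!: eventually_mono)
    then show ?thesis using 1 k by simp
  next
    case (2 \<sigma>)
    have "(\<integral>\<^sup>+\<omega>. ennreal (Z \<omega> ^ (2 * k)) \<partial>M) = (\<integral>\<^sup>+x. ennreal (normal_density 0 \<sigma> x) * ennreal (x ^ (2 * k)) \<partial>lborel)"
      by (rule distributed_nn_integral[OF 2(3), symmetric]) simp
    also have "\<dots> = (\<integral>\<^sup>+x. ennreal (normal_density 0 \<sigma> x * (x - 0) ^ (2 * k)) \<partial>lborel)"
      by (intro nn_integral_cong) (simp add: ennreal_mult')
    also have "\<dots> = ennreal (fact (2 * k) / ((2 / \<sigma>\<^sup>2)^k * fact k))"
      using integral_normal_moment_even[OF 2(1), of 0 k]
      by (subst nn_integral_eq_integral[OF integrable.intros[OF normal_moment_even[OF 2(1)]]])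
         (auto simp: zero_le_even_power)
    also have "fact (2 * k) / ((2 / \<sigma>\<^sup>2)^k * fact k) = fact (2 * k) / (2 ^ k * fact k) * (\<sigma>\<^sup>2) ^ k"
      using 2(1) by (simp add: power_divide)
    finally show ?thesis using 2 by simp
  qed
qed

text \<open>
A positive lower bound for the variance excludes a point mass and bounds the density by \<open>1 / v\<close>.
\<close>

lemma (in prob_space) centred_gaussian_density_bound:
  assumes g: "gaussian_rv M Z" and mean: "expectation Z = 0"
    and v: "0 < v" "v\<^sup>2 \<le> expectation (\<lambda>\<omega>. (Z \<omega>)\<^sup>2)"
    and [measurable]: "F \<in> borel_measurable borel"
  shows "(\<integral>\<^sup>+\<omega>. F (Z \<omega>) \<partial>M) \<le> ennreal (1 / v) * (\<integral>\<^sup>+x. F x \<partial>lborel)"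
  using g mean
proof (cases rule: centred_gaussian_cases)
  case 1
  then show ?thesis using v by (auto simp: not_le[symmetric])
next
  case (2 \<sigma>)
  have v\<sigma>: "v \<le> \<sigma>" using v 2 by (simp add: power2_le_iff_abs_le)
  have "(\<integral>\<^sup>+\<omega>. F (Z \<omega>) \<partial>M) = (\<integral>\<^sup>+x. ennreal (normal_density 0 \<sigma> x) * F x \<partial>lborel)"
    by (rule distributed_nn_integral[OF 2(3), symmetric]) simp
  also have "\<dots> \<le> (\<integral>\<^sup>+x. ennreal (1 / v) * F x \<partial>lborel)"
  proof (intro nn_integral_mono mult_right_mono ennreal_leI)
    fix x
    have "normal_density 0 \<sigma> x \<le> 1 / sqrt (2 * pi * \<sigma>\<^sup>2) * 1"
      unfolding normal_density_def by (intro mult_left_mono) auto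
    also have "\<dots> \<le> 1 / \<sigma>"
    proof -
      have "1 * \<sigma>\<^sup>2 \<le> 2 * pi * \<sigma>\<^sup>2" using pi_gt3 by (intro mult_right_mono) auto
      then have "\<sigma> \<le> sqrt (2 * pi * \<sigma>\<^sup>2)" by (intro real_le_rsqrt) simp
      then show ?thesis using 2(1) by (simp add: frac_le)
    qed
    also have "\<dots> \<le> 1 / v" using v\<sigma> v by (simp add: frac_le)
    finally show "normal_density 0 \<sigma> x \<le> 1 / v" .
  qed simp
  also have "\<dots> = ennreal (1 / v) * (\<integral>\<^sup>+x. F x \<partial>lborel)"
    by (rule nn_integral_cmult) simp
  finally show ?thesis .
qed

locale gaussian_class_X = prob_space M for M :: "'a measure" +
  fixes X :: "real \<Rightarrow> 'a \<Rightarrow> real" and T \<alpha> :: real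
  assumes T: "0 < T" and \<alpha>: "0 < \<alpha>" and X: "class_X M T \<alpha> X"
begin

lemma process: "gaussian_process M {0..T} X" "\<And>t. t \<in> {0..T} \<Longrightarrow> expectation (X t) = 0"
  "AE \<omega> in M. continuous_on {0..T} (\<lambda>t. X t \<omega>)"
  using X unfolding class_X_def centered_continuous_gaussian_process_def by auto

lemma gaussian_value: assumes t: "t \<in> {0..T}" shows "gaussian_rv M (X t)"
proof -
  have "gaussian_rv M (\<lambda>\<omega>. \<Sum>r\<in>{t}. 1 * X r \<omega>)"
    using process(1) t unfolding gaussian_process_def by (elim allE[of _ "{t}"] allE[of _ "\<lambda>_. 1"]) auto
  then show ?thesis by simp
qed

lemma measurable_X: "t \<in> {0..T} \<Longrightarrow> X t \<in> borel_measurable M"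
  using gaussian_value unfolding gaussian_rv_def by blast

lemma square_integrable: assumes t: "t \<in> {0..T}" shows "integrable M (\<lambda>\<omega>. (X t \<omega>)\<^sup>2)"
proof (rule integrableI_bounded)
  have "(\<integral>\<^sup>+\<omega>. ennreal (norm ((X t \<omega>)\<^sup>2)) \<partial>M) = (\<integral>\<^sup>+\<omega>. ennreal (X t \<omega> ^ (2 * 1)) \<partial>M)" by simp
  also have "\<dots> < \<infinity>"
    by (subst centred_gaussian_even_moment[OF gaussian_value[OF t] process(2)[OF t]]) auto
  finally show "(\<integral>\<^sup>+\<omega>. ennreal (norm ((X t \<omega>)\<^sup>2)) \<partial>M) < \<infinity>" .
qed (use measurable_X[OF t] in simp)

lemma value_integrable: assumes t: "t \<in> {0..T}" shows "integrable M (X t)"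
  using measurable_X[OF t] square_integrable[OF t]
  by (rule square_integrable_imp_integrable)

lemma gaussian_increment:
  assumes s: "s \<in> {0..T}" and t: "t \<in> {0..T}"
  shows "gaussian_rv M (\<lambda>\<omega>. X t \<omega> - X s \<omega>)" "expectation (\<lambda>\<omega>. X t \<omega> - X s \<omega>) = 0"
proof -
  show "expectation (\<lambda>\<omega>. X t \<omega> - X s \<omega>) = 0"
    using process(2) value_integrable s t by simp
  show "gaussian_rv M (\<lambda>\<omega>. X t \<omega> - X s \<omega>)"
  proof (cases "s = t")
    case True
    then show ?thesis unfolding gaussian_rv_def by auto
  next
    case False
    have "gaussian_rv M (\<lambda>\<omega>. \<Sum>r\<in>{s, t}. (if r = t then 1 else -1) * X r \<omega>)"
      using process(1) s t unfolding gaussian_process_def by auto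
    then show ?thesis using False by simp
  qed
qed

text \<open>
Path continuity gives continuity of \<open>t \<mapsto> E (cos X\<^sub>t) = exp (- V t / 2)\<close>.
\<close>

lemma var_fun_continuous: "continuous_on {0..T} (var_fun M X)"
  unfolding continuous_on_sequentially
proof (intro allI ballI impI)
  fix x t assume t: "t \<in> {0..T}" and x: "(\<forall>n. x n \<in> {0..T}) \<and> x \<longlonglongrightarrow> t"
  have cosV: "expectation (\<lambda>\<omega>. cos (X s \<omega>)) = exp (- var_fun M X s / 2)" if "s \<in> {0..T}" for s
    using centred_gaussian_cos[OF gaussian_value process(2)] that unfolding var_fun_def by simp
  have "(\<lambda>n. expectation (\<lambda>\<omega>. cos (X (x n) \<omega>))) \<longlonglongrightarrow> expectation (\<lambda>\<omega>. cos (X t \<omega>))"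
  proof (rule integral_dominated_convergence[where w="\<lambda>_. 1"])
    show "AE \<omega> in M. (\<lambda>n. cos (X (x n) \<omega>)) \<longlonglongrightarrow> cos (X t \<omega>)"
      using process(3)
    proof eventually_elim
      fix \<omega> assume "continuous_on {0..T} (\<lambda>t. X t \<omega>)"
      then have "(\<lambda>n. X (x n) \<omega>) \<longlonglongrightarrow> X t \<omega>"
        using x t unfolding continuous_on_sequentially comp_def by blast
      then show "(\<lambda>n. cos (X (x n) \<omega>)) \<longlonglongrightarrow> cos (X t \<omega>)" by (intro tendsto_intros)
    qed
  qed (use measurable_X x t in auto)
  then have "(\<lambda>n. exp (- var_fun M X (x n) / 2)) \<longlonglongrightarrow> exp (- var_fun M X t / 2)"
    using cosV x t by simp
  from tendsto_ln[OF this] have "(\<lambda>n. - var_fun M X (x n) / 2) \<longlonglongrightarrow> - var_fun M X t / 2" by simp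
  from tendsto_mult_left[OF this, of "-2"] show "(var_fun M X \<circ> x) \<longlonglongrightarrow> var_fun M X t"
    by (simp add: comp_def)
qed

text \<open>
This makes the supremum in \<open>max_incr_var\<close> one over a bounded set, so that it dominates its members.
\<close>

lemma incr_var_bounded: "\<exists>B. \<forall>s\<in>{0..T}. \<forall>t\<in>{0..T}. incr_var M X t s \<le> B"
proof -
  have "compact (var_fun M X ` {0..T})"
    using var_fun_continuous by (intro compact_continuous_image) auto
  then obtain B where B: "\<And>t. t \<in> {0..T} \<Longrightarrow> var_fun M X t \<le> B"
    using compact_imp_bounded bounded_imp_bdd_above unfolding bdd_above_def by (metis image_eqI)
  have "incr_var M X t s \<le> 2 * B + 2 * B" if s: "s \<in> {0..T}" and t: "t \<in> {0..T}" for s t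
  proof -
    have "incr_var M X t s \<le> expectation (\<lambda>\<omega>. 2 * (X t \<omega>)\<^sup>2 + 2 * (X s \<omega>)\<^sup>2)"
      unfolding incr_var_def
    proof (rule integral_mono')
      show "integrable M (\<lambda>\<omega>. 2 * (X t \<omega>)\<^sup>2 + 2 * (X s \<omega>)\<^sup>2)" using square_integrable s t by simp
      fix \<omega>
      show "(X t \<omega> - X s \<omega>)\<^sup>2 \<le> 2 * (X t \<omega>)\<^sup>2 + 2 * (X s \<omega>)\<^sup>2"
        using zero_le_power2[of "X t \<omega> + X s \<omega>"] by (simp add: power2_eq_square algebra_simps)
    qed simp
    also have "\<dots> = 2 * var_fun M X t + 2 * var_fun M X s"
      using square_integrable s t unfolding var_fun_def by simp
    also have "\<dots> \<le> 2 * B + 2 * B" using B s t by (intro add_mono mult_left_mono) auto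
    finally show ?thesis .
  qed
  then show ?thesis by blast
qed

lemma incr_var_sym: "incr_var M X t s = incr_var M X s t"
  unfolding incr_var_def by (simp add: power2_commute)

text \<open>
For small time differences this is the asymptotics of \<open>max_incr_var\<close> at \<open>0\<close>, for the others boundedness.
\<close>

lemma incr_var_holder:
  "\<exists>C\<ge>0. \<forall>s\<in>{0..T}. \<forall>t\<in>{0..T}. incr_var M X t s \<le> C * \<bar>t - s\<bar> powr (2 * \<alpha>)"
proof -
  obtain B where B: "\<And>s t. s \<in> {0..T} \<Longrightarrow> t \<in> {0..T} \<Longrightarrow> incr_var M X t s \<le> B"
    using incr_var_bounded by blast
  obtain C where C: "C > 0" and o: "(\<lambda>t. max_incr_var M T X t - C * t powr (2 * \<alpha>)) \<in> o[at_right 0](\<lambda>t. t powr (2 * \<alpha>))"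
    using X unfolding class_X_def by blast
  have "\<forall>\<^sub>F t in at_right 0. norm (max_incr_var M T X t - C * t powr (2 * \<alpha>)) \<le> 1 * norm (t powr (2 * \<alpha>))"
    using o by (rule landau_o.smallD) simp
  then obtain d where d: "0 < d" and small: "\<And>t. 0 < t \<Longrightarrow> t < d \<Longrightarrow>
       \<bar>max_incr_var M T X t - C * t powr (2 * \<alpha>)\<bar> \<le> t powr (2 * \<alpha>)"
    unfolding eventually_at_right_field by auto
  define K where "K = C + 1 + \<bar>B\<bar> / d powr (2 * \<alpha>)"
  have K: "C + 1 \<le> K" "\<bar>B\<bar> / d powr (2 * \<alpha>) \<le> K" "0 \<le> K" using C by (auto simp: K_def)
  have bound: "incr_var M X t s \<le> K * (t - s) powr (2 * \<alpha>)" if s: "s \<in> {0..T}" and t: "t \<in> {0..T}" and st: "s < t" for s t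
  proof (cases "t - s < d")
    case True
    have "incr_var M X (t - s + s) s \<le> max_incr_var M T X (t - s)"
      unfolding max_incr_var_def
    proof (rule cSUP_upper)
      show "bdd_above ((\<lambda>r. incr_var M X (t - s + r) r) ` {0..T - (t - s)})"
        by (rule bdd_aboveI2[where M=B]) (use B st in auto)
    qed (use s t in auto)
    also have "\<dots> \<le> (C + 1) * (t - s) powr (2 * \<alpha>)"
      using small[of "t - s"] True st by (simp add: algebra_simps)
    also have "\<dots> \<le> K * (t - s) powr (2 * \<alpha>)" using K by (intro mult_right_mono) auto
    finally show ?thesis by simp
  next
    case False
    have "incr_var M X t s \<le> \<bar>B\<bar> / d powr (2 * \<alpha>) * d powr (2 * \<alpha>)" using B[OF s t] d by simp
    also have "\<dots> \<le> K * (t - s) powr (2 * \<alpha>)"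
      using K False d \<alpha> by (intro mult_mono powr_mono2) auto
    finally show ?thesis .
  qed
  have "incr_var M X t s \<le> K * \<bar>t - s\<bar> powr (2 * \<alpha>)" if s: "s \<in> {0..T}" and t: "t \<in> {0..T}" for s t
    using bound[OF s t] bound[OF t s] incr_var_sym[of s t]
    by (cases s t rule: linorder_cases) (auto simp: incr_var_def)
  then show ?thesis using K(3) by blast
qed

text \<open>
Near \<open>0\<close> this is the lower bound of the class; away from \<open>0\<close> the variance is continuous and positive,
being the covariance at equal times.
\<close>

lemma var_fun_lower: "\<exists>c>0. \<forall>s\<in>{0..T}. (c * s)\<^sup>2 \<le> var_fun M X s"
proof -
  obtain c d where c: "c > 0" and d: "d > 0" and near: "\<And>s. s \<in> {0..T} \<Longrightarrow> s \<le> d \<Longrightarrow> c * s\<^sup>2 \<le> var_fun M X s"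
    using X unfolding class_X_def by blast
  have pos: "0 < var_fun M X s" if "s \<in> {0<..T}" for s
    using X that unfolding class_X_def cov_fun_def var_fun_def power2_eq_square by blast
  define e where "e = min d T"
  have e: "0 < e" "e \<le> T" "e \<le> d" using d T by (auto simp: e_def)
  have "continuous_on {e..T} (var_fun M X)"
    using var_fun_continuous by (rule continuous_on_subset) (use e in auto)
  then obtain r where r: "r \<in> {e..T}" "\<And>s. s \<in> {e..T} \<Longrightarrow> var_fun M X r \<le> var_fun M X s"
    using continuous_attains_inf[of "{e..T}" "var_fun M X"] e by auto
  define q where "q = min c (var_fun M X r / T\<^sup>2)"
  have q: "0 < q" using c pos[of r] r e T by (auto simp: q_def)
  have "(sqrt q * s)\<^sup>2 \<le> var_fun M X s" if s: "s \<in> {0..T}" for s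
  proof -
    have "q * s\<^sup>2 \<le> var_fun M X s"
    proof (cases "s \<le> e")
      case True
      have "q * s\<^sup>2 \<le> c * s\<^sup>2" by (intro mult_right_mono) (auto simp: q_def)
      also have "\<dots> \<le> var_fun M X s" using near s True e by auto
      finally show ?thesis .
    next
      case False
      have "q * s\<^sup>2 \<le> (var_fun M X r / T\<^sup>2) * T\<^sup>2"
        using s pos[of r] r e T by (intro mult_mono power_mono) (auto simp: q_def)
      also have "\<dots> = var_fun M X r" using T by simp
      also have "\<dots> \<le> var_fun M X s" using r(2)[of s] s False by auto
      finally show ?thesis .
    qed
    then show ?thesis using q by (simp add: power_mult_distrib)
  qed
  then show ?thesis using q by (intro exI[of _ "sqrt q"]) auto
qed

end

section \<open>Hoelder continuity of the paths\<close>

lemma dyadic_scale: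
  fixes d :: real
  assumes "0 < d" "d \<le> 1"
  obtains n :: nat where "1 / 2 ^ Suc n < d" "d \<le> 1 / 2 ^ n"
proof -
  obtain n0 :: nat where "1 / d < 2 ^ n0" using real_arch_pow[of 2 "1 / d"] by auto
  then have ex: "\<exists>n::nat. 1 / 2 ^ n < d" using assms by (intro exI[of _ n0]) (simp add: field_simps)
  define N where "N = (LEAST n::nat. 1 / 2 ^ n < d)"
  have N: "1 / 2 ^ N < d" using LeastI_ex[OF ex] unfolding N_def .
  have "N \<noteq> 0"
  proof
    assume "N = 0"
    with N have "1 < d" by simp
    with assms show False by simp
  qed
  then obtain n where n: "N = Suc n" by (cases N) auto
  have "\<not> 1 / 2 ^ n < d" using not_less_Least[of n "\<lambda>n. 1 / 2 ^ n < d"] n unfolding N_def by simp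
  then show thesis using N n by (intro that[of n]) auto
qed

text \<open>
Kolmogorov's chaining argument. A point is approximated by rounding it down to \<open>d n t \<in> 2\<^bsup>-n\<^esup> \<int>\<close>; passing
from level \<open>n\<close> to \<open>n + 1\<close> costs at most one dyadic increment, so by continuity the error at level \<open>n\<close>
is a geometric tail. Two points at distance about \<open>2\<^bsup>-n\<^esup>\<close> round to equal or adjacent dyadic points.
\<close>

lemma dyadic_chaining:
  fixes y :: "real \<Rightarrow> real"
  assumes a: "0 < a" and A: "0 \<le> A" and cont: "continuous_on {0..1} y"
    and incr: "\<And>n k. k < 2 ^ n \<Longrightarrow> \<bar>y (real (Suc k) / 2 ^ n) - y (real k / 2 ^ n)\<bar> \<le> A * (2 powr (-a)) ^ n"
  shows "\<exists>K\<ge>0. \<forall>s\<in>{0..1}. \<forall>t\<in>{0..1}. \<bar>y t - y s\<bar> \<le> K * \<bar>t - s\<bar> powr a"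
proof -
  define \<rho> where "\<rho> = 2 powr (-a)"
  have \<rho>: "0 < \<rho>" "\<rho> < 1" using a by (auto simp: \<rho>_def powr_less_one)
  define d where "d = (\<lambda>(n::nat) (t::real). real (nat \<lfloor>2 ^ n * t\<rfloor>) / 2 ^ n)"
  have fl: "real (nat \<lfloor>2 ^ n * t\<rfloor>) \<le> 2 ^ n * t" "2 ^ n * t < real (nat \<lfloor>2 ^ n * t\<rfloor>) + 1" if "0 \<le> t" for n :: nat and t :: real
    using that by (auto simp: of_nat_nat)
  have d_le: "d n t \<le> t" "0 \<le> d n t" "t < d n t + 1 / 2 ^ n" if "0 \<le> t" for n and t :: real
    using fl[OF that, of n] unfolding d_def by (auto simp: field_simps)
  have step: "\<bar>y (d (Suc n) t) - y (d n t)\<bar> \<le> A * \<rho> ^ Suc n" if t: "t \<in> {0..1}" for n t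
  proof -
    define p where "p = nat \<lfloor>2 ^ n * t\<rfloor>"
    define q where "q = nat \<lfloor>2 ^ Suc n * t\<rfloor>"
    have "real p \<le> 2 ^ n * t" "2 ^ n * t < real p + 1" "real q \<le> 2 ^ Suc n * t" "2 ^ Suc n * t < real q + 1"
      using fl[of t n] fl[of t "Suc n"] t unfolding p_def q_def by auto
    then have "2 * real p < real q + 1" "real q < 2 * real p + 2" by auto
    then have "q = 2 * p \<or> q = Suc (2 * p)" by linarith
    then show ?thesis
    proof
      assume "q = 2 * p"
      then have "d (Suc n) t = d n t" unfolding d_def p_def[symmetric] q_def[symmetric] by simp
      then show ?thesis using A \<rho> by simp
    next
      assume q: "q = Suc (2 * p)"
      have "2 ^ Suc n * t \<le> 2 ^ Suc n * 1" using t by (intro mult_left_mono) auto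
      moreover have "0 \<le> t" using t by simp
      ultimately have "real q \<le> 2 ^ Suc n * 1" unfolding q_def by (rule order_trans[OF fl(1), rotated])
      then have "real q \<le> real (2 ^ Suc n)" by simp
      then have "q \<le> 2 ^ Suc n" by (rule of_nat_le_iff[THEN iffD1])
      then have "2 * p < 2 ^ Suc n" using q by simp
      from incr[OF this] show ?thesis
        unfolding d_def p_def[symmetric] q_def[symmetric] \<rho>_def q by simp
    qed
  qed
  have chain: "\<bar>y (d (n + p) t) - y (d n t)\<bar> \<le> A / (1 - \<rho>) * (\<rho> ^ n - \<rho> ^ (n + p))" if t: "t \<in> {0..1}" for n p t
  proof (induction p)
    case (Suc p)
    have "\<bar>y (d (n + Suc p) t) - y (d n t)\<bar> \<le> A * \<rho> ^ Suc (n + p) + A / (1 - \<rho>) * (\<rho> ^ n - \<rho> ^ (n + p))"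
      using step[OF t, of "n + p"] Suc.IH by simp
    also have "A * \<rho> ^ Suc (n + p) \<le> A * \<rho> ^ (n + p)"
      using A \<rho> by (intro mult_left_mono power_decreasing) auto
    also have "A * \<rho> ^ (n + p) = A / (1 - \<rho>) * (\<rho> ^ (n + p) - \<rho> ^ (n + Suc p))"
      using \<rho> by (simp add: field_simps)
    finally show ?case by (simp add: algebra_simps)
  qed simp
  have approx: "\<bar>y t - y (d n t)\<bar> \<le> A / (1 - \<rho>) * \<rho> ^ n" if t: "t \<in> {0..1}" for n t
  proof -
    have "(\<lambda>p. d (p + n) t) \<longlonglongrightarrow> t"
    proof (rule LIMSEQ_ignore_initial_segment, rule tendsto_sandwich)
      show "(\<lambda>p. t - (1/2) ^ p) \<longlonglongrightarrow> t"
        using tendsto_diff[OF tendsto_const LIMSEQ_power_zero[of "1/2::real"], of t] by simp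
      show "\<forall>\<^sub>F p in sequentially. t - (1/2) ^ p \<le> d p t"
        using d_le(3)[of t] t by (intro always_eventually allI) (auto simp: power_divide algebra_simps intro: less_imp_le)
      show "\<forall>\<^sub>F p in sequentially. d p t \<le> t" using d_le(1)[of t] t by (intro always_eventually) auto
    qed (rule tendsto_const)
    moreover have "d p t \<in> {0..1}" for p
      using d_le(1,2)[of t p] t by auto
    ultimately have "(\<lambda>p. y (d (p + n) t)) \<longlonglongrightarrow> y t"
      by (intro continuous_on_tendsto_compose[OF cont]) (use t in auto)
    then have "(\<lambda>p. \<bar>y (d (p + n) t) - y (d n t)\<bar>) \<longlonglongrightarrow> \<bar>y t - y (d n t)\<bar>"
      by (intro tendsto_intros)
    moreover have "\<bar>y (d (p + n) t) - y (d n t)\<bar> \<le> A / (1 - \<rho>) * \<rho> ^ n" for p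
    proof -
      have "\<bar>y (d (n + p) t) - y (d n t)\<bar> \<le> A / (1 - \<rho>) * (\<rho> ^ n - \<rho> ^ (n + p))" by (rule chain[OF t])
      also have "\<dots> \<le> A / (1 - \<rho>) * \<rho> ^ n" using A \<rho> by (intro mult_left_mono) auto
      finally show ?thesis by (simp add: add.commute)
    qed
    ultimately show ?thesis by (intro LIMSEQ_le_const2) auto
  qed
  define K where "K = (2 * (A / (1 - \<rho>)) + A) * 2 powr a"
  have K: "0 \<le> K" using A \<rho> by (simp add: K_def)
  have main: "\<bar>y t - y s\<bar> \<le> K * (t - s) powr a" if s: "s \<in> {0..1}" and t: "t \<in> {0..1}" and st: "s < t" for s t
  proof -
    obtain n where n: "1 / 2 ^ Suc n < t - s" "t - s \<le> 1 / 2 ^ n"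
      using dyadic_scale[of "t - s"] s t st by auto
    define p where "p = nat \<lfloor>2 ^ n * s\<rfloor>"
    define q where "q = nat \<lfloor>2 ^ n * t\<rfloor>"
    have pq: "real p \<le> 2 ^ n * s" "2 ^ n * s < real p + 1" "real q \<le> 2 ^ n * t" "2 ^ n * t < real q + 1"
      using fl[of t n] fl[of s n] s t unfolding p_def q_def by auto
    have "2 ^ n * t - 2 ^ n * s \<le> 1" using n(2) by (simp add: field_simps)
    moreover have "2 ^ n * s \<le> 2 ^ n * t" using st by simp
    ultimately have "q = p \<or> q = Suc p" using pq by linarith
    then have "\<bar>y (d n t) - y (d n s)\<bar> \<le> A * \<rho> ^ n"
    proof
      assume "q = p"
      then show ?thesis unfolding d_def p_def[symmetric] q_def[symmetric] using A \<rho> by simp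
    next
      assume q: "q = Suc p"
      have "2 ^ n * t \<le> 2 ^ n * 1" using t by (intro mult_left_mono) auto
      from order_trans[OF pq(3) this] have "real q \<le> real (2 ^ n)" by simp
      then have "p < 2 ^ n" unfolding of_nat_le_iff q by simp
      from incr[OF this] show ?thesis
        unfolding d_def p_def[symmetric] q_def[symmetric] q \<rho>_def .
    qed
    then have "\<bar>y t - y s\<bar> \<le> 2 * (A / (1 - \<rho>) * \<rho> ^ n) + A * \<rho> ^ n"
      using approx[OF t, of n] approx[OF s, of n] by linarith
    also have "\<dots> = (2 * (A / (1 - \<rho>)) + A) * \<rho> ^ n" by (simp add: distrib_right)
    also have "\<rho> ^ n \<le> 2 powr a * (t - s) powr a"
    proof -
      have "\<rho> ^ n = (1 / 2 ^ n) powr a"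
        unfolding \<rho>_def by (simp add: powr_power powr_realpow[symmetric] powr_divide powr_powr powr_minus_divide mult.commute)
      also have "\<dots> \<le> (2 * (t - s)) powr a"
        using n(1) a by (intro powr_mono2) auto
      also have "\<dots> = 2 powr a * (t - s) powr a" by (rule powr_mult)
      finally show ?thesis .
    qed
    finally show ?thesis using A \<rho> unfolding K_def by (simp add: mult.assoc mult_left_mono)
  qed
  have "\<bar>y t - y s\<bar> \<le> K * \<bar>t - s\<bar> powr a" if s: "s \<in> {0..1}" and t: "t \<in> {0..1}" for s t
    using main[OF s t] main[OF t s] by (cases s t rule: linorder_cases) (auto simp: abs_minus_commute)
  then show ?thesis using K by blast
qed

context gaussian_class_X
begin

text \<open>
For \<open>2 m (\<alpha> - a) > 1\<close> the expected sum of the \<open>2 m\<close>-th powers of all normalised dyadic increments is a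
convergent geometric series: at level \<open>n\<close> there are \<open>2\<^sup>n\<close> increments, each contributing a multiple of
\<open>2\<^bsup>-2mn(\<alpha>-a)\<^esup>\<close>. So the sum is almost surely finite, and it bounds each of its terms.
\<close>

lemma AE_dyadic_increments:
  assumes a: "0 < a" "a < \<alpha>"
  shows "AE \<omega> in M. \<exists>A\<ge>0. \<forall>n k. k < 2 ^ n \<longrightarrow>
     \<bar>X (real (Suc k) / 2 ^ n * T) \<omega> - X (real k / 2 ^ n * T) \<omega>\<bar> \<le> A * (2 powr (-a)) ^ n"
proof -
  define \<rho> where "\<rho> = 2 powr (-a)"
  have \<rho>: "0 < \<rho>" by (simp add: \<rho>_def)
  obtain m0 :: nat where m0: "1 / (2 * (\<alpha> - a)) < real m0" using reals_Archimedean2 by blast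
  define m where "m = Suc m0"
  have m: "0 < m" "1 < 2 * real m * (\<alpha> - a)"
    using m0 a by (auto simp: m_def field_simps)
  obtain C where C: "0 \<le> C" "\<And>s t. s \<in> {0..T} \<Longrightarrow> t \<in> {0..T} \<Longrightarrow> incr_var M X t s \<le> C * \<bar>t - s\<bar> powr (2 * \<alpha>)"
    using incr_var_holder by blast
  define Z where "Z = (\<lambda>n k \<omega>. X (real (Suc k) / 2 ^ n * T) \<omega> - X (real k / 2 ^ n * T) \<omega>)"
  have pts: "real k / 2 ^ n * T \<in> {0..T}" "real (Suc k) / 2 ^ n * T \<in> {0..T}" if "k < 2 ^ n" for n k
  proof -
    have "real (Suc k) \<le> real (2 ^ n)" "real k \<le> real (2 ^ n)" using that by (auto simp only: of_nat_le_iff)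
    then have "real k / 2 ^ n \<le> 1" "real (Suc k) / 2 ^ n \<le> 1" by (auto simp: divide_le_eq)
    then show "real k / 2 ^ n * T \<in> {0..T}" "real (Suc k) / 2 ^ n * T \<in> {0..T}"
      using T mult_right_mono[of "real k / 2 ^ n" 1 T] mult_right_mono[of "real (Suc k) / 2 ^ n" 1 T] by auto
  qed
  have Zm: "Z n k \<in> borel_measurable M" if "k < 2 ^ n" for n k
    unfolding Z_def using measurable_X pts[OF that] by (intro borel_measurable_diff)
  define c where "c = (fact (2 * m) / (2 ^ m * fact m) :: real)"
  have c: "0 \<le> c" by (simp add: c_def)
  define r where "r = 2 powr (1 - 2 * real m * (\<alpha> - a))"
  have r: "0 < r" "r < 1" using m powr_less_mono[of "1 - 2 * real m * (\<alpha> - a)" 0 2] by (auto simp: r_def)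
  define D where "D = c * (C * T powr (2 * \<alpha>)) ^ m"
  have D: "0 \<le> D" using c C by (simp add: D_def)
  have moment: "(\<integral>\<^sup>+\<omega>. ennreal ((Z n k \<omega> / \<rho> ^ n) ^ (2 * m)) \<partial>M) \<le> ennreal (D * r ^ n / 2 ^ n)" if k: "k < 2 ^ n" for n k
  proof -
    let ?s = "real k / 2 ^ n * T" and ?t = "real (Suc k) / 2 ^ n * T"
    have diff: "\<bar>?t - ?s\<bar> = T / 2 ^ n" using T by (simp add: field_simps)
    have "expectation (\<lambda>\<omega>. (Z n k \<omega>)\<^sup>2) = incr_var M X ?t ?s"
      unfolding Z_def incr_var_def ..
    also have "\<dots> \<le> C * \<bar>?t - ?s\<bar> powr (2 * \<alpha>)" by (rule C(2)) (use pts[OF k] in auto)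
    also have "\<dots> = C * T powr (2 * \<alpha>) * (2 powr (- 2 * \<alpha>)) ^ n"
      unfolding diff using T
      by (simp add: powr_divide powr_realpow[symmetric] powr_powr powr_power powr_minus_divide mult_ac)
    finally have W: "expectation (\<lambda>\<omega>. (Z n k \<omega>)\<^sup>2) \<le> C * T powr (2 * \<alpha>) * (2 powr (- 2 * \<alpha>)) ^ n" .
    have gZ: "gaussian_rv M (Z n k)" "expectation (Z n k) = 0"
      unfolding Z_def using gaussian_increment[of ?s ?t] pts[OF k] by auto
    have "(\<integral>\<^sup>+\<omega>. ennreal ((Z n k \<omega> / \<rho> ^ n) ^ (2 * m)) \<partial>M)
       = (\<integral>\<^sup>+\<omega>. ennreal (1 / (\<rho> ^ n) ^ (2 * m)) * ennreal (Z n k \<omega> ^ (2 * m)) \<partial>M)"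
      using \<rho> by (intro nn_integral_cong) (simp add: power_divide ennreal_mult'[symmetric])
    also have "\<dots> = ennreal (1 / (\<rho> ^ n) ^ (2 * m)) * ennreal (c * expectation (\<lambda>\<omega>. (Z n k \<omega>)\<^sup>2) ^ m)"
      using centred_gaussian_even_moment[OF gZ m(1)] Zm[OF k] unfolding c_def
      by (subst nn_integral_cmult) auto
    also have "\<dots> \<le> ennreal (1 / (\<rho> ^ n) ^ (2 * m)) * ennreal (c * (C * T powr (2 * \<alpha>) * (2 powr (- 2 * \<alpha>)) ^ n) ^ m)"
      using W c by (intro mult_left_mono ennreal_leI power_mono) auto
    also have "\<dots> = ennreal (1 / (\<rho> ^ n) ^ (2 * m) * (c * (C * T powr (2 * \<alpha>) * (2 powr (- 2 * \<alpha>)) ^ n) ^ m))"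
      using c C \<rho> by (subst ennreal_mult) auto
    also have "1 / (\<rho> ^ n) ^ (2 * m) * (c * (C * T powr (2 * \<alpha>) * (2 powr (- 2 * \<alpha>)) ^ n) ^ m)
       = D * (((2 powr (- 2 * \<alpha>)) ^ n) ^ m * (1 / (\<rho> ^ n) ^ (2 * m)))"
      unfolding D_def by (simp add: power_mult_distrib mult_ac)
    also have "((2 powr (- 2 * \<alpha>)) ^ n) ^ m * (1 / (\<rho> ^ n) ^ (2 * m)) = r ^ n / 2 ^ n"
    proof -
      have "1 / (\<rho> ^ n) ^ (2 * m) = (2 powr a) ^ (n * (2 * m))"
        unfolding \<rho>_def by (simp add: powr_minus power_inverse[symmetric] power_mult divide_inverse)
      moreover have "(2 powr a) ^ (n * (2 * m)) = 2 powr (real (n * (2 * m)) * a)"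
        by (subst powr_power) auto
      moreover have "((2 powr (- 2 * \<alpha>)) ^ n) ^ m = 2 powr (real (n * m) * (- 2 * \<alpha>))"
        unfolding power_mult[symmetric] by (subst powr_power) auto
      moreover have "r ^ n = 2 powr (real n * (1 - 2 * real m * (\<alpha> - a)))"
        unfolding r_def by (subst powr_power) auto
      moreover have "(2::real) ^ n = 2 powr (real n)" by (simp add: powr_realpow)
      moreover have "2 powr (real (n * m) * (- 2 * \<alpha>)) * 2 powr (real (n * (2 * m)) * a)
          = 2 powr (real n * (1 - 2 * real m * (\<alpha> - a))) / 2 powr (real n)"
        unfolding powr_add[symmetric] powr_diff[symmetric] by (simp add: algebra_simps)
      ultimately show ?thesis by simp
    qed
    finally show ?thesis by simp
  qed
  define S where "S = (\<lambda>\<omega>. \<Sum>n. \<Sum>k<2 ^ n. ennreal ((Z n k \<omega> / \<rho> ^ n) ^ (2 * m)))"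
  have meas: "(\<lambda>\<omega>. \<Sum>k<2 ^ n. ennreal ((Z n k \<omega> / \<rho> ^ n) ^ (2 * m))) \<in> borel_measurable M" for n
    using Zm by (intro borel_measurable_sum measurable_compose[OF _ measurable_ennreal] borel_measurable_power borel_measurable_divide) auto
  have "(\<integral>\<^sup>+\<omega>. S \<omega> \<partial>M) = (\<Sum>n. \<integral>\<^sup>+\<omega>. (\<Sum>k<2 ^ n. ennreal ((Z n k \<omega> / \<rho> ^ n) ^ (2 * m))) \<partial>M)"
    unfolding S_def by (rule nn_integral_suminf[OF meas])
  also have "\<dots> \<le> (\<Sum>n. ennreal (D * r ^ n))"
  proof (rule suminf_le)
    fix n
    have "(\<integral>\<^sup>+\<omega>. (\<Sum>k<2 ^ n. ennreal ((Z n k \<omega> / \<rho> ^ n) ^ (2 * m))) \<partial>M)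
       = (\<Sum>k<2 ^ n. \<integral>\<^sup>+\<omega>. ennreal ((Z n k \<omega> / \<rho> ^ n) ^ (2 * m)) \<partial>M)"
      using Zm by (intro nn_integral_sum measurable_compose[OF _ measurable_ennreal] borel_measurable_power borel_measurable_divide) auto
    also have "\<dots> \<le> (\<Sum>k<(2::nat) ^ n. ennreal (D * r ^ n / 2 ^ n))" by (intro sum_mono moment) auto
    also have "\<dots> = ennreal (D * r ^ n)"
      using D r by (simp add: ennreal_of_nat_eq_real_of_nat ennreal_mult'[symmetric])
    finally show "(\<integral>\<^sup>+\<omega>. (\<Sum>k<2 ^ n. ennreal ((Z n k \<omega> / \<rho> ^ n) ^ (2 * m))) \<partial>M) \<le> ennreal (D * r ^ n)" .
  qed auto
  also have "\<dots> = ennreal (\<Sum>n. D * r ^ n)"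
    using D r by (intro suminf_ennreal2) (auto intro: summable_mult summable_geometric)
  also have "\<dots> < \<infinity>" by simp
  finally have "(\<integral>\<^sup>+\<omega>. S \<omega> \<partial>M) \<noteq> \<infinity>" by simp
  moreover have "S \<in> borel_measurable M" unfolding S_def using meas by measurable
  ultimately have "AE \<omega> in M. S \<omega> \<noteq> \<infinity>" by (intro nn_integral_PInf_AE)
  then show ?thesis
  proof eventually_elim
    fix \<omega> assume fin: "S \<omega> \<noteq> \<infinity>"
    define A where "A = 1 + enn2real (S \<omega>)"
    have "\<bar>Z n k \<omega>\<bar> \<le> A * \<rho> ^ n" if k: "k < 2 ^ n" for n k
    proof -
      let ?z = "\<bar>Z n k \<omega> / \<rho> ^ n\<bar>"
      have "ennreal (?z ^ (2 * m)) \<le> (\<Sum>k<2 ^ n. ennreal ((Z n k \<omega> / \<rho> ^ n) ^ (2 * m)))"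
        using k by (subst power_even_abs, simp) (rule member_le_sum[of k "{..<2 ^ n}" "\<lambda>k. ennreal ((Z n k \<omega> / \<rho> ^ n) ^ (2 * m))"], auto)
      also have "\<dots> = (\<Sum>i\<in>{n}. \<Sum>k<2 ^ i. ennreal ((Z i k \<omega> / \<rho> ^ i) ^ (2 * m)))" by simp
      also have "\<dots> \<le> S \<omega>" unfolding S_def by (rule sum_le_suminf) auto
      also have "S \<omega> = ennreal (enn2real (S \<omega>))" using fin by (simp add: less_top)
      finally have le: "?z ^ (2 * m) \<le> enn2real (S \<omega>)" by simp
      have "?z \<le> A"
      proof (cases "?z \<le> 1")
        case True
        then show ?thesis unfolding A_def by (rule order_trans) simp
      next
        case False
        then have "?z ^ 1 \<le> ?z ^ (2 * m)" using m by (intro power_increasing) auto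
        then show ?thesis using le unfolding A_def by simp
      qed
      then show ?thesis using \<rho> by (simp add: abs_divide field_simps)
    qed
    then show "\<exists>A\<ge>0. \<forall>n k. k < 2 ^ n \<longrightarrow>
       \<bar>X (real (Suc k) / 2 ^ n * T) \<omega> - X (real k / 2 ^ n * T) \<omega>\<bar> \<le> A * (2 powr (-a)) ^ n"
      unfolding Z_def \<rho>_def[symmetric] by (intro exI[of _ A]) (auto simp: A_def)
  qed
qed

lemma AE_holder_paths:
  assumes a: "0 < a" "a < \<alpha>"
  shows "AE \<omega> in M. \<exists>K\<ge>0. \<forall>s\<in>{0..T}. \<forall>t\<in>{0..T}. \<bar>X t \<omega> - X s \<omega>\<bar> \<le> K * \<bar>t - s\<bar> powr a"
  using AE_dyadic_increments[OF a] process(3)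
proof eventually_elim
  fix \<omega>
  assume "\<exists>A\<ge>0. \<forall>n k. k < 2 ^ n \<longrightarrow>
     \<bar>X (real (Suc k) / 2 ^ n * T) \<omega> - X (real k / 2 ^ n * T) \<omega>\<bar> \<le> A * (2 powr (-a)) ^ n"
  then obtain A where A: "0 \<le> A" "\<And>n k. k < 2 ^ n \<Longrightarrow>
     \<bar>X (real (Suc k) / 2 ^ n * T) \<omega> - X (real k / 2 ^ n * T) \<omega>\<bar> \<le> A * (2 powr (-a)) ^ n" by blast
  assume cont: "continuous_on {0..T} (\<lambda>t. X t \<omega>)"
  have sub: "x * T \<in> {0..T}" if "x \<in> {0..1}" for x
    using that T mult_right_mono[of x 1 T] by auto
  have "continuous_on {0..1} (\<lambda>x. X (x * T) \<omega>)"
    by (rule continuous_on_compose2[OF cont]) (auto intro!: continuous_intros simp del: atLeastAtMost_iff intro: sub)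
  from dyadic_chaining[OF a(1) A(1) this A(2)] obtain K where K: "0 \<le> K"
    "\<And>s t. s \<in> {0..1} \<Longrightarrow> t \<in> {0..1} \<Longrightarrow> \<bar>X (t * T) \<omega> - X (s * T) \<omega>\<bar> \<le> K * \<bar>t - s\<bar> powr a" by blast
  have "\<bar>X t \<omega> - X s \<omega>\<bar> \<le> K / T powr a * \<bar>t - s\<bar> powr a" if "s \<in> {0..T}" "t \<in> {0..T}" for s t
  proof -
    have "\<bar>X (t / T * T) \<omega> - X (s / T * T) \<omega>\<bar> \<le> K * \<bar>t / T - s / T\<bar> powr a"
      using that T by (intro K(2)) auto
    also have "\<bar>t / T - s / T\<bar> = \<bar>t - s\<bar> / T" using T by (simp add: diff_divide_distrib[symmetric])
    also have "K * (\<bar>t - s\<bar> / T) powr a = K / T powr a * \<bar>t - s\<bar> powr a" using T by (simp add: powr_divide)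
    finally show ?thesis using T by simp
  qed
  then show "\<exists>K\<ge>0. \<forall>s\<in>{0..T}. \<forall>t\<in>{0..T}. \<bar>X t \<omega> - X s \<omega>\<bar> \<le> K * \<bar>t - s\<bar> powr a"
    using K(1) by (intro exI[of _ "K / T powr a"]) auto
qed

end

section \<open>Almost sure domination of the oscillation\<close>

text \<open>
Freezing a monotone function outside \<open>[-N, N]\<close> makes it bounded without changing it along paths that
stay in this interval.
\<close>

definition clamp_fun :: "(real \<Rightarrow> real) \<Rightarrow> real \<Rightarrow> real \<Rightarrow> real" where
  "clamp_fun m N x = m (max (-N) (min N x))"

lemma clamp_fun_props:
  assumes m: "mono m" and N: "0 \<le> N"
  shows "mono (clamp_fun m N)" "clamp_fun m N \<in> borel_measurable borel"
    "\<bar>clamp_fun m N x\<bar> \<le> \<bar>m N\<bar> + \<bar>m (-N)\<bar>"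
    "\<bar>x\<bar> \<le> N \<Longrightarrow> clamp_fun m N x = m x"
proof -
  show mono: "mono (clamp_fun m N)"
    unfolding clamp_fun_def by (intro monoI monoD[OF m]) (auto simp: max_def min_def)
  then show "clamp_fun m N \<in> borel_measurable borel" by (rule borel_measurable_mono)
  have "m (-N) \<le> clamp_fun m N x" "clamp_fun m N x \<le> m N"
    unfolding clamp_fun_def by (intro monoD[OF m]; use N in auto)+
  then show "\<bar>clamp_fun m N x\<bar> \<le> \<bar>m N\<bar> + \<bar>m (-N)\<bar>" by linarith
  show "\<bar>x\<bar> \<le> N \<Longrightarrow> clamp_fun m N x = m x" unfolding clamp_fun_def by (auto simp: max_def min_def)
qed

text \<open>
After translation the two integrals over \<open>[-R, R]\<close> differ only near the ends of the interval, on two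
intervals of length \<open>2 \<delta>\<close>.
\<close>

lemma clamp_fun_shift_integral:
  fixes m :: "real \<Rightarrow> real"
  assumes m: "mono m" and N: "0 \<le> N" and \<delta>: "0 \<le> \<delta>"
  defines "B \<equiv> \<bar>m N\<bar> + \<bar>m (-N)\<bar>"
  shows "(\<integral>\<^sup>+x. ennreal (clamp_fun m N (x + \<delta>) - clamp_fun m N (x - \<delta>)) \<partial>lborel) \<le> ennreal (4 * B * \<delta>)"
proof -
  let ?f = "clamp_fun m N"
  note props = clamp_fun_props[OF m N]
  have [measurable]: "?f \<in> borel_measurable borel" by (rule props(2))
  have bd: "\<bar>?f x\<bar> \<le> B" for x unfolding B_def by (rule props(3))
  have B: "0 \<le> B" by (simp add: B_def)
  define R where "R = N + \<delta>"
  have zero: "?f (x + \<delta>) - ?f (x - \<delta>) = 0" if "x \<notin> {-R..R}" for x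
    using that N \<delta> unfolding R_def clamp_fun_def by (auto simp: max_def min_def)
  have ind: "integrable lborel (\<lambda>x. B * indicator {p..q} x)" for p q :: real
    by (simp add: emeasure_lborel_Icc_eq)
  have int: "integrable lborel (\<lambda>x. indicator {p..q} x * ?f (x + c))" for p q c
  proof (rule Bochner_Integration.integrable_bound)
    show "integrable lborel (\<lambda>x. B * indicator {p..q} x)" by (rule ind)
    show "AE x in lborel. norm (indicator {p..q} x * ?f (x + c)) \<le> norm (B * indicator {p..q} x)"
      using bd B by (auto simp: indicator_def)
  qed simp
  have shift: "(LINT x|lborel. indicator {-R..R} x * ?f (x + c)) = (LINT x|lborel. indicator {-R+c..R+c} x * ?f x)" for c
    by (subst lborel_integral_real_affine[where c=1 and t="-c"])
       (auto simp: indicator_def intro!: Bochner_Integration.integral_cong)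
  have "(\<integral>\<^sup>+x. ennreal (?f (x + \<delta>) - ?f (x - \<delta>)) \<partial>lborel)
     = (\<integral>\<^sup>+x. ennreal (indicator {-R..R} x * ?f (x + \<delta>) - indicator {-R..R} x * ?f (x + (-\<delta>))) \<partial>lborel)"
    using zero by (intro nn_integral_cong) (auto simp: indicator_def)
  also have "\<dots> = ennreal (LINT x|lborel. indicator {-R..R} x * ?f (x + \<delta>) - indicator {-R..R} x * ?f (x + (-\<delta>)))"
  proof (rule nn_integral_eq_integral[OF Bochner_Integration.integrable_diff[OF int int]], rule AE_I2)
    fix x
    have "?f (x + (-\<delta>)) \<le> ?f (x + \<delta>)" using \<delta> by (intro monoD[OF props(1)]) simp
    then show "0 \<le> indicator {-R..R} x * ?f (x + \<delta>) - indicator {-R..R} x * ?f (x + (-\<delta>))"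
      by (simp add: indicator_def)
  qed
  finally have eq: "(\<integral>\<^sup>+x. ennreal (?f (x + \<delta>) - ?f (x - \<delta>)) \<partial>lborel)
     = ennreal (LINT x|lborel. indicator {-R..R} x * ?f (x + \<delta>) - indicator {-R..R} x * ?f (x + (-\<delta>)))" .
  have "(LINT x|lborel. indicator {-R..R} x * ?f (x + \<delta>) - indicator {-R..R} x * ?f (x + (-\<delta>)))
     = (LINT x|lborel. indicator {-R..R} x * ?f (x + \<delta>)) - (LINT x|lborel. indicator {-R..R} x * ?f (x + (-\<delta>)))"
    by (rule Bochner_Integration.integral_diff[OF int int])
  also have "\<dots> = (LINT x|lborel. indicator {-R+\<delta>..R+\<delta>} x * ?f (x + 0) - indicator {-R-\<delta>..R-\<delta>} x * ?f (x + 0))"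
    unfolding shift by (subst Bochner_Integration.integral_diff[OF int int]) simp
  also have "\<dots> \<le> (LINT x|lborel. B * indicator {R-\<delta>..R+\<delta>} x + B * indicator {-R-\<delta>..-R+\<delta>} x)"
  proof (rule integral_mono)
    show "integrable lborel (\<lambda>x. indicator {-R+\<delta>..R+\<delta>} x * ?f (x + 0) - indicator {-R-\<delta>..R-\<delta>} x * ?f (x + 0))"
      by (intro Bochner_Integration.integrable_diff int)
    fix x
    show "indicator {-R+\<delta>..R+\<delta>} x * ?f (x + 0) - indicator {-R-\<delta>..R-\<delta>} x * ?f (x + 0)
      \<le> B * indicator {R-\<delta>..R+\<delta>} x + B * indicator {-R-\<delta>..-R+\<delta>} x"
    proof -
      have "-B \<le> ?f x" "?f x \<le> B" using bd[of x] by linarith+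
      then show ?thesis using B \<delta> by (simp add: indicator_def)
    qed
    show "integrable lborel (\<lambda>x. B * indicator {R-\<delta>..R+\<delta>} x + B * indicator {-R-\<delta>..-R+\<delta>} x)"
      by (rule Bochner_Integration.integrable_add[OF ind ind])
  qed
  also have "\<dots> = (LINT x|lborel. B * indicator {R-\<delta>..R+\<delta>} x) + (LINT x|lborel. B * indicator {-R-\<delta>..-R+\<delta>} x)"
    by (rule Bochner_Integration.integral_add[OF ind ind])
  also have "\<dots> = B * (2 * \<delta>) + B * (2 * \<delta>)"
    using \<delta> unfolding integral_mult_right_zero by (simp add: measure_lborel_Icc)
  also have "\<dots> = 4 * B * \<delta>" by simp
  finally show ?thesis unfolding eq by (rule ennreal_leI)
qed

lemma min_le_powr:
  fixes x p :: real
  assumes "0 \<le> x" "0 < p" "p \<le> 1"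
  shows "min 1 x \<le> x powr p"
proof (cases "x \<le> 1")
  case True
  then show ?thesis using assms powr_mono'[of p 1 x] by (cases "x = 0") auto
next
  case False
  then show ?thesis using assms by (simp add: ge_one_powr_ge_zero)
qed

context gaussian_class_X
begin

text \<open>
The set of discontinuous paths need not be measurable; it is enclosed in a measurable null set, on
which \<open>Xc\<close> is put to \<open>0\<close>. The version \<open>Xc\<close> has continuous paths on the whole line, which makes it
jointly measurable in time and chance.
\<close>

definition path_null :: "'a set" where
  "path_null = (SOME N0. N0 \<in> null_sets M \<and> {\<omega> \<in> space M. \<not> continuous_on {0..T} (\<lambda>t. X t \<omega>)} \<subseteq> N0)"

definition Xc :: "real \<Rightarrow> 'a \<Rightarrow> real" where
  "Xc t \<omega> = (if \<omega> \<in> path_null then 0 else X (max 0 (min T t)) \<omega>)"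

lemma path_null: "path_null \<in> null_sets M" "\<And>\<omega>. \<omega> \<in> space M \<Longrightarrow> \<omega> \<notin> path_null \<Longrightarrow> continuous_on {0..T} (\<lambda>t. X t \<omega>)"
proof -
  obtain N0 where "{\<omega> \<in> space M. \<not> continuous_on {0..T} (\<lambda>t. X t \<omega>)} \<subseteq> N0" "emeasure M N0 = 0" "N0 \<in> sets M"
    using process(3) by (rule AE_E)
  then have "\<exists>N0. N0 \<in> null_sets M \<and> {\<omega> \<in> space M. \<not> continuous_on {0..T} (\<lambda>t. X t \<omega>)} \<subseteq> N0"
    by (auto simp: null_sets_def)
  from someI_ex[OF this] show "path_null \<in> null_sets M" "\<And>\<omega>. \<omega> \<in> space M \<Longrightarrow> \<omega> \<notin> path_null \<Longrightarrow> continuous_on {0..T} (\<lambda>t. X t \<omega>)"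
    unfolding path_null_def[symmetric] by auto
qed

lemma Xc_AE: "AE \<omega> in M. \<forall>t\<in>{0..T}. Xc t \<omega> = X t \<omega>"
  using AE_not_in[OF path_null(1)] by eventually_elim (auto simp: Xc_def)

lemma Xc_continuous: "\<omega> \<in> space M \<Longrightarrow> continuous_on UNIV (\<lambda>t. Xc t \<omega>)"
proof (cases "\<omega> \<in> path_null")
  case False
  assume "\<omega> \<in> space M"
  then show ?thesis
    unfolding Xc_def using False T
    by (auto intro!: continuous_on_compose2[OF path_null(2)] continuous_intros)
qed (simp add: Xc_def)

lemma measurable_Xc: "Xc t \<in> borel_measurable M"
proof -
  have "X (max 0 (min T t)) \<in> borel_measurable M" using T by (intro measurable_X) auto
  moreover have "path_null \<in> sets M" using path_null(1) by auto
  ultimately show ?thesis unfolding Xc_def[abs_def] by measurable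
qed

text \<open>
The process is the limit of its values at dyadic times below \<open>t\<close>, which take countably many values.
\<close>

lemma measurable_Xc_pair [measurable]: "(\<lambda>(t, \<omega>). Xc t \<omega>) \<in> borel_measurable (borel \<Otimes>\<^sub>M M)"
proof (rule borel_measurable_LIMSEQ_real)
  fix n :: nat
  have [measurable]: "Xc t \<in> borel_measurable M" for t by (rule measurable_Xc)
  have "(\<lambda>z :: real \<times> 'a. (\<lambda>i z. Xc (of_int i / 2 ^ n) (snd z)) \<lfloor>2 ^ n * fst z\<rfloor> z) \<in> borel_measurable (borel \<Otimes>\<^sub>M M)"
    by (rule measurable_compose_countable[where f="\<lambda>i (z :: real \<times> 'a). Xc (of_int i / 2 ^ n) (snd z)" and g="\<lambda>z :: real \<times> 'a. \<lfloor>2 ^ n * fst z\<rfloor>"]) measurable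
  then show "(\<lambda>z :: real \<times> 'a. Xc (of_int \<lfloor>2 ^ n * fst z\<rfloor> / 2 ^ n) (snd z)) \<in> borel_measurable (borel \<Otimes>\<^sub>M M)"
    by simp
next
  fix z :: "real \<times> 'a" assume z: "z \<in> space (borel \<Otimes>\<^sub>M M)"
  obtain t \<omega> where tw: "z = (t, \<omega>)" by (cases z)
  have \<omega>: "\<omega> \<in> space M" using z tw by (auto simp: space_pair_measure)
  have "(\<lambda>n. of_int \<lfloor>2 ^ n * t\<rfloor> / 2 ^ n) \<longlonglongrightarrow> t"
  proof (rule tendsto_sandwich)
    show "(\<lambda>p. t - (1/2) ^ p) \<longlonglongrightarrow> t"
      using tendsto_diff[OF tendsto_const LIMSEQ_power_zero[of "1/2::real"], of t] by simp
    have "t - (1/2) ^ p \<le> of_int \<lfloor>2 ^ p * t\<rfloor> / 2 ^ p" for p :: nat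
    proof -
      have "t - (1/2) ^ p = (2 ^ p * t - 1) / 2 ^ p" by (simp add: power_divide diff_divide_distrib)
      also have "\<dots> \<le> of_int \<lfloor>2 ^ p * t\<rfloor> / 2 ^ p"
        using floor_correct[of "2 ^ p * t"] by (intro divide_right_mono) auto
      finally show ?thesis .
    qed
    then show "\<forall>\<^sub>F p in sequentially. t - (1/2) ^ p \<le> of_int \<lfloor>2 ^ p * t\<rfloor> / 2 ^ p" by simp
    have "of_int \<lfloor>2 ^ p * t\<rfloor> / 2 ^ p \<le> t" for p :: nat
      using floor_correct[of "2 ^ p * t"] by (simp add: field_simps)
    then show "\<forall>\<^sub>F p in sequentially. of_int \<lfloor>2 ^ p * t\<rfloor> / 2 ^ p \<le> t" by simp
  qed (rule tendsto_const)
  moreover have "isCont (\<lambda>t. Xc t \<omega>) t"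
    using Xc_continuous[OF \<omega>] by (simp add: continuous_on_eq_continuous_at)
  ultimately have "(\<lambda>n. Xc (of_int \<lfloor>2 ^ n * t\<rfloor> / 2 ^ n) \<omega>) \<longlonglongrightarrow> Xc t \<omega>"
    by (rule isCont_tendsto_compose[rotated])
  then show "(\<lambda>n. Xc (of_int \<lfloor>2 ^ n * fst z\<rfloor> / 2 ^ n) (snd z)) \<longlonglongrightarrow> (case z of (t, \<omega>) \<Rightarrow> Xc t \<omega>)"
    using tw by simp
qed

text \<open>
On a path with Hoelder constant \<open>K\<close> and exponent \<open>a\<close> this bounds the oscillation of \<open>g \<circ> X\<close> at scale \<open>r\<close>
around \<open>s\<close>, while its expectation only involves the law of the single variable \<open>X\<^sub>s\<close>.
\<close>

definition osc_bound :: "(real \<Rightarrow> real) \<Rightarrow> real \<Rightarrow> real \<Rightarrow> 'a \<Rightarrow> real \<Rightarrow> real \<Rightarrow> real" where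
  "osc_bound g K a \<omega> s r = g (Xc s \<omega> + K * r powr a) - g (Xc s \<omega> - K * r powr a)"

text \<open>
With \<open>\<delta> = K r\<^sup>a\<close>, the density bound and the shift integral give the order \<open>\<delta> / (c s)\<close>, and boundedness gives
the order \<open>1\<close>. Interpolating between the two by a power \<open>p\<close> relaxes the singularity at \<open>s = 0\<close> to
\<open>s\<^bsup>-p\<^esup>\<close>.
\<close>

lemma expected_osc_bound:
  assumes m: "mono m" and N: "0 \<le> N" and K: "0 \<le> K" and c: "0 < c" "\<And>s. s \<in> {0..T} \<Longrightarrow> (c * s)\<^sup>2 \<le> var_fun M X s"
    and p: "0 < p" "p \<le> 1" and s: "0 < s" "s \<le> T" and r: "0 < r"
  shows "(\<integral>\<^sup>+\<omega>. ennreal (osc_bound (clamp_fun m N) K a \<omega> s r) \<partial>M)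
     \<le> ennreal (4 * (\<bar>m N\<bar> + \<bar>m (-N)\<bar>) * (K / c) powr p * s powr (-p) * r powr (a * p))"
proof -
  define B where "B = \<bar>m N\<bar> + \<bar>m (-N)\<bar>"
  define \<delta> where "\<delta> = K * r powr a"
  have B: "0 \<le> B" and \<delta>: "0 \<le> \<delta>" using K by (auto simp: B_def \<delta>_def)
  note props = clamp_fun_props[OF m N]
  have [measurable]: "clamp_fun m N \<in> borel_measurable borel" by (rule props(2))
  let ?F = "\<lambda>x. ennreal (clamp_fun m N (x + \<delta>) - clamp_fun m N (x - \<delta>))"
  have sT: "s \<in> {0..T}" using s by auto
  have "(\<integral>\<^sup>+\<omega>. ennreal (osc_bound (clamp_fun m N) K a \<omega> s r) \<partial>M) = (\<integral>\<^sup>+\<omega>. ?F (X s \<omega>) \<partial>M)"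
  proof (rule nn_integral_cong_AE)
    show "AE \<omega> in M. ennreal (osc_bound (clamp_fun m N) K a \<omega> s r) = ?F (X s \<omega>)"
      using Xc_AE by eventually_elim (use sT in \<open>simp add: osc_bound_def \<delta>_def\<close>)
  qed
  also have "\<dots> \<le> ennreal (4 * B * min 1 (\<delta> / (c * s)))"
  proof (cases "\<delta> / (c * s) \<le> 1")
    case True
    have "(\<integral>\<^sup>+\<omega>. ?F (X s \<omega>) \<partial>M) \<le> ennreal (1 / (c * s)) * (\<integral>\<^sup>+x. ?F x \<partial>lborel)"
      using c(2)[OF sT] c(1) s unfolding var_fun_def
      by (intro centred_gaussian_density_bound[OF gaussian_value[OF sT] process(2)[OF sT]]) auto
    also have "\<dots> \<le> ennreal (1 / (c * s)) * ennreal (4 * B * \<delta>)"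
      unfolding B_def by (intro mult_left_mono clamp_fun_shift_integral[OF m N \<delta>]) simp
    also have "\<dots> = ennreal (4 * B * (\<delta> / (c * s)))"
      using B \<delta> c s by (subst ennreal_mult[symmetric]) auto
    finally have "(\<integral>\<^sup>+\<omega>. ?F (X s \<omega>) \<partial>M) \<le> ennreal (4 * B * (\<delta> / (c * s)))" .
    moreover have "min 1 (\<delta> / (c * s)) = \<delta> / (c * s)" using True by (rule min_absorb2)
    ultimately show ?thesis by (simp only:)
  next
    case False
    have "(\<integral>\<^sup>+\<omega>. ?F (X s \<omega>) \<partial>M) \<le> (\<integral>\<^sup>+\<omega>. ennreal (4 * B) \<partial>M)"
    proof (intro nn_integral_mono ennreal_leI)
      fix \<omega>
      show "clamp_fun m N (X s \<omega> + \<delta>) - clamp_fun m N (X s \<omega> - \<delta>) \<le> 4 * B"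
        using props(3)[of "X s \<omega> + \<delta>"] props(3)[of "X s \<omega> - \<delta>"] B unfolding B_def[symmetric] by linarith
    qed
    also have "\<dots> = ennreal (4 * B)" by (simp add: emeasure_space_1)
    finally show ?thesis using False by (simp add: min_def)
  qed
  also have "\<dots> \<le> ennreal (4 * B * (\<delta> / (c * s)) powr p)"
    using B \<delta> c s by (intro ennreal_leI mult_left_mono min_le_powr p) auto
  also have "4 * B * (\<delta> / (c * s)) powr p = 4 * B * (K / c) powr p * s powr (-p) * r powr (a * p)"
  proof -
    have "(\<delta> / (c * s)) powr p = ((K / c) * ((1 / s) * r powr a)) powr p" by (simp add: \<delta>_def)
    also have "\<dots> = (K / c) powr p * (s powr (-p) * r powr (a * p))"
      using K c s r by (simp add: powr_mult powr_powr powr_divide powr_minus_divide)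
    finally show ?thesis by simp
  qed
  finally show ?thesis unfolding B_def .
qed

text \<open>
By Tonelli and \<open>expected_osc_bound\<close> the expectation is at most a multiple of
\<open>\<integral> s\<^bsup>-p\<^esup> ds \<cdot> \<integral> r\<^bsup>ap-\<beta>-1\<^esup> dr\<close>. Both integrals are finite for \<open>\<beta> / a < p < 1\<close>.
\<close>

lemma AE_osc_mass_finite:
  assumes m: "mono m" and N: "0 \<le> N" and K: "0 \<le> K" and \<beta>: "0 < \<beta>" "\<beta> < a"
  shows "AE \<omega> in M. (\<integral>\<^sup>+s\<in>{0..T}. osc_mass \<beta> (osc_bound (clamp_fun m N) K a \<omega>) (2 * T) s \<partial>lborel) < \<infinity>"
proof -
  from var_fun_lower obtain c where "0 < c \<and> (\<forall>s\<in>{0..T}. (c * s)\<^sup>2 \<le> var_fun M X s)" ..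
  then have c: "0 < c" "\<And>s. s \<in> {0..T} \<Longrightarrow> (c * s)\<^sup>2 \<le> var_fun M X s" by simp_all
  have "\<beta> / a < 1" using \<beta> by simp
  then obtain p where p: "\<beta> / a < p" "p < 1" using dense by blast
  have "0 < \<beta> / a" using \<beta> by simp
  then have p0: "0 < p" using p(1) by linarith
  have p1: "\<beta> < a * p" using p(1) \<beta> by (simp add: divide_less_eq mult.commute)
  note props = clamp_fun_props[OF m N]
  have [measurable]: "clamp_fun m N \<in> borel_measurable borel" by (rule props(2))
  define D where "D = 4 * (\<bar>m N\<bar> + \<bar>m (-N)\<bar>) * (K / c) powr p"
  have D: "0 \<le> D" by (simp add: D_def)
  let ?\<Delta> = "osc_bound (clamp_fun m N) K a"
  have [measurable]: "(\<lambda>(\<omega>, s). Xc s \<omega>) \<in> borel_measurable (M \<Otimes>\<^sub>M lborel)"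
  proof -
    have "(\<lambda>z. (\<lambda>(t, \<omega>). Xc t \<omega>) ((\<lambda>(x, y). (y, x)) z)) \<in> borel_measurable (M \<Otimes>\<^sub>M borel)"
      by (rule measurable_compose[OF measurable_pair_swap' measurable_Xc_pair])
    moreover have "(\<lambda>z. (\<lambda>(t, \<omega>). Xc t \<omega>) ((\<lambda>(x, y). (y, x)) z)) = (\<lambda>(\<omega>, s). Xc s \<omega>)" by auto
    moreover have "sets (M \<Otimes>\<^sub>M borel) = sets (M \<Otimes>\<^sub>M (lborel :: real measure))"
      by (intro sets_pair_measure_cong) auto
    ultimately show ?thesis using measurable_cong_sets by (metis (no_types, lifting))
  qed
  have [measurable]: "(\<lambda>(\<omega>, s). osc_mass \<beta> (?\<Delta> \<omega>) (2 * T) s) \<in> borel_measurable (M \<Otimes>\<^sub>M lborel)"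
    unfolding osc_mass_def osc_bound_def by measurable
  interpret P: pair_sigma_finite M lborel ..
  have section_le: "(\<integral>\<^sup>+\<omega>. osc_mass \<beta> (?\<Delta> \<omega>) (2 * T) s \<partial>M)
      \<le> ennreal (D * s powr (-p)) * (\<integral>\<^sup>+r. ennreal (indicator {0<..<2*T} r * r powr (a * p - \<beta> - 1)) \<partial>lborel)"
    if s: "0 < s" "s \<le> T" for s
  proof -
    have [measurable]: "Xc s \<in> borel_measurable M" by (rule measurable_Xc)
    have "(\<integral>\<^sup>+\<omega>. osc_mass \<beta> (?\<Delta> \<omega>) (2 * T) s \<partial>M)
       = (\<integral>\<^sup>+r. (\<integral>\<^sup>+\<omega>. ennreal (?\<Delta> \<omega> s r * r powr (-1 - \<beta>)) * indicator {0<..<2 * T} r \<partial>M) \<partial>lborel)"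
      unfolding osc_mass_def osc_bound_def by (rule P.Fubini'[symmetric]) measurable
    also have "\<dots> \<le> (\<integral>\<^sup>+r. ennreal (D * s powr (-p)) * ennreal (indicator {0<..<2*T} r * r powr (a * p - \<beta> - 1)) \<partial>lborel)"
    proof (rule nn_integral_mono)
      fix r
      show "(\<integral>\<^sup>+\<omega>. ennreal (?\<Delta> \<omega> s r * r powr (-1 - \<beta>)) * indicator {0<..<2 * T} r \<partial>M)
        \<le> ennreal (D * s powr (-p)) * ennreal (indicator {0<..<2*T} r * r powr (a * p - \<beta> - 1))"
      proof (cases "r \<in> {0<..<2 * T}")
        case True
        then have r: "0 < r" by simp
        have "(\<integral>\<^sup>+\<omega>. ennreal (?\<Delta> \<omega> s r * r powr (-1 - \<beta>)) * indicator {0<..<2 * T} r \<partial>M)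
          = (\<integral>\<^sup>+\<omega>. ennreal (r powr (-1 - \<beta>)) * ennreal (?\<Delta> \<omega> s r) \<partial>M)"
          using True by (intro nn_integral_cong) (simp add: ennreal_mult' mult.commute)
        also have "\<dots> = ennreal (r powr (-1 - \<beta>)) * (\<integral>\<^sup>+\<omega>. ennreal (?\<Delta> \<omega> s r) \<partial>M)"
          unfolding osc_bound_def by (rule nn_integral_cmult) measurable
        also have "\<dots> \<le> ennreal (r powr (-1 - \<beta>)) * ennreal (D * s powr (-p) * r powr (a * p))"
          unfolding D_def by (intro mult_left_mono expected_osc_bound[OF m N K c] p0 s r) (use p in auto)
        also have "\<dots> = ennreal (D * s powr (-p)) * ennreal (r powr (a * p - \<beta> - 1))"
        proof -
          have "r powr (-1 - \<beta>) * r powr (a * p) = r powr (a * p - \<beta> - 1)"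
            unfolding powr_add[symmetric] by (simp add: algebra_simps)
          then show ?thesis using D by (simp add: ennreal_mult[symmetric] mult_ac)
        qed
        finally show ?thesis using True by simp
      qed simp
    qed
    also have "\<dots> = ennreal (D * s powr (-p)) * (\<integral>\<^sup>+r. ennreal (indicator {0<..<2*T} r * r powr (a * p - \<beta> - 1)) \<partial>lborel)"
      by (rule nn_integral_cmult) measurable
    finally show ?thesis .
  qed
  have finite_powr: "(\<integral>\<^sup>+r. ennreal (indicator {0<..<2*T} r * r powr (q - 1)) \<partial>lborel) < \<infinity>" if "0 < q" for q
    using has_bochner_integral_powr_near_0[of q "2*T"] that T
    by (subst nn_integral_eq_integral) (auto simp: has_bochner_integral_iff)
  define J where "J = (\<integral>\<^sup>+r. ennreal (indicator {0<..<2*T} r * r powr (a * p - \<beta> - 1)) \<partial>lborel)"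
  have J: "J < \<infinity>" unfolding J_def using finite_powr[of "a * p - \<beta>"] p1 by simp
  have "(\<integral>\<^sup>+\<omega>. (\<integral>\<^sup>+s\<in>{0..T}. osc_mass \<beta> (?\<Delta> \<omega>) (2 * T) s \<partial>lborel) \<partial>M)
     = (\<integral>\<^sup>+s. (\<integral>\<^sup>+\<omega>. osc_mass \<beta> (?\<Delta> \<omega>) (2 * T) s * indicator {0..T} s \<partial>M) \<partial>lborel)"
    by (rule P.Fubini'[symmetric]) measurable
  also have "\<dots> \<le> (\<integral>\<^sup>+s. ennreal D * J * ennreal (indicator {0<..<2*T} s * s powr (1 - p - 1)) \<partial>lborel)"
  proof (rule nn_integral_mono_AE)
    show "AE s in lborel. (\<integral>\<^sup>+\<omega>. osc_mass \<beta> (?\<Delta> \<omega>) (2 * T) s * indicator {0..T} s \<partial>M)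
       \<le> ennreal D * J * ennreal (indicator {0<..<2*T} s * s powr (1 - p - 1))"
      using AE_lborel_singleton[of 0]
    proof eventually_elim
      fix s :: real assume "s \<noteq> 0"
      show "(\<integral>\<^sup>+\<omega>. osc_mass \<beta> (?\<Delta> \<omega>) (2 * T) s * indicator {0..T} s \<partial>M)
       \<le> ennreal D * J * ennreal (indicator {0<..<2*T} s * s powr (1 - p - 1))"
      proof (cases "s \<in> {0..T}")
        case True
        then have s: "0 < s" "s \<le> T" using \<open>s \<noteq> 0\<close> by auto
        have "ennreal (D * s powr (-p)) * J = ennreal D * J * ennreal (s powr (-p))"
          using D by (simp add: ennreal_mult mult_ac)
        then show ?thesis using section_le[OF s] s T unfolding J_def[symmetric] by simp
      qed simp
    qed
  qed
  also have "\<dots> = ennreal D * J * (\<integral>\<^sup>+s. ennreal (indicator {0<..<2*T} s * s powr (1 - p - 1)) \<partial>lborel)"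
    by (rule nn_integral_cmult) measurable
  also have "\<dots> < \<infinity>"
    using J finite_powr[of "1 - p"] p by (simp add: ennreal_mult_less_top)
  finally have "(\<integral>\<^sup>+\<omega>. (\<integral>\<^sup>+s\<in>{0..T}. osc_mass \<beta> (?\<Delta> \<omega>) (2 * T) s \<partial>lborel) \<partial>M) \<noteq> \<infinity>" by simp
  then have "AE \<omega> in M. (\<integral>\<^sup>+s\<in>{0..T}. osc_mass \<beta> (?\<Delta> \<omega>) (2 * T) s \<partial>lborel) \<noteq> \<infinity>"
    by (intro nn_integral_PInf_AE) measurable
  then show ?thesis by eventually_elim (simp add: less_top)
qed

end

section \<open>The convergence theorem\<close>

lemma set_lebesgue_integral_cong':
  fixes f g :: "real \<Rightarrow> 'b :: {banach, second_countable_topology}"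
  assumes "\<And>x. x \<in> A \<Longrightarrow> f x = g x"
  shows "set_lebesgue_integral M A f = set_lebesgue_integral M A g"
  unfolding set_lebesgue_integral_def
  by (rule Bochner_Integration.integral_cong[OF refl]) (use assms in \<open>auto simp: indicator_def\<close>)

lemma gls_integral_cong:
  assumes eq: "\<And>s. s \<in> {0..T} \<Longrightarrow> h s = h' s"
  shows "gls_integral \<beta> T h g = gls_integral \<beta> T h' g"
proof -
  have fd: "frac_deriv_0plus \<beta> h s = frac_deriv_0plus \<beta> h' s" if s: "s \<in> {0..T}" for s
  proof -
    have "(LINT u:{0..s}|lebesgue. (h s - h u) / (s - u) powr (\<beta> + 1))
       = (LINT u:{0..s}|lebesgue. (h' s - h' u) / (s - u) powr (\<beta> + 1))"
      by (rule set_lebesgue_integral_cong') (use eq s in auto)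
    then show ?thesis unfolding frac_deriv_0plus_def using eq[OF s] by simp
  qed
  show ?thesis
    unfolding gls_integral_def by (intro arg_cong2[where f="(*)"] refl set_lebesgue_integral_cong') (simp add: fd)
qed

lemma besov2_norm_cong:
  assumes eq: "\<And>s. s \<in> {0..T} \<Longrightarrow> h s = h' s"
  shows "besov2_norm T \<beta> h = besov2_norm T \<beta> h'"
proof -
  have inner: "(\<integral>\<^sup>+u\<in>{0..s}. ennreal (\<bar>h u - h s\<bar> / (s - u) powr (1 + \<beta>)) \<partial>lebesgue)
     = (\<integral>\<^sup>+u\<in>{0..s}. ennreal (\<bar>h' u - h' s\<bar> / (s - u) powr (1 + \<beta>)) \<partial>lebesgue)" if s: "s \<in> {0..T}" for s
    by (rule nn_integral_cong) (use eq s in \<open>auto simp: indicator_def\<close>)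
  have 1: "(\<integral>\<^sup>+s\<in>{0..T}. ennreal (\<bar>h s\<bar> / s powr \<beta>) \<partial>lebesgue) = (\<integral>\<^sup>+s\<in>{0..T}. ennreal (\<bar>h' s\<bar> / s powr \<beta>) \<partial>lebesgue)"
    by (rule nn_integral_cong) (use eq in \<open>auto simp: indicator_def\<close>)
  have 2: "(\<integral>\<^sup>+s\<in>{0..T}. (\<integral>\<^sup>+u\<in>{0..s}. ennreal (\<bar>h u - h s\<bar> / (s - u) powr (1 + \<beta>)) \<partial>lebesgue) \<partial>lebesgue)
     = (\<integral>\<^sup>+s\<in>{0..T}. (\<integral>\<^sup>+u\<in>{0..s}. ennreal (\<bar>h' u - h' s\<bar> / (s - u) powr (1 + \<beta>)) \<partial>lebesgue) \<partial>lebesgue)"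
  proof (rule nn_integral_cong)
    fix s :: real
    show "(\<integral>\<^sup>+u\<in>{0..s}. ennreal (\<bar>h u - h s\<bar> / (s - u) powr (1 + \<beta>)) \<partial>lebesgue) * indicator {0..T} s
      = (\<integral>\<^sup>+u\<in>{0..s}. ennreal (\<bar>h' u - h' s\<bar> / (s - u) powr (1 + \<beta>)) \<partial>lebesgue) * indicator {0..T} s"
      using inner[of s] by (cases "s \<in> {0..T}") simp_all
  qed
  show ?thesis unfolding besov2_norm_def 1 2 ..
qed

lemma besov2I_borel:
  assumes "h' \<in> borel_measurable borel" "besov2_norm T \<beta> h' < \<infinity>"
    and eq: "\<And>s. s \<in> {0..T} \<Longrightarrow> h s = h' s"
  shows "h \<in> besov2 T \<beta>"
proof -
  have "h' \<in> borel_measurable lebesgue" using assms(1) by (intro measurable_completion) simp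
  then have "h' \<in> borel_measurable (lebesgue_on {0..T})" by (rule measurable_restrict_space1)
  then have "h \<in> borel_measurable (lebesgue_on {0..T})"
    by (rule measurable_cong[THEN iffD1, rotated]) (use eq in auto)
  then show ?thesis using assms(2) besov2_norm_cong[OF eq] unfolding besov2_def by simp
qed

text \<open>
A path value at distance \<open>r\<close> from \<open>s\<close> lies in \<open>[x s - K r\<^sup>a, x s + K r\<^sup>a]\<close>, and over this interval
a monotone function varies by the difference of its values at the ends.
\<close>

lemma holder_path_dominated_oscillation:
  fixes x :: "real \<Rightarrow> real"
  assumes T: "0 < T" and \<beta>: "0 < \<beta>" "\<beta> < 1"
    and x: "continuous_on UNIV x" "\<And>s. s \<in> {0..T} \<Longrightarrow> \<bar>x s\<bar> \<le> N" "0 \<le> N"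
    and K: "0 \<le> K" "\<And>s t. s \<in> {0..T} \<Longrightarrow> t \<in> {0..T} \<Longrightarrow> \<bar>x t - x s\<bar> \<le> K * \<bar>t - s\<bar> powr a" and a: "0 < a"
    and m: "mono m" and d: "d \<in> borel_measurable borel" "\<And>y z. \<bar>d y - d z\<bar> \<le> \<bar>m y - m z\<bar>"
    and fin: "(\<integral>\<^sup>+s\<in>{0..T}. osc_mass \<beta>
       (\<lambda>s r. clamp_fun m N (x s + K * r powr a) - clamp_fun m N (x s - K * r powr a)) (2 * T) s \<partial>lborel) < \<infinity>"
  shows "dominated_oscillation T \<beta> (\<lambda>s. d (x s))
       (\<lambda>s r. clamp_fun m N (x s + K * r powr a) - clamp_fun m N (x s - K * r powr a))"
proof
  note props = clamp_fun_props[OF m x(3)]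
  note mono = monoD[OF props(1)]
  have [measurable]: "x \<in> borel_measurable borel" "clamp_fun m N \<in> borel_measurable borel" "d \<in> borel_measurable borel"
    using borel_measurable_continuous_onI[OF x(1)] props(2) d(1) by auto
  show "(\<lambda>s. d (x s)) \<in> borel_measurable borel" by measurable
  show "(\<lambda>(s, r). clamp_fun m N (x s + K * r powr a) - clamp_fun m N (x s - K * r powr a)) \<in> borel_measurable (borel \<Otimes>\<^sub>M borel)"
    by measurable
  fix s r r' :: real
  assume r: "0 < r"
  have "0 \<le> K * r powr a" using K(1) by simp
  then show "0 \<le> clamp_fun m N (x s + K * r powr a) - clamp_fun m N (x s - K * r powr a)"
    using mono[of "x s - K * r powr a" "x s + K * r powr a"] by linarith
  assume rr: "r \<le> r'"
  have "K * r powr a \<le> K * r' powr a" using K(1) r rr a by (intro mult_left_mono powr_mono2) auto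
  then show "clamp_fun m N (x s + K * r powr a) - clamp_fun m N (x s - K * r powr a)
     \<le> clamp_fun m N (x s + K * r' powr a) - clamp_fun m N (x s - K * r' powr a)"
    using mono[of "x s + K * r powr a" "x s + K * r' powr a"] mono[of "x s - K * r' powr a" "x s - K * r powr a"] by linarith
next
  note props = clamp_fun_props[OF m x(3)]
  note mono = monoD[OF props(1)]
  fix s t assume s: "s \<in> {0..T}" and t: "t \<in> {0..T}"
  let ?r = "K * \<bar>s - t\<bar> powr a"
  have near: "\<bar>x s - x t\<bar> \<le> ?r" using K(2)[OF t s] .
  have "\<bar>d (x s) - d (x t)\<bar> \<le> \<bar>m (x s) - m (x t)\<bar>" by (rule d(2))
  also have "\<dots> = \<bar>clamp_fun m N (x s) - clamp_fun m N (x t)\<bar>"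
    using props(4)[OF x(2)[OF s]] props(4)[OF x(2)[OF t]] by simp
  also have "\<dots> \<le> clamp_fun m N (x s + ?r) - clamp_fun m N (x s - ?r)"
    using mono[of "x s - ?r" "x s"] mono[of "x s" "x s + ?r"] mono[of "x s - ?r" "x t"] mono[of "x t" "x s + ?r"] near
    by linarith
  finally show "\<bar>d (x s) - d (x t)\<bar> \<le> clamp_fun m N (x s + ?r) - clamp_fun m N (x s - ?r)" .
next
  have "\<bar>d (x s)\<bar> \<le> \<bar>d 0\<bar> + (\<bar>m N\<bar> + \<bar>m (-N)\<bar>) + \<bar>m 0\<bar>" if s: "s \<in> {0..T}" for s
  proof -
    have "m (-N) \<le> m (x s)" "m (x s) \<le> m N" using x(2)[OF s] by (auto intro!: monoD[OF m])
    then show ?thesis using d(2)[of "x s" 0] by linarith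
  qed
  then show "\<exists>B. \<forall>s\<in>{0..T}. \<bar>d (x s)\<bar> \<le> B" by blast
qed (use T \<beta> fin in auto)

theorem theorem3p3:
  fixes M :: "'a measure"
    and X Y :: "real \<Rightarrow> 'a \<Rightarrow> real"
    and f :: "real \<Rightarrow> real"
    and T \<alpha> \<beta> :: real
    and k :: "nat \<Rightarrow> nat"
    and u :: "nat \<Rightarrow> nat \<Rightarrow> real"
  assumes "prob_space M"
    and "T > 0"
    and "lin_comb_convex f"
    and "0 < \<alpha>" and "\<alpha> < 1" and "\<alpha> > 1/3"
    and "class_X M T \<alpha> X"
    and "0 < \<beta>" and "\<beta> < min \<alpha> (3 * \<alpha> - 1)"
    and "\<And>t. t \<in> {0..T} \<Longrightarrow> Y t \<in> borel_measurable M"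
    and "AE \<omega> in M. (\<lambda>t. Y t \<omega>) \<in> besov1 T (1 - \<beta>)"
    and "\<And>n. is_partition T (k n) (u n)"
    and "(\<lambda>n. mesh (k n) (u n)) \<longlonglongrightarrow> 0"
  shows "AE \<omega> in M.
           (\<lambda>s. left_deriv f (X s \<omega>)) \<in> besov2 T \<beta> \<and>
           (\<lambda>n. complex_of_real (\<Sum>j<k n. left_deriv f (X (u n j) \<omega>) * (Y (u n (Suc j)) \<omega> - Y (u n j) \<omega>)))
             \<longlonglongrightarrow> gls_integral \<beta> T (\<lambda>s. left_deriv f (X s \<omega>)) (\<lambda>s. Y s \<omega>)"
proof -
  interpret gaussian_class_X M X T \<alpha>
    using assms by (intro gaussian_class_X.intro gaussian_class_X_axioms.intro)
  have \<beta>: "0 < \<beta>" "\<beta> < \<alpha>" "\<beta> < 1" using assms by auto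
  obtain a where a: "\<beta> < a" "a < \<alpha>" using dense[OF \<beta>(2)] by blast
  have a0: "0 < a" using a \<beta> by linarith
  obtain m where m: "mono m" and dm: "\<And>x y. \<bar>left_deriv f x - left_deriv f y\<bar> \<le> \<bar>m x - m y\<bar>"
    using left_deriv_lin_comb_convex(1)[OF assms(3)] by blast
  have meas: "left_deriv f \<in> borel_measurable borel" by (rule left_deriv_lin_comb_convex(2)[OF assms(3)])
  \<comment> \<open>The bounds \<open>N\<close> and \<open>K\<close> depend on the path; countably many suffice.\<close>
  have mass: "AE \<omega> in M. \<forall>N K :: nat. (\<integral>\<^sup>+s\<in>{0..T}. osc_mass \<beta> (osc_bound (clamp_fun m (real N)) (real K) a \<omega>) (2 * T) s \<partial>lborel) < \<infinity>"
    unfolding AE_all_countable by (intro allI AE_osc_mass_finite m \<beta> a) auto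
  show ?thesis
    using AE_space Xc_AE mass AE_holder_paths[OF a0 a(2)] assms(11)
  proof eventually_elim
    fix \<omega>
    assume \<omega>: "\<omega> \<in> space M" and Xc: "\<forall>t\<in>{0..T}. Xc t \<omega> = X t \<omega>"
      and mass: "\<forall>N K :: nat. (\<integral>\<^sup>+s\<in>{0..T}. osc_mass \<beta> (osc_bound (clamp_fun m (real N)) (real K) a \<omega>) (2 * T) s \<partial>lborel) < \<infinity>"
      and hol: "\<exists>K\<ge>0. \<forall>s\<in>{0..T}. \<forall>t\<in>{0..T}. \<bar>X t \<omega> - X s \<omega>\<bar> \<le> K * \<bar>t - s\<bar> powr a"
      and Y: "(\<lambda>t. Y t \<omega>) \<in> besov1 T (1 - \<beta>)"
    let ?x = "\<lambda>t. Xc t \<omega>"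
    have cont: "continuous_on UNIV ?x" by (rule Xc_continuous[OF \<omega>])
    have "compact (?x ` {0..T})" by (intro compact_continuous_image continuous_on_subset[OF cont]) auto
    then have "bounded (?x ` {0..T})" by (rule compact_imp_bounded)
    then obtain N0 where N0: "\<forall>y\<in>?x ` {0..T}. norm y \<le> N0" unfolding bounded_iff ..
    obtain N :: nat where "N0 \<le> real N" using real_arch_simple by blast
    have N: "\<bar>?x s\<bar> \<le> real N" if "s \<in> {0..T}" for s
      using bspec[OF N0 imageI[OF that]] \<open>N0 \<le> real N\<close> by simp
    from hol obtain K0 where "K0 \<ge> 0 \<and> (\<forall>s\<in>{0..T}. \<forall>t\<in>{0..T}. \<bar>X t \<omega> - X s \<omega>\<bar> \<le> K0 * \<bar>t - s\<bar> powr a)" ..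
    then have K0: "\<forall>s\<in>{0..T}. \<forall>t\<in>{0..T}. \<bar>X t \<omega> - X s \<omega>\<bar> \<le> K0 * \<bar>t - s\<bar> powr a" ..
    obtain K :: nat where "K0 \<le> real K" using real_arch_simple by blast
    have K: "\<bar>?x t - ?x s\<bar> \<le> real K * \<bar>t - s\<bar> powr a" if s: "s \<in> {0..T}" and t: "t \<in> {0..T}" for s t
    proof -
      have "\<bar>X t \<omega> - X s \<omega>\<bar> \<le> K0 * \<bar>t - s\<bar> powr a" using K0 s t by blast
      also have "\<dots> \<le> real K * \<bar>t - s\<bar> powr a" by (rule mult_right_mono[OF \<open>K0 \<le> real K\<close>]) simp
      finally show ?thesis using Xc s t by simp
    qed
    interpret D: dominated_oscillation T \<beta> "\<lambda>s. left_deriv f (?x s)"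
      "\<lambda>s r. clamp_fun m (real N) (?x s + real K * r powr a) - clamp_fun m (real N) (?x s - real K * r powr a)"
    proof (rule holder_path_dominated_oscillation[OF T \<beta>(1,3) cont N _ _ K a0 m meas dm])
      show "(\<integral>\<^sup>+s\<in>{0..T}. osc_mass \<beta> (\<lambda>s r. clamp_fun m (real N) (?x s + real K * r powr a)
          - clamp_fun m (real N) (?x s - real K * r powr a)) (2 * T) s \<partial>lborel) < \<infinity>"
        using mass unfolding osc_bound_def by blast
    qed auto
    have eq: "left_deriv f (X s \<omega>) = left_deriv f (?x s)" if "s \<in> {0..T}" for s
      using Xc that by simp
    have "(\<lambda>s. left_deriv f (X s \<omega>)) \<in> besov2 T \<beta>"
      by (rule besov2I_borel[OF D.meas_h D.besov2_norm_finite eq])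
    moreover have "(\<lambda>n. complex_of_real (\<Sum>j<k n. left_deriv f (X (u n j) \<omega>) * (Y (u n (Suc j)) \<omega> - Y (u n j) \<omega>)))
             \<longlonglongrightarrow> gls_integral \<beta> T (\<lambda>s. left_deriv f (X s \<omega>)) (\<lambda>s. Y s \<omega>)"
    proof -
      have "(\<Sum>j<k n. left_deriv f (X (u n j) \<omega>) * (Y (u n (Suc j)) \<omega> - Y (u n j) \<omega>))
         = (\<Sum>j<k n. left_deriv f (?x (u n j)) * (Y (u n (Suc j)) \<omega> - Y (u n j) \<omega>))" for n
      proof (rule sum.cong[OF refl])
        fix j assume "j \<in> {..<k n}"
        then have "u n j \<in> {0..T}" using partition_mesh(4)[OF assms(12) T, of j n] by simp
        then show "left_deriv f (X (u n j) \<omega>) * (Y (u n (Suc j)) \<omega> - Y (u n j) \<omega>)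
          = left_deriv f (?x (u n j)) * (Y (u n (Suc j)) \<omega> - Y (u n j) \<omega>)" by (simp add: eq)
      qed
      moreover have "gls_integral \<beta> T (\<lambda>s. left_deriv f (X s \<omega>)) (\<lambda>s. Y s \<omega>)
         = gls_integral \<beta> T (\<lambda>s. left_deriv f (?x s)) (\<lambda>s. Y s \<omega>)"
        by (rule gls_integral_cong) (rule eq)
      ultimately show ?thesis
        using D.riemann_sums_converge[OF Y assms(12,13)] by (simp only:)
    qed
    ultimately show "(\<lambda>s. left_deriv f (X s \<omega>)) \<in> besov2 T \<beta> \<and>
           (\<lambda>n. complex_of_real (\<Sum>j<k n. left_deriv f (X (u n j) \<omega>) * (Y (u n (Suc j)) \<omega> - Y (u n j) \<omega>)))
             \<longlonglongrightarrow> gls_integral \<beta> T (\<lambda>s. left_deriv f (X s \<omega>)) (\<lambda>s. Y s \<omega>)" ..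
  qed
qed

end
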